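(* Let $F$ be a Markov multi-map of $[0,1]$ belonging to the class $\mathcal{F}$, with trajectory space $X$ and associated shift of finite type $\Sigma_M$. Then $(X,\sigma_X)$ is Borel entropy conjugate to $(\Sigma_M,\sigma_M)$.
   Context: **Markov multi-maps.** A Markov multi-map $F$ of $[0,1]$ is defined by a tuple $(P,\mathcal{A}_0,\mathcal{A}_1,\mathcal{A}_2,D,R,\{f_a\}_{a\in\mathcal{A}_0})$ such that: (1) $P=\{p_0,\dots,p_r\}$ with $0=p_0<\dots<p_r=1$; (2) $\mathcal{A}=\mathcal{A}_0\sqcup\mathcal{A}_1\sqcup\mathcal{A}_2$ is a finite set; (3) $D$ assigns to each $a\in\mathcal{A}$ a closed set $D(a)$, where for some $i$, $D(a)=[p_i,p_{i+1}]$ if $a\in\mathcal{A}_0$ and $D(a)=\{p_i\}$ if $a\in\mathcal{A}_1\cup\mathcal{A}_2$; (4) $R$ assigns to each $a\in\mathcal{A}$ a set $R(a)=[u,v]$ with $u\le v$ in $P$, where $u<v$ if $a\in\mathcal{A}_0$; $u<v$ and $R(a)\cap P=\{u,v\}$ if $a\in\mathcal{A}_1$; $u=v$ if $a\in\mathcal{A}_2$; (5) for $a\in\mathcal{A}_0$, $f_a:D(a)\to R(a)$ is a homeomorphism; (6) $[0,1]\subset\bigcup_{a\in\mathcal{A}}D(a)$. **Graphs.** For $a\in\mathcal{A}_0$, $G(a)$ is the graph of $f_a$; for $a\in\mathcal{A}_1\cup\mathcal{A}_2$, $G(a)=D(a)\times R(a)$. $G(F)=\bigcup_{a\in\mathcal{A}}G(a)$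 and $F(x)=\{y:(x,y)\in G(F)\}$. For $a\in\mathcal{A}_0$ with $D(a)=[p_i,p_{i+1}]$, $R(a)=[u,v]$: $D_0(a)=(p_i,p_{i+1})$, $R_0(a)=(u,v)$, and $G_0(a)$ is the graph of $f_a|_{D_0(a)}$. For $a\in\mathcal{A}_1$ with $D(a)=\{p\}$, $R(a)=[u,v]$: $D_0(a)=\{p\}$, $R_0(a)=(u,v)$, $G_0(a)=\{p\}\times(u,v)$. For $a\in\mathcal{A}_2$ with $D(a)=\{p\}$, $R(a)=\{q\}$: $D_0(a)=\{p\}$, $R_0(a)=\{q\}$, $G_0(a)=\{(p,q)\}$. $F$ is *properly parametrized* if the sets $G_0(a)$, $a\in\mathcal{A}$, form a partition of $G(F)$ (disjoint for distinct $a$, with union $G(F)$). **Trajectory space.** $X=\{(x_n)_{n\ge0}\in[0,1]^{\mathbb{Z}_+}: x_{n+1}\in F(x_n)\ \forall n\ge 0\}$ with the product topology; $\sigma_X$ is the left shift on $X$. **Associated SFT.** $M$ is the $0$-$1$ matrix indexed by $\mathcal{A}$ with $M(a,b)=1$ iff $D_0(b)\subset R_0(a)$. $\Sigma_M=\{\mathbf{a}\in\mathcal{A}^{\mathbb{Z}_+}: M(a_n,a_{n+1})=1\ \forall n\ge 0\}$, with left shift $\sigma_M$. $\mathcal{L}_n$ is the set of words $a_0\dots a_n\in\mathcal{A}^{n+1}$ with $M(a_i,a_{i+1})=1$ for $0\le i<n$; $\mathcal{L}=\bigcup_{n\ge0}\mathcal{L}_n$; $[u]$ denotes the set of points of $\Sigma_M$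 beginning with the word $u$. The irreducible components $\mathcal{C}\subset\mathcal{A}$ are the vertex sets of the maximal strongly connected components of the directed graph with adjacency matrix $M$; $\Sigma_M(\mathcal{C})$ is the set of points of $\Sigma_M$ using only symbols of $\mathcal{C}$, $\mathcal{L}(\mathcal{C})$ is the set of words in $\mathcal{L}$ using only symbols of $\mathcal{C}$, and $\mathcal{C}$ has positive entropy if $\Sigma_M(\mathcal{C})$ has positive topological entropy. **Intervals.** For $a\in\mathcal{A}_0$, $f_a^{-1}:R(a)\to D(a)$ is the inverse of $f_a$; for $a\in\mathcal{A}_1\cup\mathcal{A}_2$, $f_a^{-1}:R(a)\to D(a)$ is the unique (constant) map. For $a_0\dots a_n\in\mathcal{L}_n$, $I_{a_0\dots a_n}=f_{a_0}^{-1}\circ\dots\circ f_{a_{n-1}}^{-1}(D(a_n))$; for $\mathbf{a}\in\Sigma_M$, $I_{\mathbf{a}}=\bigcap_{n\ge1}I_{a_0\dots a_n}$. **Class $\mathcal{F}$.** A *coding word* for a component $\mathcal{C}$ is $u\in\mathcal{L}(\mathcal{C})$ such that if $\mathbf{a}\in\Sigma_M(\mathcal{C})$ and $\{n\ge0:\sigma_M^n(\mathbf{a})\in[u]\}$ is infinite, then $I_{\mathbf{a}}$ is a singleton. An *avoiding word* for $\mathcal{C}$ is $u\in\mathcal{L}(\mathcal{C})$ such that $\mathbf{a}\in[u]$ implies $I_{\mathbf{a}}\cap P=\varnothing$. $\mathcal{F}$ is the class of all properly parametrized Markov multi-maps such that every irreducible component with positive entropy has a coding word, every irreducible component with positive entropy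 contained in $\mathcal{A}_0$ has an avoiding word, and $\Sigma_M$ has positive topological entropy. **Borel entropy conjugacy.** For a topological dynamical system $(\mathcal{X},T)$ (continuous self-map of a compact metrizable space) and Borel $E\subset\mathcal{X}$, $h_{prob}(E)=\sup\{h(\mu):\mu \text{ ergodic } T\text{-invariant Borel probability measure},\ \mu(E)>0\}$, where $h(\mu)$ is measure-theoretic entropy. Systems $(\mathcal{X}_0,T_0)$, $(\mathcal{X}_1,T_1)$ are *Borel entropy conjugate* if there exist Borel sets $E_i\subset\mathcal{X}_i$ and an invertible Borel bi-measurable map $\psi:\mathcal{X}_0\setminus E_0\to\mathcal{X}_1\setminus E_1$ such that $h_{prob}(E_i)<h_{top}(\mathcal{X}_i,T_i)$ for $i=0,1$ and $\psi\circ T_0=T_1\circ\psi$ on $\mathcal{X}_0\setminus E_0$. *)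

theory Defs
  imports
    "Graph_Theory.Pair_Digraph"
    "Graph_Theory.Digraph_Component"
    "HOL-Library.Disjoint_Sets"
    "HOL-Probability.Probability"
begin

section \<open>Topological dynamical systems and entropy\<close>

definition tds :: "'x topology \<Rightarrow> ('x \<Rightarrow> 'x) \<Rightarrow> bool" where
  "tds X T \<longleftrightarrow> compact_space X \<and> metrizable_space X \<and> continuous_map X X T"

definition borel_of_top :: "'x topology \<Rightarrow> 'x measure" where
  "borel_of_top X = sigma (topspace X) {U. openin X U}"

text \<open>All entropies are \<^typ>\<open>ennreal\<close>-valued and use natural logarithms. In
  particular, a supremum over the empty set is 0. The common refinement
  of the preimages of \<open>\<U>\<close> under \<open>T\<^sup>i\<close>, \<open>i < n\<close>, below, is used both for open covers and for
  measurable partitions; in the latter case it may contain the empty set, which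
  contributes \<open>0 * ln 0 = 0\<close> to the Shannon entropy.\<close>

definition dyn_join :: "'x set \<Rightarrow> ('x \<Rightarrow> 'x) \<Rightarrow> nat \<Rightarrow> 'x set set \<Rightarrow> 'x set set" where
  "dyn_join S T n \<U> = {S \<inter> (\<Inter>i<n. (T ^^ i) -` V i) | V. \<forall>i<n. V i \<in> \<U>}"

definition open_cover :: "'x topology \<Rightarrow> 'x set set \<Rightarrow> bool" where
  "open_cover X \<U> \<longleftrightarrow> (\<forall>U\<in>\<U>. openin X U) \<and> \<Union>\<U> = topspace X"

definition min_subcover_card :: "'x topology \<Rightarrow> 'x set set \<Rightarrow> nat" where
  "min_subcover_card X \<U> =
    (LEAST k. \<exists>\<V>\<subseteq>\<U>. finite \<V> \<and> \<Union>\<V> = topspace X \<and> card \<V> = k)"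

text \<open>The limits defining the two entropies exist by subadditivity, so that the upper
  limits below are limits.\<close>

definition cover_entropy :: "'x topology \<Rightarrow> ('x \<Rightarrow> 'x) \<Rightarrow> 'x set set \<Rightarrow> ennreal" where
  "cover_entropy X T \<U> =
    limsup (\<lambda>n. ennreal (ln (real (min_subcover_card X (dyn_join (topspace X) T n \<U>))) / real n))"

definition h_top :: "'x topology \<Rightarrow> ('x \<Rightarrow> 'x) \<Rightarrow> ennreal" where
  "h_top X T = (SUP \<U>\<in>{\<U>. open_cover X \<U>}. cover_entropy X T \<U>)"

definition shannon_entropy :: "'x measure \<Rightarrow> 'x set set \<Rightarrow> real" where
  "shannon_entropy \<mu> \<xi> = - (\<Sum>B\<in>\<xi>. measure \<mu> B * ln (measure \<mu> B))"

definition finite_partition :: "'x measure \<Rightarrow> 'x set set \<Rightarrow> bool" where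
  "finite_partition \<mu> \<xi> \<longleftrightarrow> finite \<xi> \<and> partition_on (space \<mu>) \<xi> \<and> \<xi> \<subseteq> sets \<mu>"

definition partition_entropy :: "'x measure \<Rightarrow> ('x \<Rightarrow> 'x) \<Rightarrow> 'x set set \<Rightarrow> ennreal" where
  "partition_entropy \<mu> T \<xi> =
    limsup (\<lambda>n. ennreal (shannon_entropy \<mu> (dyn_join (space \<mu>) T n \<xi>) / real n))"

definition h_measure :: "'x measure \<Rightarrow> ('x \<Rightarrow> 'x) \<Rightarrow> ennreal" where
  "h_measure \<mu> T = (SUP \<xi>\<in>{\<xi>. finite_partition \<mu> \<xi>}. partition_entropy \<mu> T \<xi>)"

definition invariant_prob :: "'x topology \<Rightarrow> ('x \<Rightarrow> 'x) \<Rightarrow> 'x measure \<Rightarrow> bool" where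
  "invariant_prob X T \<mu> \<longleftrightarrow>
    prob_space \<mu> \<and> space \<mu> = topspace X \<and> sets \<mu> = sets (borel_of_top X) \<and>
    T \<in> measurable \<mu> \<mu> \<and> distr \<mu> \<mu> T = \<mu>"

definition ergodic_prob :: "'x topology \<Rightarrow> ('x \<Rightarrow> 'x) \<Rightarrow> 'x measure \<Rightarrow> bool" where
  "ergodic_prob X T \<mu> \<longleftrightarrow>
    invariant_prob X T \<mu> \<and>
    (\<forall>B\<in>sets \<mu>. T -` B \<inter> space \<mu> = B \<longrightarrow> measure \<mu> B = 0 \<or> measure \<mu> B = 1)"

definition h_prob :: "'x topology \<Rightarrow> ('x \<Rightarrow> 'x) \<Rightarrow> 'x set \<Rightarrow> ennreal" where
  "h_prob X T E = (SUP \<mu>\<in>{\<mu>. ergodic_prob X T \<mu> \<and> measure \<mu> E > 0}. h_measure \<mu> T)"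

text \<open>For \<open>\<psi> \<circ> T\<^sub>0\<close> to make sense on \<open>X\<^sub>0 - E\<^sub>0\<close>, this set has to be mapped into itself by
  \<open>T\<^sub>0\<close>; since \<open>\<psi>\<close> is a total function here, this is stated explicitly.\<close>

definition borel_entropy_conjugate ::
  "'x topology \<Rightarrow> ('x \<Rightarrow> 'x) \<Rightarrow> 'y topology \<Rightarrow> ('y \<Rightarrow> 'y) \<Rightarrow> bool" where
  "borel_entropy_conjugate X\<^sub>0 T\<^sub>0 X\<^sub>1 T\<^sub>1 \<longleftrightarrow>
    tds X\<^sub>0 T\<^sub>0 \<and> tds X\<^sub>1 T\<^sub>1 \<and>
    (\<exists>E\<^sub>0 E\<^sub>1 \<psi>.
      E\<^sub>0 \<in> sets (borel_of_top X\<^sub>0) \<and> E\<^sub>1 \<in> sets (borel_of_top X\<^sub>1) \<and>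
      bij_betw \<psi> (topspace X\<^sub>0 - E\<^sub>0) (topspace X\<^sub>1 - E\<^sub>1) \<and>
      \<psi> \<in> measurable (restrict_space (borel_of_top X\<^sub>0) (topspace X\<^sub>0 - E\<^sub>0))
                     (restrict_space (borel_of_top X\<^sub>1) (topspace X\<^sub>1 - E\<^sub>1)) \<and>
      inv_into (topspace X\<^sub>0 - E\<^sub>0) \<psi>
        \<in> measurable (restrict_space (borel_of_top X\<^sub>1) (topspace X\<^sub>1 - E\<^sub>1))
                     (restrict_space (borel_of_top X\<^sub>0) (topspace X\<^sub>0 - E\<^sub>0)) \<and>
      h_prob X\<^sub>0 T\<^sub>0 E\<^sub>0 < h_top X\<^sub>0 T\<^sub>0 \<and>
      h_prob X\<^sub>1 T\<^sub>1 E\<^sub>1 < h_top X\<^sub>1 T\<^sub>1 \<and>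
      (\<forall>x\<in>topspace X\<^sub>0 - E\<^sub>0. T\<^sub>0 x \<in> topspace X\<^sub>0 - E\<^sub>0 \<and> \<psi> (T\<^sub>0 x) = T\<^sub>1 (\<psi> x)))"

definition lshift :: "(nat \<Rightarrow> 'b) \<Rightarrow> nat \<Rightarrow> 'b" where
  "lshift x = (\<lambda>n. x (Suc n))"


section \<open>Markov multi-maps\<close>

text \<open>The partition points are \<open>pt F 0 < \<dots> < pt F (nparts F)\<close>; the values of \<open>pt\<close>, \<open>sdom\<close>,
  \<open>srng\<close> and \<open>fmap\<close> outside the relevant index sets (and of \<open>fmap F a\<close> outside \<open>dom F a\<close>) are
  irrelevant.\<close>

record 'a markov_tuple =
  nparts :: nat
  pt :: "nat \<Rightarrow> real"
  sym0 :: "'a set"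
  sym1 :: "'a set"
  sym2 :: "'a set"
  sdom :: "'a \<Rightarrow> real set"
  srng :: "'a \<Rightarrow> real set"
  fmap :: "'a \<Rightarrow> real \<Rightarrow> real"

definition pts :: "'a markov_tuple \<Rightarrow> real set" where
  "pts F = pt F ` {..nparts F}"

definition syms :: "'a markov_tuple \<Rightarrow> 'a set" where
  "syms F = sym0 F \<union> sym1 F \<union> sym2 F"

definition markov_multi_map :: "'a markov_tuple \<Rightarrow> bool" where
  "markov_multi_map F \<longleftrightarrow>
    pt F 0 = 0 \<and> pt F (nparts F) = 1 \<and> (\<forall>i<nparts F. pt F i < pt F (Suc i)) \<and>
    finite (syms F) \<and>
    sym0 F \<inter> sym1 F = {} \<and> sym0 F \<inter> sym2 F = {} \<and> sym1 F \<inter> sym2 F = {} \<and>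
    (\<forall>a\<in>sym0 F. \<exists>i<nparts F. sdom F a = {pt F i..pt F (Suc i)}) \<and>
    (\<forall>a\<in>sym1 F \<union> sym2 F. \<exists>i\<le>nparts F. sdom F a = {pt F i}) \<and>
    (\<forall>a\<in>sym0 F. \<exists>u\<in>pts F. \<exists>v\<in>pts F. u < v \<and> srng F a = {u..v}) \<and>
    (\<forall>a\<in>sym1 F. \<exists>u\<in>pts F. \<exists>v\<in>pts F. u < v \<and> srng F a = {u..v} \<and> srng F a \<inter> pts F = {u, v}) \<and>
    (\<forall>a\<in>sym2 F. \<exists>u\<in>pts F. srng F a = {u}) \<and>
    (\<forall>a\<in>sym0 F. \<exists>g. homeomorphism (sdom F a) (srng F a) (fmap F a) g) \<and>
    {0..1} \<subseteq> (\<Union>a\<in>syms F. sdom F a)"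

definition graph_sym :: "'a markov_tuple \<Rightarrow> 'a \<Rightarrow> (real \<times> real) set" where
  "graph_sym F a =
    (if a \<in> sym0 F then (\<lambda>x. (x, fmap F a x)) ` sdom F a else sdom F a \<times> srng F a)"

definition graph_mm :: "'a markov_tuple \<Rightarrow> (real \<times> real) set" where
  "graph_mm F = (\<Union>a\<in>syms F. graph_sym F a)"

definition mm_apply :: "'a markov_tuple \<Rightarrow> real \<Rightarrow> real set" where
  "mm_apply F x = {y. (x, y) \<in> graph_mm F}"

text \<open>The interior of \<open>[u, v]\<close> in the real line is \<open>(u, v)\<close>, also if \<open>u = 0\<close> or \<open>v = 1\<close>.\<close>

definition sdom0 :: "'a markov_tuple \<Rightarrow> 'a \<Rightarrow> real set" where
  "sdom0 F a = (if a \<in> sym0 F then interior (sdom F a) else sdom F a)"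

definition srng0 :: "'a markov_tuple \<Rightarrow> 'a \<Rightarrow> real set" where
  "srng0 F a = (if a \<in> sym0 F \<union> sym1 F then interior (srng F a) else srng F a)"

definition graph0_sym :: "'a markov_tuple \<Rightarrow> 'a \<Rightarrow> (real \<times> real) set" where
  "graph0_sym F a =
    (if a \<in> sym0 F then (\<lambda>x. (x, fmap F a x)) ` sdom0 F a else sdom0 F a \<times> srng0 F a)"

definition properly_parametrized :: "'a markov_tuple \<Rightarrow> bool" where
  "properly_parametrized F \<longleftrightarrow>
    disjoint_family_on (graph0_sym F) (syms F) \<and> (\<Union>a\<in>syms F. graph0_sym F a) = graph_mm F"

definition trajectories :: "'a markov_tuple \<Rightarrow> (nat \<Rightarrow> real) set" where
  "trajectories F = {x. (\<forall>n. x n \<in> {0..1}) \<and> (\<forall>n. x (Suc n) \<in> mm_apply F (x n))}"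

definition trajectory_space :: "'a markov_tuple \<Rightarrow> (nat \<Rightarrow> real) topology" where
  "trajectory_space F =
    subtopology (product_topology (\<lambda>_. top_of_set {0..1}) UNIV) (trajectories F)"


section \<open>The associated shift of finite type\<close>

definition trans_mat :: "'a markov_tuple \<Rightarrow> 'a \<Rightarrow> 'a \<Rightarrow> nat" where
  "trans_mat F a b = (if sdom0 F b \<subseteq> srng0 F a then 1 else 0)"

definition sft :: "'a markov_tuple \<Rightarrow> (nat \<Rightarrow> 'a) set" where
  "sft F = {x. (\<forall>n. x n \<in> syms F) \<and> (\<forall>n. trans_mat F (x n) (x (Suc n)) = 1)}"

definition sft_restr :: "'a markov_tuple \<Rightarrow> 'a set \<Rightarrow> (nat \<Rightarrow> 'a) set" where
  "sft_restr F C = {x \<in> sft F. \<forall>n. x n \<in> C}"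

definition symbolic_space :: "'a markov_tuple \<Rightarrow> (nat \<Rightarrow> 'a) set \<Rightarrow> (nat \<Rightarrow> 'a) topology" where
  "symbolic_space F S =
    subtopology (product_topology (\<lambda>_. discrete_topology (syms F)) UNIV) S"

definition language :: "'a markov_tuple \<Rightarrow> 'a list set" where
  "language F = {w. w \<noteq> [] \<and> set w \<subseteq> syms F \<and>
    (\<forall>i. Suc i < length w \<longrightarrow> trans_mat F (w ! i) (w ! Suc i) = 1)}"

definition language_restr :: "'a markov_tuple \<Rightarrow> 'a set \<Rightarrow> 'a list set" where
  "language_restr F C = {w \<in> language F. set w \<subseteq> C}"

definition cylinder :: "'a markov_tuple \<Rightarrow> 'a list \<Rightarrow> (nat \<Rightarrow> 'a) set" where
  "cylinder F u = {x \<in> sft F. \<forall>i<length u. x i = u ! i}"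

definition trans_graph :: "'a markov_tuple \<Rightarrow> 'a pair_pre_digraph" where
  "trans_graph F =
    \<lparr>pverts = syms F, parcs = {(a, b) \<in> syms F \<times> syms F. trans_mat F a b = 1}\<rparr>"

text \<open>A vertex lying on no cycle forms a component of its own (of zero entropy).\<close>

definition irreducible_component :: "'a markov_tuple \<Rightarrow> 'a set \<Rightarrow> bool" where
  "irreducible_component F C \<longleftrightarrow> C \<in> verts ` pre_digraph.sccs (with_proj (trans_graph F))"

definition positive_entropy :: "'a markov_tuple \<Rightarrow> 'a set \<Rightarrow> bool" where
  "positive_entropy F C \<longleftrightarrow> h_top (symbolic_space F (sft_restr F C)) lshift > 0"


section \<open>Intervals and the class of multi-maps\<close>

definition finv :: "'a markov_tuple \<Rightarrow> 'a \<Rightarrow> real \<Rightarrow> real" where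
  "finv F a =
    (if a \<in> sym0 F then inv_into (sdom F a) (fmap F a) else (\<lambda>_. the_elem (sdom F a)))"

definition word_interval :: "'a markov_tuple \<Rightarrow> 'a list \<Rightarrow> real set" where
  "word_interval F w = foldr (\<lambda>a S. finv F a ` S) (butlast w) (sdom F (last w))"

definition point_interval :: "'a markov_tuple \<Rightarrow> (nat \<Rightarrow> 'a) \<Rightarrow> real set" where
  "point_interval F x = (\<Inter>n\<in>{1..}. word_interval F (map x [0..<Suc n]))"

definition coding_word :: "'a markov_tuple \<Rightarrow> 'a set \<Rightarrow> 'a list \<Rightarrow> bool" where
  "coding_word F C u \<longleftrightarrow>
    u \<in> language_restr F C \<and>
    (\<forall>x\<in>sft_restr F C. infinite {n. (lshift ^^ n) x \<in> cylinder F u} \<longrightarrow>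
      is_singleton (point_interval F x))"

definition avoiding_word :: "'a markov_tuple \<Rightarrow> 'a set \<Rightarrow> 'a list \<Rightarrow> bool" where
  "avoiding_word F C u \<longleftrightarrow>
    u \<in> language_restr F C \<and> (\<forall>x\<in>cylinder F u. point_interval F x \<inter> pts F = {})"

definition class_F :: "'a markov_tuple set" where
  "class_F = {F. markov_multi_map F \<and> properly_parametrized F \<and>
    (\<forall>C. irreducible_component F C \<and> positive_entropy F C \<longrightarrow> (\<exists>u. coding_word F C u)) \<and>
    (\<forall>C. irreducible_component F C \<and> positive_entropy F C \<and> C \<subseteq> sym0 F \<longrightarrow>
      (\<exists>u. avoiding_word F C u)) \<and>
    h_top (symbolic_space F (sft F)) lshift > 0}"

end

(*
  Every step (x_n, x_(n+1)) of a trajectory lies in G_0(a) for exactly one symbol a, so proper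
  parametrization gives an everywhere defined, Borel, equivariant coding map X -> Sigma_M.
  A point a of Sigma_M is the code of exactly one trajectory as soon as it stays in a component
  of positive entropy and visits infinitely often a coding word (uniqueness: the intervals
  I_(sigma^n a) are singletons) and an "anchor", i.e. an avoiding word or a symbol outside A_0
  (existence: the trajectory shadowing a then uses the interiors of the domains).  Call these
  points good; E_0 and E_1 are the sets of points with a code that is not good.

  By ergodicity, an ergodic measure charging E_0 or E_1 is carried by the codes in one component
  C, and either C has entropy zero or these codes never visit some fixed word w of C.  The growth
  rate of the number of words bounds the measure entropy: on Sigma_M by a direct estimate of
  Shannon entropies, and on X because the inverse branches are monotone, so that a code word
  of length n has only polynomially many itineraries with respect to a finite set of cut points.
  Forbidding w strictly decreases the growth rate of an irreducible graph, and the growth rate of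
  C is at most the topological entropy: on X, the points of Sigma_M(C) that visit an anchor with
  bounded gaps form subsystems of nearly full entropy which lift to disjoint closed sets.
*)

theory Submission
  imports Defs "HOL-Library.Sublist" "HOL-Real_Asymp.Real_Asymp"
begin

section \<open>Growth rates and walks on finite graphs\<close>

text \<open>Two obstacles shape the argument. By compactness every point of \<open>Sigma_M\<close>
  has a shadow, a trajectory running through the closed graphs \<open>G(a_n)\<close>; but a shadow
  that meets partition points may have another code, and where the intervals do not shrink to points
  there are many shadows. So the coding map is in general neither continuous nor injective nor onto,
  and it cannot carry entropies across. Growth rates of word counts are the common currency instead:
  on each side separately they bound measure entropies from above and topological entropy from
  below.

  The strict inequality \<open>h_prob(E) < h_top\<close> requires a gap that does not depend on the
  measure. It comes from finiteness: finitely many components of positive entropy with two forbidden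
  words each, while components of zero entropy contribute 0; positive entropy of
  \<open>Sigma_M\<close> provides at least one component of positive entropy.

  Subsystems are cut out by bounded gaps and not by mere recurrence because bounded gaps give
  compact sets, and compactness makes the set of shadows with a given first letter closed.\<close>

text \<open>An upper bound for the limit superior of \<open>ln (c n) / n\<close>, written
  multiplicatively so that zero counts cause no exception; \<open>h\<close> may be negative.\<close>

definition exp_growth_le :: "(nat \<Rightarrow> nat) \<Rightarrow> real \<Rightarrow> bool" where
  "exp_growth_le c h \<longleftrightarrow> (\<forall>e>0. \<forall>\<^sub>F n in sequentially. real (c n) \<le> exp (real n * (h + e)))"

text \<open>Prefixes suffice: for a shift-invariant \<open>S\<close> every word occurring in a point
  of \<open>S\<close> is a prefix of another point of \<open>S\<close>.\<close>

definition words :: "nat \<Rightarrow> (nat \<Rightarrow> 'b) set \<Rightarrow> 'b list set" where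
  "words n S = (\<lambda>x. map x [0..<n]) ` S"

text \<open>Nothing is lost by \<open>ennreal\<close> cutting off negative values: a nonzero natural
  number has a nonnegative logarithm, and \<open>c n = 0\<close> satisfies the bound
  trivially.\<close>

lemma exp_growth_leI_limsup:
  assumes "limsup (\<lambda>n. ennreal (ln (real (c n)) / real n)) \<le> ennreal h" and "h \<ge> 0"
  shows "exp_growth_le c h"
  unfolding exp_growth_le_def
proof (intro allI impI)
  fix e :: real assume e: "e > 0"
  then have "limsup (\<lambda>n. ennreal (ln (real (c n)) / real n)) < ennreal (h + e)"
    using assms by (intro le_less_trans[OF assms(1)]) (simp add: ennreal_less_iff)
  then have "\<forall>\<^sub>F n in sequentially. ennreal (ln (real (c n)) / real n) < ennreal (h + e)"
    by (rule Limsup_lessD)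
  then show "\<forall>\<^sub>F n in sequentially. real (c n) \<le> exp (real n * (h + e))"
    using eventually_gt_at_top[of 0]
  proof eventually_elim
    case (elim n)
    show ?case
    proof (cases "c n = 0")
      case False
      then have "ln (real (c n)) / real n \<ge> 0" by simp
      with elim have "ln (real (c n)) / real n < h + e"
        by (simp add: ennreal_less_iff)
      then have "ln (real (c n)) \<le> real n * (h + e)" using elim by (simp add: field_simps)
      then have "exp (ln (real (c n))) \<le> exp (real n * (h + e))" by simp
      then show ?thesis using False by simp
    qed simp
  qed
qed

lemma exp_growth_le_mono:
  assumes "exp_growth_le c h" "\<And>n. d n \<le> c n" "h \<le> g"
  shows "exp_growth_le d g"
  unfolding exp_growth_le_def
proof (intro allI impI)
  fix e :: real assume "e > 0"
  then have "\<forall>\<^sub>F n in sequentially. real (c n) \<le> exp (real n * (h + e))"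
    using assms(1) by (simp add: exp_growth_le_def)
  then show "\<forall>\<^sub>F n in sequentially. real (d n) \<le> exp (real n * (g + e))"
  proof eventually_elim
    case (elim n)
    have "real (d n) \<le> real (c n)" using assms(2) by simp
    also have "\<dots> \<le> exp (real n * (h + e))" by (rule elim)
    also have "\<dots> \<le> exp (real n * (g + e))" using assms(3) by (simp add: mult_left_mono)
    finally show ?case .
  qed
qed

text \<open>The absorption principle behind most comparisons of counts: a linear factor and a window
  longer by \<open>k\<close> cost at most \<open>exp (n * e / 2)\<close> for large \<open>n\<close>,
  while a genuine factor \<open>exp (- \<delta> * n)\<close> lowers the rate by
  \<open>\<delta>\<close>.\<close>

lemma exp_growth_leI_poly:
  assumes c: "exp_growth_le c h" and K: "K \<ge> 0"
    and d: "\<forall>\<^sub>F n in sequentially. real (d n) \<le> K * (real n + 1) * exp (- \<delta> * real n) * real (c (n + k))"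
  shows "exp_growth_le d (h - \<delta>)"
  unfolding exp_growth_le_def
proof (intro allI impI)
  fix e :: real assume e: "e > 0"
  then have "\<forall>\<^sub>F n in sequentially. real (c n) \<le> exp (real n * (h + e / 2))"
    using c half_gt_zero[OF e] unfolding exp_growth_le_def by blast
  then have "\<forall>\<^sub>F n in sequentially. real (c (n + k)) \<le> exp (real (n + k) * (h + e / 2))"
    using eventually_sequentially_seg[of "\<lambda>n. real (c n) \<le> exp (real n * (h + e / 2))" k] by simp
  moreover have "\<forall>\<^sub>F n in sequentially. K * (real n + 1) * exp (real k * (h + e / 2)) \<le> exp (real n * (e / 2))"
    using e by real_asymp
  ultimately show "\<forall>\<^sub>F n in sequentially. real (d n) \<le> exp (real n * (h - \<delta> + e))"
    using d
  proof eventually_elim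
    case (elim n)
    have "real (d n) \<le> (K * (real n + 1) * exp (- \<delta> * real n)) * exp (real (n + k) * (h + e / 2))"
      using elim(1) K by (intro order_trans[OF elim(3)] mult_left_mono) auto
    also have "\<dots> = (K * (real n + 1) * exp (real k * (h + e / 2))) * (exp (- \<delta> * real n) * exp (real n * (h + e / 2)))"
    proof -
      have "real (n + k) * (h + e / 2) = real k * (h + e / 2) + real n * (h + e / 2)"
        by (simp add: algebra_simps)
      then show ?thesis by (simp only: exp_add mult_ac)
    qed
    also have "\<dots> \<le> exp (real n * (e / 2)) * (exp (- \<delta> * real n) * exp (real n * (h + e / 2)))"
      by (intro mult_right_mono elim) auto
    also have "\<dots> = exp (real n * (h - \<delta> + e))"
      by (simp add: exp_add[symmetric] algebra_simps)
    finally show ?case .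
  qed
qed

section \<open>The transition graph and its irreducible components\<close>

definition edges :: "'a markov_tuple \<Rightarrow> 'a set \<Rightarrow> ('a \<times> 'a) set" where
  "edges F C = {(a, b) \<in> C \<times> C. trans_mat F a b = 1}"

definition walks :: "('b \<times> 'b) set \<Rightarrow> (nat \<Rightarrow> 'b) set" where
  "walks E = {x. \<forall>n. (x n, x (Suc n)) \<in> E}"

lemma lshift_funpow: "(lshift ^^ n) x = (\<lambda>i. x (i + n))"
  by (induction n) (simp_all add: lshift_def)

lemma sft_eq_walks: "sft F = walks (edges F (syms F))"
  by (auto simp: sft_def walks_def edges_def)

lemma sft_restr_eq_walks: "C \<subseteq> syms F \<Longrightarrow> sft_restr F C = walks (edges F C)"
  by (auto simp: sft_restr_def sft_def walks_def edges_def)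

lemma walks_rtrancl: "x \<in> walks E \<Longrightarrow> m \<le> n \<Longrightarrow> (x m, x n) \<in> E\<^sup>*"
  by (induction n rule: nat_induct) (auto simp: walks_def le_Suc_eq intro: rtrancl_into_rtrancl)

lemma walks_lshift: "x \<in> walks E \<Longrightarrow> (lshift ^^ n) x \<in> walks E"
  by (simp add: walks_def lshift_funpow)

text \<open>The components of the graph library become classes of mutual reachability. The bridge is
  \<open>R\<close>: library reachability asks vertices to belong to the graph, whereas the reflexive
  transitive closure is reflexive everywhere, so membership of the start has to be added.\<close>

lemma irreducible_component_iff:
  "irreducible_component F C \<longleftrightarrow> C \<noteq> {} \<and> C \<subseteq> syms F \<and>
    (\<forall>u\<in>C. \<forall>v. v \<in> C \<longleftrightarrow> (u, v) \<in> (edges F (syms F))\<^sup>* \<and> (v, u) \<in> (edges F (syms F))\<^sup>*)"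
proof -
  interpret pair_wf_digraph "trans_graph F"
    by unfold_locales (auto simp: trans_graph_def)
  have E: "arcs_ends (with_proj (trans_graph F)) = edges F (syms F)"
    by (auto simp: arcs_ends_def trans_graph_def edges_def arc_to_ends_def)
  have V: "verts (with_proj (trans_graph F)) = syms F" by (simp add: trans_graph_def)
  have R: "u \<rightarrow>\<^sup>*\<^bsub>with_proj (trans_graph F)\<^esub> v \<longleftrightarrow> u \<in> syms F \<and> (u, v) \<in> (edges F (syms F))\<^sup>*" for u v
  proof
    assume "u \<rightarrow>\<^sup>*\<^bsub>with_proj (trans_graph F)\<^esub> v"
    then have r: "(u, v) \<in> rtrancl_on (syms F) (edges F (syms F))"
      unfolding reachable_def E V .
    show "u \<in> syms F \<and> (u, v) \<in> (edges F (syms F))\<^sup>*"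
      using in_rtrancl_on_in_F(1)[OF r] rtrancl_on_rtranclI[OF r] by (rule conjI)
  next
    assume a: "u \<in> syms F \<and> (u, v) \<in> (edges F (syms F))\<^sup>*"
    then have "(u, v) \<in> (edges F (syms F))\<^sup>*" by blast
    then have "(u, v) \<in> rtrancl_on (syms F) (edges F (syms F))"
      using a by (induction rule: rtrancl_induct) (auto simp: edges_def intro: rtrancl_on_into_rtrancl_on)
    then show "u \<rightarrow>\<^sup>*\<^bsub>with_proj (trans_graph F)\<^esub> v" unfolding reachable_def E V .
  qed
  have S: "S \<in> pre_digraph.sccs_verts (with_proj (trans_graph F)) \<longleftrightarrow>
    S \<noteq> {} \<and> S \<subseteq> syms F \<and>
    (\<forall>u\<in>S. \<forall>v. v \<in> S \<longleftrightarrow> (u, v) \<in> (edges F (syms F))\<^sup>* \<and> (v, u) \<in> (edges F (syms F))\<^sup>*)"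
    (is "?L \<longleftrightarrow> ?R") for S
  proof
    assume ?L
    then have l: "S \<noteq> {}" "\<And>u v. u \<in> S \<Longrightarrow> v \<in> S \<Longrightarrow> u \<in> syms F \<and> (u, v) \<in> (edges F (syms F))\<^sup>*"
      "\<And>u v. u \<in> S \<Longrightarrow> v \<notin> S \<Longrightarrow> \<not> (u \<in> syms F \<and> (u, v) \<in> (edges F (syms F))\<^sup>*) \<or> \<not> (v \<in> syms F \<and> (v, u) \<in> (edges F (syms F))\<^sup>*)"
      unfolding in_sccs_verts_conv_reachable R by blast+
    have "S \<subseteq> syms F" using l(2) by blast
    moreover have "v \<in> S" if "u \<in> S" "(u, v) \<in> (edges F (syms F))\<^sup>*" "(v, u) \<in> (edges F (syms F))\<^sup>*" for u v
    proof -
      have "v \<in> syms F" using that(2)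
      proof (cases rule: rtranclE)
        case base then show ?thesis using that(1) l(2) by blast
      qed (simp add: edges_def)
      then show ?thesis using l(2,3)[OF that(1)] that by blast
    qed
    ultimately show ?R using l(1,2) by blast
  next
    assume ?R
    then show ?L unfolding in_sccs_verts_conv_reachable R by blast
  qed
  show ?thesis unfolding irreducible_component_def sccs_verts_conv[symmetric] S ..
qed

text \<open>A path of the whole graph joining two vertices of \<open>C\<close> never leaves
  \<open>C\<close>: each vertex on it reaches \<open>v\<close>, and \<open>v\<close> leads back to
  it.\<close>

lemma irreducible_component_strongly_connected:
  assumes "irreducible_component F C" "u \<in> C" "v \<in> C"
  shows "(u, v) \<in> (edges F C)\<^sup>*"
proof -
  let ?E = "edges F (syms F)"
  have C: "\<And>u v. u \<in> C \<Longrightarrow> v \<in> C \<longleftrightarrow> (u, v) \<in> ?E\<^sup>* \<and> (v, u) \<in> ?E\<^sup>*"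
    using assms(1) by (simp add: irreducible_component_iff)
  have "(u, v) \<in> ?E\<^sup>*" using C assms by blast
  then show ?thesis using assms(2)
  proof (induction rule: converse_rtrancl_induct)
    case (step y z)
    have "(y, v) \<in> ?E\<^sup>*" "(v, y) \<in> ?E\<^sup>*" using C step.prems assms(3) by blast+
    with step.hyps have "(y, z) \<in> ?E\<^sup>*" "(z, y) \<in> ?E\<^sup>*" by auto
    then have "z \<in> C" using C step.prems by blast
    moreover have "(y, z) \<in> edges F C" using step.hyps step.prems \<open>z \<in> C\<close> by (auto simp: edges_def)
    ultimately show ?case using step.IH by (auto intro: converse_rtrancl_into_rtrancl)
  qed simp
qed

section \<open>Counting paths in an irreducible graph\<close>

abbreviation is_path :: "('b \<times> 'b) set \<Rightarrow> 'b list \<Rightarrow> bool" where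
  "is_path E \<equiv> successively (\<lambda>x y. (x, y) \<in> E)"

text \<open>\<open>n\<close> counts vertices, so edges impose a condition only from
  \<open>n = 2\<close> on.\<close>

definition paths :: "('b \<times> 'b) set \<Rightarrow> 'b set \<Rightarrow> nat \<Rightarrow> 'b list set" where
  "paths E C n = {xs. length xs = n \<and> set xs \<subseteq> C \<and> is_path E xs}"

lemma finite_paths: "finite C \<Longrightarrow> finite (paths E C n)"
  by (rule finite_subset[OF _ finite_lists_length_eq[of C n]]) (auto simp: paths_def)

lemma words_subset_paths:
  assumes "E \<subseteq> C \<times> C" shows "words n (walks E) \<subseteq> paths E C n"
proof
  fix w assume "w \<in> words n (walks E)"
  then obtain x where x: "x \<in> walks E" and w: "w = map x [0..<n]" by (auto simp: words_def)
  have e: "(x i, x (Suc i)) \<in> E" for i using x by (simp add: walks_def)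
  then have "x i \<in> C" for i using assms by blast
  moreover have "is_path E (map x [0..<n])"
  proof (induction n)
    case (Suc n)
    then show ?case using e[of "n - 1"] by (cases n) (simp_all add: successively_append_iff)
  qed simp
  ultimately show "w \<in> paths E C n" by (auto simp: paths_def w)
qed

text \<open>\<open>conn\<close> uses the reflexive closure and so holds for a single vertex without
  loop; \<open>succ\<close> excludes this case and lets every finite path be continued.\<close>

locale irreducible_graph =
  fixes C :: "'b set" and E :: "('b \<times> 'b) set"
  assumes fin: "finite C" and ne: "C \<noteq> {}" and EC: "E \<subseteq> C \<times> C"
    and conn: "\<And>u v. u \<in> C \<Longrightarrow> v \<in> C \<Longrightarrow> (u, v) \<in> E\<^sup>*"
    and succ: "\<And>u. u \<in> C \<Longrightarrow> \<exists>v. (u, v) \<in> E"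
begin

text \<open>Continuations are stored without their start \<open>a\<close>, so that one of length
  \<open>m + n\<close> is plainly the concatenation of two, as in \<open>ext_add\<close>.\<close>

definition ext :: "nat \<Rightarrow> 'b \<Rightarrow> 'b list set" where
  "ext n a = {xs. length xs = n \<and> is_path E (a # xs)}"

lemma path_in_C: "is_path E (a # xs) \<Longrightarrow> set xs \<subseteq> C"
  using EC by (induction xs arbitrary: a) auto

lemma ext_subset: "ext n a \<subseteq> {xs. set xs \<subseteq> C \<and> length xs = n}"
  using path_in_C by (auto simp: ext_def)

lemma finite_ext: "finite (ext n a)"
  by (rule finite_subset[OF ext_subset finite_lists_length_eq[OF fin]])

lemma card_ext_le: "card (ext n a) \<le> card C ^ n"
  using card_mono[OF finite_lists_length_eq[OF fin] ext_subset] card_lists_length_eq[OF fin] by metis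

lemma last_in_C: "a \<in> C \<Longrightarrow> xs \<in> ext n a \<Longrightarrow> last (a # xs) \<in> C"
  using path_in_C[of a xs] last_in_set[of "a # xs"] by (auto simp: ext_def)

lemma path_append_iff:
  "is_path E (a # xs @ ys) \<longleftrightarrow> is_path E (a # xs) \<and> is_path E (last (a # xs) # ys)"
  using successively_append_iff[of _ "a # xs" ys] by (cases ys) auto

lemma ext_append: "xs \<in> ext m a \<Longrightarrow> ys \<in> ext n (last (a # xs)) \<Longrightarrow> xs @ ys \<in> ext (m + n) a"
  unfolding ext_def mem_Collect_eq path_append_iff by simp

lemma ext_split:
  assumes "zs \<in> ext (m + n) a"
  shows "take m zs \<in> ext m a" "drop m zs \<in> ext n (last (a # take m zs))"
proof -
  have z: "length zs = m + n" "is_path E (a # take m zs @ drop m zs)"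
    using assms by (simp_all add: ext_def)
  then show "take m zs \<in> ext m a" "drop m zs \<in> ext n (last (a # take m zs))"
    unfolding path_append_iff ext_def by simp_all
qed

lemma card_Union_append:
  assumes "finite B" "\<And>xs. xs \<in> B \<Longrightarrow> length xs = m" "\<And>xs. xs \<in> B \<Longrightarrow> finite (G xs)"
  shows "card (\<Union>xs\<in>B. (@) xs ` G xs) = (\<Sum>xs\<in>B. card (G xs))"
proof -
  have "card (\<Union>xs\<in>B. (@) xs ` G xs) = (\<Sum>xs\<in>B. card ((@) xs ` G xs))"
    using assms by (intro card_UN_disjoint) auto
  also have "\<dots> = (\<Sum>xs\<in>B. card (G xs))"
    by (intro sum.cong refl card_image) (simp add: inj_on_def)
  finally show ?thesis .
qed

lemma ext_add: "ext (m + n) a = (\<Union>xs\<in>ext m a. (@) xs ` ext n (last (a # xs)))"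
proof (intro equalityI subsetI)
  fix zs assume "zs \<in> ext (m + n) a"
  from ext_split[OF this] show "zs \<in> (\<Union>xs\<in>ext m a. (@) xs ` ext n (last (a # xs)))"
    by (intro UN_I[of "take m zs"] image_eqI[of _ _ "drop m zs"]) simp_all
qed (use ext_append in blast)

lemma card_ext_add: "card (ext (m + n) a) = (\<Sum>xs\<in>ext m a. card (ext n (last (a # xs))))"
  unfolding ext_add by (rule card_Union_append[OF finite_ext _ finite_ext]) (simp add: ext_def)

lemma ext_nonempty: "a \<in> C \<Longrightarrow> ext n a \<noteq> {}"
proof (induction n arbitrary: a)
  case 0 show ?case by (auto simp: ext_def)
next
  case (Suc n)
  obtain b where b: "(a, b) \<in> E" using succ[OF Suc.prems] by blast
  then have "b \<in> C" using EC by blast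
  then obtain xs where "xs \<in> ext n b" using Suc.IH by blast
  then have "b # xs \<in> ext (Suc n) a" using b by (auto simp: ext_def)
  then show ?case by blast
qed

lemma card_ext_pos: "a \<in> C \<Longrightarrow> card (ext n a) > 0"
  using ext_nonempty finite_ext by (simp add: card_gt_0_iff)

lemma card_ext_mono: "a \<in> C \<Longrightarrow> card (ext m a) \<le> card (ext (m + n) a)"
proof -
  assume a: "a \<in> C"
  have "card (ext m a) = (\<Sum>xs\<in>ext m a. 1)" by simp
  also have "\<dots> \<le> (\<Sum>xs\<in>ext m a. card (ext n (last (a # xs))))"
    using card_ext_pos[OF last_in_C[OF a]] by (intro sum_mono) (simp add: Suc_le_eq)
  finally show ?thesis unfolding card_ext_add .
qed

lemma card_ext_step: "card (ext (m + n) a) \<le> card C ^ n * card (ext m a)"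
proof -
  have "card (ext (m + n) a) \<le> (\<Sum>xs\<in>ext m a. card C ^ n)"
    unfolding card_ext_add by (intro sum_mono card_ext_le)
  then show ?thesis by (simp add: mult.commute)
qed

lemma connecting_path: "\<exists>xs. is_path E (a # xs) \<and> last (a # xs) = b" if "a \<in> C" "b \<in> C"
  using conn[OF that]
proof (induction rule: converse_rtrancl_induct)
  case base
  have "is_path E [b] \<and> last [b] = b" by simp
  then show ?case by blast
next
  case (step y z)
  then obtain xs where "is_path E (z # xs)" "last (z # xs) = b" by blast
  then have "is_path E (y # z # xs) \<and> last (y # z # xs) = b" using step.hyps by simp
  then show ?case by blast
qed

text \<open>Prefixing the continuations of \<open>b\<close> by one fixed path from \<open>a\<close>
  to \<open>b\<close> embeds them into longer continuations of \<open>a\<close>; dropping the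
  surplus letters costs a power of \<open>card C\<close> independent of \<open>n\<close>. Finitely
  many pairs give a uniform \<open>K\<close>.\<close>

lemma card_ext_comparable:
  obtains K where "K \<ge> 1" "\<And>a b n. a \<in> C \<Longrightarrow> b \<in> C \<Longrightarrow> card (ext n b) \<le> K * card (ext n a)"
proof -
  have "\<exists>K. \<forall>n. card (ext n b) \<le> K * card (ext n a)" if ab: "a \<in> C" "b \<in> C" for a b
  proof -
    obtain xs where xs: "is_path E (a # xs)" "last (a # xs) = b" using connecting_path[OF ab] by blast
    then have x: "xs \<in> ext (length xs) a" by (simp add: ext_def)
    have "card (ext n b) \<le> card C ^ length xs * card (ext n a)" for n
    proof -
      have "card (ext n b) \<le> card (ext (length xs + n) a)"
        unfolding card_ext_add using member_le_sum[OF x _ finite_ext, of "\<lambda>xs. card (ext n (last (a # xs)))"] xs(2)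
        by simp
      also have "\<dots> \<le> card C ^ length xs * card (ext n a)"
        using card_ext_step[of n "length xs" a] by (simp add: add.commute)
      finally show ?thesis .
    qed
    then show ?thesis by blast
  qed
  then have "\<forall>p\<in>C \<times> C. \<exists>K. \<forall>n. card (ext n (snd p)) \<le> K * card (ext n (fst p))" by auto
  from bchoice[OF this] obtain K
    where K: "\<forall>p\<in>C \<times> C. \<forall>n. card (ext n (snd p)) \<le> K p * card (ext n (fst p))" by blast
  define L where "L = Max (K ` (C \<times> C)) + 1"
  have "card (ext n b) \<le> L * card (ext n a)" if "a \<in> C" "b \<in> C" for a b n
  proof -
    have "K (a, b) \<le> L" unfolding L_def using that fin
      by (intro trans_le_add1 Max_ge finite_imageI finite_cartesian_product) auto
    moreover have "card (ext n b) \<le> K (a, b) * card (ext n a)" using K that by force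
    ultimately show ?thesis by (meson mult_le_mono1 order_trans)
  qed
  then show ?thesis using that[of L] by (simp add: L_def)
qed

lemma extend_path: "a \<in> C \<Longrightarrow> xs \<in> ext m a \<Longrightarrow> m \<le> n \<Longrightarrow> \<exists>ys. xs @ ys \<in> ext n a"
proof -
  assume a: "a \<in> C" and xs: "xs \<in> ext m a" and mn: "m \<le> n"
  obtain ys where "ys \<in> ext (n - m) (last (a # xs))"
    using ext_nonempty[OF last_in_C[OF a xs]] by blast
  from ext_append[OF xs this] show ?thesis using mn by auto
qed

lemma path_through:
  assumes "is_path E w" "w \<noteq> []" "set w \<subseteq> C" "a \<in> C"
  shows "\<exists>xs. is_path E (a # xs) \<and> sublist w (a # xs)"
proof -
  have "hd w \<in> C" using assms by auto
  then obtain xs where xs: "is_path E (a # xs)" "last (a # xs) = hd w"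
    using connecting_path[OF assms(4)] by blast
  have "is_path E (a # xs @ tl w)" unfolding path_append_iff xs(2) using xs(1) assms(1,2) by simp
  moreover have "a # xs @ tl w = butlast (a # xs) @ w @ []"
  proof -
    have "a # xs = butlast (a # xs) @ [hd w]" using xs(2) append_butlast_last_id[of "a # xs"] by simp
    then have "(a # xs) @ tl w = (butlast (a # xs) @ [hd w]) @ tl w" by (rule arg_cong)
    then show ?thesis using assms(2) by simp
  qed
  ultimately show ?thesis unfolding sublist_def by blast
qed

section \<open>Forbidding a word lowers the growth rate\<close>

text \<open>The start \<open>a\<close> takes part in occurrences of \<open>w\<close>. So when a
  continuation is cut, both pieces avoid \<open>w\<close>, although the second starts at the last
  letter of the first. Occurrences across the cut are ignored, which is why
  \<open>card_avoid_add\<close> is only an inequality.\<close>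

definition avoid :: "'b list \<Rightarrow> nat \<Rightarrow> 'b \<Rightarrow> 'b list set" where
  "avoid w n a = {xs \<in> ext n a. \<not> sublist w (a # xs)}"

lemma finite_avoid: "finite (avoid w n a)"
  unfolding avoid_def using finite_ext by simp

lemma avoid_split:
  assumes "zs \<in> avoid w (m + n) a"
  shows "take m zs \<in> avoid w m a" "drop m zs \<in> avoid w n (last (a # take m zs))"
proof -
  have z: "zs \<in> ext (m + n) a" "\<not> sublist w (a # zs)" using assms by (simp_all add: avoid_def)
  have s1: "sublist w (a # zs)" if "sublist w (a # take m zs)"
  proof -
    have "sublist (a # take m zs) ((a # take m zs) @ drop m zs)" by (rule sublist_append_rightI)
    then show ?thesis using that sublist_order.order.trans by fastforce
  qed
  have s2: "sublist w (a # zs)" if "sublist w (last (a # take m zs) # drop m zs)"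
  proof -
    have "a # zs = butlast (a # take m zs) @ (last (a # take m zs) # drop m zs)"
      using append_butlast_last_id[of "a # take m zs"] append_take_drop_id[of m zs]
      by (metis append_Cons append_assoc list.distinct(1) append_Nil)
    then show ?thesis using that sublist_append_leftI sublist_order.order.trans by metis
  qed
  show "take m zs \<in> avoid w m a" "drop m zs \<in> avoid w n (last (a # take m zs))"
    using ext_split[OF z(1)] s1 s2 z(2) by (auto simp: avoid_def)
qed

lemma card_avoid_add:
  "card (avoid w (m + n) a) \<le> (\<Sum>xs\<in>avoid w m a. card (avoid w n (last (a # xs))))"
proof -
  have "avoid w (m + n) a \<subseteq> (\<Union>xs\<in>avoid w m a. (@) xs ` avoid w n (last (a # xs)))"
  proof
    fix zs assume "zs \<in> avoid w (m + n) a"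
    from avoid_split[OF this] show "zs \<in> (\<Union>xs\<in>avoid w m a. (@) xs ` avoid w n (last (a # xs)))"
      by (intro UN_I[of "take m zs"] image_eqI[of _ _ "drop m zs"]) simp_all
  qed
  then have "card (avoid w (m + n) a) \<le> card (\<Union>xs\<in>avoid w m a. (@) xs ` avoid w n (last (a # xs)))"
    by (intro card_mono finite_UN_I finite_imageI finite_avoid)
  also have "\<dots> = (\<Sum>xs\<in>avoid w m a. card (avoid w n (last (a # xs))))"
    by (rule card_Union_append[OF finite_avoid _ finite_avoid]) (simp add: avoid_def ext_def)
  finally show ?thesis .
qed

text \<open>From every vertex some path of length \<open>D\<close> sees \<open>w\<close>, and by irreducibility the
  continuations of that is_path make up a proportion of at least \<open>\<epsilon>\<close> of all continuations.\<close>

lemma avoid_decay: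
  assumes w: "is_path E w" "w \<noteq> []" "set w \<subseteq> C"
  obtains D :: nat and \<epsilon> :: real where "D > 0" "0 < \<epsilon>" "\<epsilon> < 1"
    "\<And>j a. a \<in> C \<Longrightarrow> real (card (avoid w (j * D) a)) \<le> (1 - \<epsilon>) ^ j * card (ext (j * D) a)"
proof -
  have "\<forall>a\<in>C. \<exists>xs. is_path E (a # xs) \<and> sublist w (a # xs)"
    using path_through[OF w] by blast
  then obtain z where z: "\<And>a. a \<in> C \<Longrightarrow> is_path E (a # z a) \<and> sublist w (a # z a)" by metis
  define D where "D = Suc (Max ((\<lambda>a. length (z a)) ` C))"
  have D: "length (z a) \<le> D" if "a \<in> C" for a
    unfolding D_def using that fin by (intro le_SucI Max_ge) auto
  have "\<exists>y. y \<in> ext D a \<and> sublist w (a # y)" if a: "a \<in> C" for a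
  proof -
    have "z a \<in> ext (length (z a)) a" using z[OF a] by (simp add: ext_def)
    from extend_path[OF a this D[OF a]] obtain ys where ys: "z a @ ys \<in> ext D a" by blast
    have "sublist (a # z a) ((a # z a) @ ys)" by (rule sublist_append_rightI)
    then have "sublist w (a # z a @ ys)" using z[OF a] sublist_order.order.trans by fastforce
    with ys show ?thesis by blast
  qed
  then obtain y where y: "\<And>a. a \<in> C \<Longrightarrow> y a \<in> ext D a" "\<And>a. a \<in> C \<Longrightarrow> sublist w (a # y a)" by metis
  obtain K where K: "K \<ge> 1" "\<And>a b n. a \<in> C \<Longrightarrow> b \<in> C \<Longrightarrow> card (ext n b) \<le> K * card (ext n a)"
    using card_ext_comparable by blast
  \<comment> \<open>\<open>card C ^ D\<close> bounds the growth over \<open>D\<close> steps and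
    \<open>K\<close> compares two starting vertices, so \<open>1 / M\<close> is a valid proportion;
    the factor 2 keeps it strictly below 1.\<close>
  define M where "M = 2 * card C ^ D * K"
  have "card C ^ D * K > 0" using K(1) ne fin by (simp add: card_gt_0_iff)
  then have M: "M > 1" unfolding M_def mult.assoc by linarith
  define \<epsilon> where "\<epsilon> = 1 / real M"
  have \<epsilon>: "0 < \<epsilon>" "\<epsilon> < 1" using M by (auto simp: \<epsilon>_def)
  have proportion: "\<epsilon> * card (ext (D + n) a) \<le> card (ext n b)" if "a \<in> C" "b \<in> C" for a b n
  proof -
    have "card (ext (D + n) a) \<le> card C ^ D * card (ext n a)"
      using card_ext_step[of n D a] by (simp add: add.commute)
    also have "\<dots> \<le> card C ^ D * (K * card (ext n b))" by (intro mult_le_mono2 K that)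
    also have "\<dots> \<le> M * card (ext n b)" by (simp add: M_def)
    finally have "real (card (ext (D + n) a)) \<le> real M * real (card (ext n b))"
      by (metis of_nat_le_iff of_nat_mult)
    then show ?thesis using M by (simp add: \<epsilon>_def field_simps)
  qed
  have decay: "real (card (avoid w (j * D) a)) \<le> (1 - \<epsilon>) ^ j * card (ext (j * D) a)" if "a \<in> C" for j a
    using that
  proof (induction j arbitrary: a)
    case 0
    have "card (avoid w 0 a) \<le> card (ext 0 a)"
      by (rule card_mono[OF finite_ext]) (auto simp: avoid_def)
    then show ?case by simp
  next
    case (Suc j)
    let ?c = "\<lambda>xs. real (card (ext (j * D) (last (a # xs))))"
    \<comment> \<open>The whole gain comes from leaving out the single path \<open>y a\<close>: by
      \<open>proportion\<close> its last vertex carries at least the fraction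
      \<open>\<epsilon>\<close> of all continuations.\<close>
    have sub: "avoid w D a \<subseteq> ext D a - {y a}" using y(2)[OF Suc.prems] by (auto simp: avoid_def)
    have "real (card (avoid w (D + j * D) a)) \<le> (\<Sum>xs\<in>avoid w D a. real (card (avoid w (j * D) (last (a # xs)))))"
      using card_avoid_add[of w D "j * D" a] by (metis of_nat_le_iff of_nat_sum)
    also have "\<dots> \<le> (\<Sum>xs\<in>avoid w D a. (1 - \<epsilon>) ^ j * ?c xs)"
    proof (rule sum_mono)
      fix xs assume "xs \<in> avoid w D a"
      then have "xs \<in> ext D a" by (simp add: avoid_def)
      then have "last (a # xs) \<in> C" by (rule last_in_C[OF Suc.prems])
      then show "real (card (avoid w (j * D) (last (a # xs)))) \<le> (1 - \<epsilon>) ^ j * ?c xs" by (rule Suc.IH)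
    qed
    also have "\<dots> \<le> (\<Sum>xs\<in>ext D a - {y a}. (1 - \<epsilon>) ^ j * ?c xs)"
      using sub finite_ext \<epsilon> by (intro sum_mono2) auto
    also have "\<dots> = (1 - \<epsilon>) ^ j * (\<Sum>xs\<in>ext D a - {y a}. ?c xs)" by (simp add: sum_distrib_left)
    also have "(\<Sum>xs\<in>ext D a - {y a}. ?c xs) = (\<Sum>xs\<in>ext D a. ?c xs) - ?c (y a)"
      using y(1)[OF Suc.prems] finite_ext by (simp add: sum_diff1)
    also have "(\<Sum>xs\<in>ext D a. ?c xs) = card (ext (D + j * D) a)" unfolding card_ext_add by simp
    also have "(1 - \<epsilon>) ^ j * (card (ext (D + j * D) a) - ?c (y a))
      \<le> (1 - \<epsilon>) ^ j * ((1 - \<epsilon>) * card (ext (D + j * D) a))"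
    proof (rule mult_left_mono)
      have "\<epsilon> * card (ext (D + j * D) a) \<le> ?c (y a)"
        by (rule proportion[OF Suc.prems last_in_C[OF Suc.prems y(1)[OF Suc.prems]]])
      then show "card (ext (D + j * D) a) - ?c (y a) \<le> (1 - \<epsilon>) * card (ext (D + j * D) a)"
        by (simp add: left_diff_distrib)
    qed (use \<epsilon> in simp)
    finally show ?case by (simp add: mult_ac)
  qed
  have D0: "D > 0" by (simp add: D_def)
  show ?thesis by (rule that[OF D0 \<epsilon> decay])
qed

definition avoiding_paths :: "'b list \<Rightarrow> nat \<Rightarrow> 'b list set" where
  "avoiding_paths w n = {xs \<in> paths E C n. \<not> sublist w xs}"

lemma paths_Suc: "paths E C (Suc n) = (\<Union>a\<in>C. (#) a ` ext n a)"
proof (intro equalityI subsetI)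
  fix zs assume z: "zs \<in> paths E C (Suc n)"
  then obtain a xs where "zs = a # xs" by (cases zs) (auto simp: paths_def)
  with z show "zs \<in> (\<Union>a\<in>C. (#) a ` ext n a)" by (auto simp: paths_def ext_def)
next
  fix zs assume "zs \<in> (\<Union>a\<in>C. (#) a ` ext n a)"
  then obtain a xs where "zs = a # xs" "a \<in> C" "xs \<in> ext n a" by blast
  then show "zs \<in> paths E C (Suc n)" using path_in_C[of a xs] by (auto simp: paths_def ext_def)
qed

lemma card_Union_Cons:
  assumes "\<And>a. finite (G a)"
  shows "card (\<Union>a\<in>C. (#) a ` G a) = (\<Sum>a\<in>C. card (G a))"
proof -
  have "card (\<Union>a\<in>C. (#) a ` G a) = (\<Sum>a\<in>C. card ((#) a ` G a))"
    using assms fin by (intro card_UN_disjoint) auto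
  also have "\<dots> = (\<Sum>a\<in>C. card (G a))"
    by (intro sum.cong refl card_image) (simp add: inj_on_def)
  finally show ?thesis .
qed

lemma card_paths_Suc: "card (paths E C (Suc n)) = (\<Sum>a\<in>C. card (ext n a))"
  unfolding paths_Suc by (rule card_Union_Cons[OF finite_ext])

lemma card_avoiding_paths_Suc: "card (avoiding_paths w (Suc n)) = (\<Sum>a\<in>C. card (avoid w n a))"
proof -
  have "avoiding_paths w (Suc n) = (\<Union>a\<in>C. (#) a ` avoid w n a)"
    unfolding avoiding_paths_def paths_Suc avoid_def by blast
  then show ?thesis by (simp only: card_Union_Cons[OF finite_avoid])
qed

lemma card_avoiding_paths_le:
  assumes w: "is_path E w" "w \<noteq> []" "set w \<subseteq> C"
  obtains K \<delta> :: real where "K \<ge> 0" "\<delta> > 0"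
    "\<And>n. n > 0 \<Longrightarrow> real (card (avoiding_paths w n)) \<le> K * exp (- \<delta> * real n) * real (card (paths E C n))"
proof -
  obtain D :: nat and \<epsilon> :: real where D: "D > 0" and \<epsilon>: "0 < \<epsilon>" "\<epsilon> < 1"
    and decay: "\<And>j a. a \<in> C \<Longrightarrow> real (card (avoid w (j * D) a)) \<le> (1 - \<epsilon>) ^ j * card (ext (j * D) a)"
    by (rule avoid_decay[OF w]) blast
  \<comment> \<open>The factor \<open>1 - \<epsilon>\<close> per \<open>D\<close> letters, spread
    evenly over single letters.\<close>
  define \<delta> where "\<delta> = - ln (1 - \<epsilon>) / real D"
  have \<delta>: "\<delta> > 0" using \<epsilon> D by (simp add: \<delta>_def divide_neg_pos)
  \<comment> \<open>The power of \<open>card C\<close> pays for the fewer than \<open>D\<close>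
    letters left over by the division by \<open>D\<close>, the exponential for the rounding
    \<open>n <= j * D + 2 * D\<close>.\<close>
  define K where "K = real (card C ^ D) * exp (2 * real D * \<delta>)"
  have cC: "card C \<ge> 1" using ne fin by (simp add: Suc_le_eq card_gt_0_iff)
  have "real (card (avoiding_paths w n)) \<le> K * exp (- \<delta> * real n) * real (card (paths E C n))" if n: "n > 0" for n
  proof -
    obtain m where m: "n = Suc m" using n gr0_implies_Suc by blast
    define j r where "j = m div D" and "r = m mod D"
    have mjr: "m = j * D + r" and rD: "r < D" using D by (simp_all add: j_def r_def)
    have pw: "(1 - \<epsilon>) ^ j \<le> exp (2 * real D * \<delta>) * exp (- \<delta> * real n)"
    proof -
      have "(1 - \<epsilon>) ^ j = exp (ln (1 - \<epsilon>)) ^ j" using \<epsilon> by simp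
      also have "\<dots> = exp (real j * ln (1 - \<epsilon>))" by (simp add: exp_of_nat_mult)
      also have "ln (1 - \<epsilon>) = - \<delta> * real D" using D by (simp add: \<delta>_def)
      also have "real j * (- \<delta> * real D) = - \<delta> * (real j * real D)" by simp
      also have "exp \<dots> \<le> exp (2 * real D * \<delta> + - \<delta> * real n)"
      proof -
        have "real n \<le> real j * real D + 2 * real D"
        proof -
          have "n \<le> j * D + 2 * D" using m mjr rD D by linarith
          then have "real n \<le> real (j * D + 2 * D)" by (simp only: of_nat_le_iff)
          then show ?thesis by simp
        qed
        then have "\<delta> * real n \<le> \<delta> * (real j * real D + 2 * real D)"
          using \<delta> by (intro mult_left_mono) auto
        then show ?thesis by (simp add: algebra_simps)
      qed
      finally show ?thesis by (simp only: exp_add)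
    qed
    have a: "real (card (avoid w m a)) \<le> real (card C ^ D) * ((1 - \<epsilon>) ^ j * real (card (ext m a)))" if a: "a \<in> C" for a
    proof -
      have "card (avoid w m a) \<le> (\<Sum>xs\<in>avoid w (j * D) a. card (avoid w r (last (a # xs))))"
        unfolding mjr by (rule card_avoid_add)
      also have "\<dots> \<le> (\<Sum>xs\<in>avoid w (j * D) a. card C ^ D)"
      proof (rule sum_mono)
        fix xs
        have "card (avoid w r (last (a # xs))) \<le> card (ext r (last (a # xs)))"
          by (rule card_mono[OF finite_ext]) (auto simp: avoid_def)
        also have "\<dots> \<le> card C ^ r" by (rule card_ext_le)
        also have "\<dots> \<le> card C ^ D" using cC rD by (intro power_increasing) auto
        finally show "card (avoid w r (last (a # xs))) \<le> card C ^ D" .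
      qed
      also have "\<dots> = card C ^ D * card (avoid w (j * D) a)" by simp
      finally have "real (card (avoid w m a)) \<le> real (card C ^ D) * real (card (avoid w (j * D) a))"
        by (simp only: of_nat_mult[symmetric] of_nat_le_iff)
      also have "\<dots> \<le> real (card C ^ D) * ((1 - \<epsilon>) ^ j * real (card (ext (j * D) a)))"
        by (intro mult_left_mono decay a) simp
      also have "\<dots> \<le> real (card C ^ D) * ((1 - \<epsilon>) ^ j * real (card (ext m a)))"
        using card_ext_mono[OF a, of "j * D" r] \<epsilon> unfolding mjr by (intro mult_left_mono) simp_all
      finally show ?thesis .
    qed
    have "real (card (avoiding_paths w n)) = (\<Sum>a\<in>C. real (card (avoid w m a)))"
      unfolding m card_avoiding_paths_Suc by simp
    also have "\<dots> \<le> (\<Sum>a\<in>C. real (card C ^ D) * ((1 - \<epsilon>) ^ j * real (card (ext m a))))"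
      by (intro sum_mono a)
    also have "\<dots> = real (card C ^ D) * ((1 - \<epsilon>) ^ j * real (card (paths E C n)))"
      unfolding m card_paths_Suc by (simp add: sum_distrib_left)
    also have "\<dots> \<le> real (card C ^ D) * ((exp (2 * real D * \<delta>) * exp (- \<delta> * real n)) * real (card (paths E C n)))"
      by (intro mult_left_mono mult_right_mono pw) simp_all
    also have "\<dots> = K * exp (- \<delta> * real n) * real (card (paths E C n))"
      by (simp only: K_def mult_ac)
    finally show ?thesis .
  qed
  moreover have "K \<ge> 0" by (simp add: K_def)
  ultimately show ?thesis using that \<delta> by blast
qed

text \<open>Stated relative to an arbitrary upper bound \<open>g\<close>, because the bound supplied
  later is a topological entropy and not the growth rate itself. The new rate \<open>h\<close> may
  be negative.\<close>

lemma avoiding_growth: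
  assumes w: "is_path E w" "w \<noteq> []" "set w \<subseteq> C" and g: "exp_growth_le (\<lambda>n. card (paths E C n)) g"
  obtains h where "h < g" "exp_growth_le (\<lambda>n. card (avoiding_paths w n)) h"
proof -
  obtain K \<delta> where K: "K \<ge> 0" "\<delta> > 0"
    "\<And>n. n > 0 \<Longrightarrow> real (card (avoiding_paths w n)) \<le> K * exp (- \<delta> * real n) * real (card (paths E C n))"
    by (rule card_avoiding_paths_le[OF w]) blast
  have "exp_growth_le (\<lambda>n. card (avoiding_paths w n)) (g - \<delta>)"
  proof (rule exp_growth_leI_poly[OF g K(1), where k = 0])
    show "\<forall>\<^sub>F n in sequentially. real (card (avoiding_paths w n))
      \<le> K * (real n + 1) * exp (- \<delta> * real n) * real (card (paths E C (n + 0)))"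
      using eventually_gt_at_top[of 0]
    proof eventually_elim
      case (elim n)
      have "K * exp (- \<delta> * real n) * real (card (paths E C n))
        \<le> (K * (real n + 1)) * exp (- \<delta> * real n) * real (card (paths E C n))"
        using K(1) by (intro mult_right_mono) (simp_all add: mult_le_cancel_left1)
      then show ?case using K(3)[OF elim] by simp
    qed
  qed
  then show ?thesis using K(2) that[of "g - \<delta>"] by simp
qed

section \<open>Infinite walks in which a word recurs with bounded gaps\<close>

lemma walk_from: "a \<in> C \<Longrightarrow> \<exists>x\<in>walks E. x 0 = a"
proof -
  assume a: "a \<in> C"
  obtain s where s: "\<And>u. u \<in> C \<Longrightarrow> (u, s u) \<in> E" using succ by metis
  have C: "(s ^^ n) a \<in> C" for n using a s EC by (induction n) auto
  show ?thesis
    by (rule bexI[of _ "\<lambda>n. (s ^^ n) a"]) (simp_all add: walks_def s[OF C])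
qed

lemma splice_walk:
  assumes "is_path E xs" "x \<in> walks E" "xs \<noteq> [] \<Longrightarrow> (last xs, x 0) \<in> E"
  shows "(\<lambda>i. if i < length xs then xs ! i else x (i - length xs)) \<in> walks E"
  unfolding walks_def
proof (intro CollectI allI)
  fix i
  consider "Suc i < length xs" | "Suc i = length xs" | "i \<ge> length xs" by linarith
  then show "(if i < length xs then xs ! i else x (i - length xs),
      if Suc i < length xs then xs ! Suc i else x (Suc i - length xs)) \<in> E"
  proof cases
    case 1
    then show ?thesis using successively_nth[OF assms(1)] by simp
  next
    case 2
    then have "xs \<noteq> []" "xs ! i = last xs" by (auto simp: last_conv_nth) (metis diff_Suc_1 last_conv_nth list.size(3) nat.distinct(1))
    then show ?thesis using assms(3) 2 by simp
  next
    case 3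
    then show ?thesis using assms(2) by (simp add: walks_def Suc_diff_le)
  qed
qed

lemma words_walks: "n > 0 \<Longrightarrow> words n (walks E) = paths E C n"
proof
  assume n: "n > 0"
  show "paths E C n \<subseteq> words n (walks E)"
  proof
    fix xs assume xs: "xs \<in> paths E C n"
    then have l: "length xs = n" and p: "is_path E xs" and "xs \<noteq> []" using n by (auto simp: paths_def)
    then have "last xs \<in> C" using xs last_in_set by (auto simp: paths_def)
    then obtain b where b: "(last xs, b) \<in> E" using succ by blast
    then have "b \<in> C" using EC by blast
    then obtain x where x: "x \<in> walks E" "x 0 = b" using walk_from by blast
    have "(\<lambda>i. if i < length xs then xs ! i else x (i - length xs)) \<in> walks E"
      by (rule splice_walk[OF p x(1)]) (simp add: x(2) b)
    moreover have "xs = map (\<lambda>i. if i < length xs then xs ! i else x (i - length xs)) [0..<n]"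
      by (rule nth_equalityI) (simp_all add: l)
    ultimately show "xs \<in> words n (walks E)" unfolding words_def by blast
  qed
qed (rule words_subset_paths[OF EC])

text \<open>A violation is visible on a finite window, hence the condition is closed, in contrast to
  having infinitely many occurrences. An occurrence has to start inside the window of length
  \<open>g\<close> but may end outside.\<close>

definition frequent :: "'b list \<Rightarrow> nat \<Rightarrow> (nat \<Rightarrow> 'b) set" where
  "frequent w g = {x \<in> walks E. \<forall>n. \<exists>m\<ge>n. m < n + g \<and> (\<forall>j<length w. x (m + j) = w ! j)}"

text \<open>Blocks of a common length are parsed uniquely, so \<open>N\<close> free choices of
  blocks give \<open>card B ^ N\<close> different words; \<open>w\<close>, sitting at the same place
  \<open>q\<close> of every block, recurs within two block lengths.\<close>

lemma frequent_blocks: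
  assumes p: "p > 0" and B: "\<And>b. b \<in> B \<Longrightarrow> length b = p \<and> is_path E b"
    and BB: "\<And>b b'. b \<in> B \<Longrightarrow> b' \<in> B \<Longrightarrow> (last b, hd b') \<in> E"
    and w: "\<And>b j. b \<in> B \<Longrightarrow> j < length w \<Longrightarrow> b ! (q + j) = w ! j" and q: "q + length w \<le> p"
    and finB: "finite B" "B \<noteq> {}"
  shows "card B ^ N \<le> card (words (N * p) (frequent w (2 * p)))"
proof -
  define z where "z f i = f (i div p) ! (i mod p)" for f :: "nat \<Rightarrow> 'b list" and i
  have zB: "z f \<in> frequent w (2 * p)" if f: "\<And>i. f i \<in> B" for f
    unfolding frequent_def
  proof (intro CollectI conjI allI)
    show "z f \<in> walks E" unfolding walks_def
    proof (intro CollectI allI)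
      fix i
      let ?b = "f (i div p)"
      have b: "length ?b = p" "is_path E ?b" using B[OF f] by auto
      show "(z f i, z f (Suc i)) \<in> E"
      proof (cases "Suc (i mod p) = p")
        case True
        then have s: "Suc i mod p = 0" "Suc i div p = Suc (i div p)" by (simp_all add: mod_Suc div_Suc)
        have "?b \<noteq> []" using b(1) p by auto
        moreover have "i mod p = length ?b - 1" using True b(1) by linarith
        ultimately have "?b ! (i mod p) = last ?b" by (simp add: last_conv_nth)
        moreover have "f (Suc (i div p)) ! 0 = hd (f (Suc (i div p)))"
          using B[OF f[of "Suc (i div p)"]] p by (intro hd_conv_nth[symmetric]) auto
        ultimately show ?thesis unfolding z_def s using BB[OF f f] by simp
      next
        case False
        then have s: "Suc i mod p = Suc (i mod p)" "Suc i div p = i div p" by (simp_all add: mod_Suc div_Suc)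
        have "i mod p < p" using p by simp
        then have "Suc (i mod p) < length ?b" using False b(1) by linarith
        then show ?thesis unfolding z_def s by (rule successively_nth[OF b(2)])
      qed
    qed
    fix n
    define k where "k = n div p"
    have "k * p + n mod p = n" unfolding k_def by (rule div_mult_mod_eq)
    moreover have "n mod p < p" using p by simp
    ultimately have k: "k * p \<le> n" "n < k * p + p" by linarith+
    \<comment> \<open>\<open>k\<close> is the number of the block containing position
      \<open>n\<close>. The copy of \<open>w\<close> in the next block starts after \<open>n\<close>
      and less than \<open>2 * p\<close> letters later.\<close>
    define m where "m = (k + 1) * p + q"
    show "\<exists>m\<ge>n. m < n + 2 * p \<and> (\<forall>j<length w. z f (m + j) = w ! j)"
    proof (cases "length w = 0")
      case True
      then show ?thesis using p by (intro exI[of _ n]) simp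
    next
      case False
      have "z f (m + j) = w ! j" if j: "j < length w" for j
      proof -
        have mj: "m + j = (q + j) + (k + 1) * p" by (simp add: m_def)
        have "q + j < p" using j q by linarith
        then have "(m + j) div p = k + 1" "(m + j) mod p = q + j"
          unfolding mj using p by (simp_all only: div_mult_self1 mod_mult_self1 div_less mod_less)
        then show ?thesis unfolding z_def using w[OF f j] by simp
      qed
      moreover have "q < p" using False q by linarith
      then have "n \<le> m" "m < n + 2 * p" using k unfolding m_def by (simp_all add: algebra_simps)
      ultimately show ?thesis by blast
    qed
  qed
  have conc: "map (z f) [0..<M * p] = concat (map f [0..<M])" if f: "\<And>i. f i \<in> B" for f M
  proof (induction M)
    case (Suc M)
    have "map (z f) [M * p..<M * p + p] = f M"
    proof (rule nth_equalityI)
      show "length (map (z f) [M * p..<M * p + p]) = length (f M)" using B[OF f] by simp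
      fix i assume "i < length (map (z f) [M * p..<M * p + p])"
      then show "map (z f) [M * p..<M * p + p] ! i = f M ! i" by (simp add: z_def)
    qed
    moreover have "[0..<Suc M * p] = [0..<M * p] @ [M * p..<M * p + p]"
      by (subst upt_add_eq_append[symmetric]) (simp_all add: add.commute)
    ultimately show ?case using Suc by simp
  qed simp
  let ?L = "{bs. set bs \<subseteq> B \<and> length bs = N}"
  have inj: "inj_on concat ?L"
  proof (rule inj_onI)
    fix bs cs assume bc: "bs \<in> ?L" "cs \<in> ?L" "concat bs = concat cs"
    show "bs = cs"
    proof (rule concat_injective[OF bc(3)])
      show "length bs = length cs" using bc by simp
      show "\<forall>(x, y)\<in>set (zip bs cs). length x = length y"
      proof (clarify)
        fix x y assume "(x, y) \<in> set (zip bs cs)"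
        then have "x \<in> B" "y \<in> B" using bc(1,2) set_zip_leftD set_zip_rightD by fast+
        then show "length x = length y" using B by simp
      qed
    qed
  qed
  have sub: "concat ` ?L \<subseteq> words (N * p) (frequent w (2 * p))"
  proof
    fix u assume "u \<in> concat ` ?L"
    then obtain bs where bs: "set bs \<subseteq> B" "length bs = N" "u = concat bs" by blast
    obtain b0 where b0: "b0 \<in> B" using finB by blast
    \<comment> \<open>Only the first \<open>N\<close> blocks are prescribed; \<open>b0\<close> fills
      up the rest of the infinite walk.\<close>
    define f where "f i = (if i < N then bs ! i else b0)" for i
    have f: "f i \<in> B" for i using bs b0 nth_mem[of i bs] by (auto simp: f_def)
    have "map f [0..<N] = bs" by (rule nth_equalityI) (simp_all add: f_def bs)
    then have "u = map (z f) [0..<N * p]" using conc[of f N] f bs(3) by simp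
    then show "u \<in> words (N * p) (frequent w (2 * p))"
      unfolding words_def using zB[of f] f by blast
  qed
  have "finite (words (N * p) (frequent w (2 * p)))"
  proof (rule finite_subset[OF _ finite_paths[OF fin]])
    have "words (N * p) (frequent w (2 * p)) \<subseteq> words (N * p) (walks E)"
      unfolding words_def frequent_def by blast
    also have "\<dots> \<subseteq> paths E C (N * p)" by (rule words_subset_paths[OF EC])
    finally show "words (N * p) (frequent w (2 * p)) \<subseteq> paths E C (N * p)" .
  qed
  from card_mono[OF this sub] show ?thesis
    unfolding card_image[OF inj] card_lists_length_eq[OF finB(1)] .
qed

text \<open>Blocks with fixed first and last letters can be concatenated freely through a fixed
  connecting word that contains \<open>w\<close>.\<close>

lemma frequent_entropy:
  assumes w: "is_path E w" "w \<noteq> []" "set w \<subseteq> C"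
  obtains D where "\<And>k. k > 0 \<Longrightarrow> \<exists>p>0. p \<le> k + D \<and>
    (\<forall>N. real (card (paths E C k)) ^ N \<le> real (card C ^ 2) ^ N * real (card (words (N * p) (frequent w (2 * p)))))"
proof -
  \<comment> \<open>\<open>v\<close> will be inserted between a block ending in \<open>t\<close> and
    a block starting in \<open>s\<close>.\<close>
  have "\<exists>v q. is_path E (t # v @ [s]) \<and> q + length w \<le> length v \<and> (\<forall>j<length w. v ! (q + j) = w ! j)"
    if ts: "t \<in> C" "s \<in> C" for t s
  proof -
    obtain t' where t': "(t, t') \<in> E" using succ[OF ts(1)] by blast
    then have "t' \<in> C" using EC by blast
    from path_through[OF w this] obtain xs where xs: "is_path E (t' # xs)" "sublist w (t' # xs)" by blast
    then obtain ps ss where ps: "t' # xs = ps @ w @ ss" unfolding sublist_def by blast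
    have "t' \<in> C \<Longrightarrow> set (t' # xs) \<subseteq> C" using path_in_C[OF xs(1)] by simp
    then have "last (t' # xs) \<in> C" using \<open>t' \<in> C\<close> last_in_set[of "t' # xs"] by blast
    then obtain b where b: "(last (t' # xs), b) \<in> E" using succ by blast
    then have "b \<in> C" using EC by blast
    from connecting_path[OF this ts(2)] obtain ys where ys: "is_path E (b # ys)" "last (b # ys) = s" by blast
    have bl: "b # ys = butlast (b # ys) @ [s]" using append_butlast_last_id[of "b # ys"] ys(2) by simp
    define v where "v = (t' # xs) @ butlast (b # ys)"
    have "is_path E ((t' # xs) @ (b # ys))"
      unfolding successively_append_iff using xs(1) ys(1) b by simp
    then have "is_path E (v @ [s])" unfolding v_def using bl by simp
    moreover have "hd (v @ [s]) = t'" by (simp add: v_def)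
    ultimately have "is_path E (t # v @ [s])" using t' by (simp add: successively_Cons)
    moreover have "length ps + length w \<le> length v" unfolding v_def ps by simp
    moreover have "v ! (length ps + j) = w ! j" if "j < length w" for j
      unfolding v_def ps using that by (simp add: nth_append)
    ultimately show ?thesis by blast
  qed
  then have "\<forall>ts\<in>C \<times> C. \<exists>vq. is_path E (fst ts # fst vq @ [snd ts]) \<and> snd vq + length w \<le> length (fst vq)
      \<and> (\<forall>j<length w. fst vq ! (snd vq + j) = w ! j)"
    by simp
  from bchoice[OF this] obtain vq where vq: "\<And>t s. t \<in> C \<Longrightarrow> s \<in> C \<Longrightarrow>
      is_path E (t # fst (vq (t, s)) @ [s]) \<and> snd (vq (t, s)) + length w \<le> length (fst (vq (t, s)))
      \<and> (\<forall>j<length w. fst (vq (t, s)) ! (snd (vq (t, s)) + j) = w ! j)"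
    by auto
  \<comment> \<open>The connecting words do not depend on \<open>k\<close>, so neither does the
    overhead \<open>D\<close>.\<close>
  define D where "D = Max ((\<lambda>ts. length (fst (vq ts))) ` (C \<times> C))"
  have "\<exists>p>0. p \<le> k + D \<and>
    (\<forall>N. real (card (paths E C k)) ^ N \<le> real (card C ^ 2) ^ N * real (card (words (N * p) (frequent w (2 * p)))))"
    if k: "k > 0" for k
  proof -
    define L where "L = (\<lambda>(s, t). {xs \<in> paths E C k. hd xs = s \<and> last xs = t})"
    \<comment> \<open>Pigeonhole over the pairs of first and last letters: one class carries at
      least the fraction \<open>1 / card C ^ 2\<close> of all paths.\<close>
    have "\<exists>st\<in>C \<times> C. card (paths E C k) \<le> card C ^ 2 * card (L st)"
    proof (rule ccontr)
      assume "\<not> ?thesis"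
      then have lt: "card C ^ 2 * card (L st) < card (paths E C k)" if "st \<in> C \<times> C" for st
        using that by (meson not_le)
      have "paths E C k \<subseteq> (\<Union>st\<in>C \<times> C. L st)"
      proof
        fix xs assume xs: "xs \<in> paths E C k"
        then have "xs \<noteq> []" "set xs \<subseteq> C" using k by (auto simp: paths_def)
        then have "(hd xs, last xs) \<in> C \<times> C" by auto
        then show "xs \<in> (\<Union>st\<in>C \<times> C. L st)" by (rule UN_I) (simp add: L_def xs)
      qed
      then have "card (paths E C k) \<le> card (\<Union>st\<in>C \<times> C. L st)"
        by (rule card_mono[rotated]) (use fin finite_paths[OF fin] in \<open>auto simp: L_def\<close>)
      also have "\<dots> \<le> (\<Sum>st\<in>C \<times> C. card (L st))" using fin by (intro card_UN_le) simp
      finally have "card C ^ 2 * card (paths E C k) \<le> card C ^ 2 * (\<Sum>st\<in>C \<times> C. card (L st))"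
        by (rule mult_le_mono2)
      also have "\<dots> = (\<Sum>st\<in>C \<times> C. card C ^ 2 * card (L st))" by (rule sum_distrib_left)
      also have "\<dots> < (\<Sum>st\<in>C \<times> C. card (paths E C k))"
        using fin ne lt by (intro sum_strict_mono) auto
      also have "\<dots> = card C ^ 2 * card (paths E C k)" by (simp add: card_cartesian_product power2_eq_square)
      finally show False by simp
    qed
    then obtain s t where st: "s \<in> C" "t \<in> C" and big: "card (paths E C k) \<le> card C ^ 2 * card (L (s, t))" by auto
    define v q where "v = fst (vq (t, s))" and "q = snd (vq (t, s))"
    have v: "is_path E (t # v @ [s])" "q + length w \<le> length v" "\<And>j. j < length w \<Longrightarrow> v ! (q + j) = w ! j"
      using vq[OF st(2,1)] unfolding v_def q_def by auto
    define p where "p = k + length v"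
    have vne: "v \<noteq> []" using v(2) w(2) by auto
    have Lx: "length xs = k \<and> xs \<noteq> [] \<and> is_path E xs \<and> hd xs = s \<and> last xs = t" if "xs \<in> L (s, t)" for xs
      using that k by (auto simp: L_def paths_def)
    have vs: "(t, hd v) \<in> E" "is_path E v" "(last v, s) \<in> E"
      using v(1) vne by (auto simp: successively_Cons successively_append_iff)
    have Lne: "L (s, t) \<noteq> {}"
    proof
      assume "L (s, t) = {}"
      then have "card (paths E C k) = 0" using big by simp
      moreover have "card (paths E C k) > 0"
      proof -
        obtain m where m: "k = Suc m" using k gr0_implies_Suc by blast
        have "0 < (\<Sum>a\<in>C. card (ext m a))"
          using fin ne card_ext_pos by (intro sum_pos) auto
        then show ?thesis unfolding m card_paths_Suc .
      qed
      ultimately show False by simp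
    qed
    have finL: "finite (L (s, t))" using finite_paths[OF fin] by (simp add: L_def)
    have "card ((\<lambda>xs. xs @ v) ` L (s, t)) ^ N \<le> card (words (N * p) (frequent w (2 * p)))" for N
    proof (rule frequent_blocks[where q = "k + q"])
      show "p > 0" using k by (simp add: p_def)
      show "length b = p \<and> is_path E b" if "b \<in> (\<lambda>xs. xs @ v) ` L (s, t)" for b
        using that Lx vs by (auto simp: p_def successively_append_iff)
      show "(last b, hd b') \<in> E" if "b \<in> (\<lambda>xs. xs @ v) ` L (s, t)" "b' \<in> (\<lambda>xs. xs @ v) ` L (s, t)" for b b'
        using that Lx vs vne by auto
      show "b ! (k + q + j) = w ! j" if "b \<in> (\<lambda>xs. xs @ v) ` L (s, t)" "j < length w" for b j
        using that Lx v(3) by (auto simp: nth_append)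
      show "k + q + length w \<le> p" using v(2) by (simp add: p_def)
    qed (use finL Lne in auto)
    moreover have "card ((\<lambda>xs. xs @ v) ` L (s, t)) = card (L (s, t))"
      by (rule card_image) (simp add: inj_on_def)
    ultimately have *: "card (L (s, t)) ^ N \<le> card (words (N * p) (frequent w (2 * p)))" for N by simp
    have "real (card (paths E C k)) ^ N \<le> real (card C ^ 2) ^ N * real (card (words (N * p) (frequent w (2 * p))))" for N
    proof -
      have "card (paths E C k) ^ N \<le> (card C ^ 2 * card (L (s, t))) ^ N"
        using big by (intro power_mono) auto
      also have "\<dots> \<le> (card C ^ 2) ^ N * card (words (N * p) (frequent w (2 * p)))"
        unfolding power_mult_distrib by (intro mult_le_mono2 *)
      finally have "real (card (paths E C k) ^ N) \<le> real ((card C ^ 2) ^ N * card (words (N * p) (frequent w (2 * p))))"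
        by (rule of_nat_mono)
      then show ?thesis by (simp only: of_nat_mult of_nat_power)
    qed
    moreover have "p \<le> k + D" unfolding p_def D_def v_def using st fin
      by (intro add_left_mono Max_ge) auto
    moreover have "p > 0" using k by (simp add: p_def)
    ultimately show ?thesis by blast
  qed
  then show ?thesis by (rule that)
qed

text \<open>The block length \<open>p\<close> in \<open>frequent_entropy\<close> varies with
  \<open>k\<close>, so growth bounds for all gaps are assumed. Taking \<open>N\<close>-th roots for
  large \<open>N\<close> bounds the number of paths of length \<open>k\<close> up to the overhead
  \<open>D\<close> and the factor \<open>card C ^ 2\<close>, and both disappear as \<open>k\<close>
  grows.\<close>

lemma growth_le_of_frequent:
  assumes w: "is_path E w" "w \<noteq> []" "set w \<subseteq> C" and g: "g \<ge> 0"
    and fr: "\<And>p. exp_growth_le (\<lambda>n. card (words n (frequent w p))) g"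
  shows "exp_growth_le (\<lambda>n. card (paths E C n)) g"
proof -
  obtain D where D: "\<And>k. k > 0 \<Longrightarrow> \<exists>p>0. p \<le> k + D \<and>
    (\<forall>N. real (card (paths E C k)) ^ N \<le> real (card C ^ 2) ^ N * real (card (words (N * p) (frequent w (2 * p)))))"
    by (rule frequent_entropy[OF w]) blast
  let ?c = "real (card C ^ 2)"
  have cC: "?c > 0" using ne fin by (simp add: card_gt_0_iff)
  have bound: "real (card (paths E C k)) \<le> ?c * exp ((real k + real D) * (g + e))" if k: "k > 0" and e: "e > 0" for k e
  proof -
    obtain p where p: "p > 0" "p \<le> k + D"
      "\<And>N. real (card (paths E C k)) ^ N \<le> ?c ^ N * real (card (words (N * p) (frequent w (2 * p))))"
      using D[OF k] by blast
    have "\<forall>\<^sub>F n in sequentially. real (card (words n (frequent w (2 * p)))) \<le> exp (real n * (g + e))"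
      using fr[of "2 * p"] e unfolding exp_growth_le_def by blast
    then obtain n0 where n0: "\<And>n. n \<ge> n0 \<Longrightarrow> real (card (words n (frequent w (2 * p)))) \<le> exp (real n * (g + e))"
      unfolding eventually_sequentially by blast
    \<comment> \<open>Large enough to pass the threshold \<open>n0\<close>, and positive so that an
      \<open>N\<close>-th root can be taken.\<close>
    define N where "N = Suc n0"
    have "n0 \<le> N * p" using p(1) by (simp add: N_def trans_le_add1)
        (metis One_nat_def Suc_leI le_add2 mult.commute mult_le_mono1 nat_mult_1 trans_le_add2)
    have "real (card (paths E C k)) ^ N \<le> ?c ^ N * exp (real (N * p) * (g + e))"
      using n0[OF \<open>n0 \<le> N * p\<close>] by (intro order_trans[OF p(3)] mult_left_mono) simp_all
    also have "\<dots> = (?c * exp (real p * (g + e))) ^ N"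
      by (simp add: power_mult_distrib exp_of_nat_mult[symmetric] mult.assoc)
    finally have "real (card (paths E C k)) \<le> ?c * exp (real p * (g + e))"
      unfolding N_def by (rule power_le_imp_le_base) simp
    also have "\<dots> \<le> ?c * exp ((real k + real D) * (g + e))"
    proof (intro mult_left_mono exp_le_cancel_iff[THEN iffD2] mult_right_mono)
      show "real p \<le> real k + real D" using p(2) by linarith
    qed (use g e in auto)
    finally show ?thesis .
  qed
  show ?thesis unfolding exp_growth_le_def
  proof (intro allI impI)
    fix e :: real assume e: "e > 0"
    define K where "K = ?c * exp (real D * (g + e / 2))"
    have "\<forall>\<^sub>F n in sequentially. K \<le> exp (real n * (e / 2))"
      using e by real_asymp
    then show "\<forall>\<^sub>F n in sequentially. real (card (paths E C n)) \<le> exp (real n * (g + e))"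
      using eventually_gt_at_top[of 0]
    proof eventually_elim
      case (elim n)
      have "real (card (paths E C n)) \<le> ?c * exp ((real n + real D) * (g + e / 2))"
        using bound[of n "e / 2"] elim e by simp
      also have "\<dots> = K * exp (real n * (g + e / 2))"
        by (simp only: K_def distrib_right exp_add mult_ac)
      also have "\<dots> \<le> exp (real n * (e / 2)) * exp (real n * (g + e / 2))"
        using elim by (intro mult_right_mono) auto
      also have "\<dots> = exp (real n * (g + e))"
        by (simp add: exp_add[symmetric] algebra_simps)
      finally show ?case .
    qed
  qed
qed

end

section \<open>Zero growth in graphs that are not irreducible\<close>

text \<open>Each factor has a uniform bound \<open>K * exp (n * e / 2)\<close>, the exponents
  belonging to \<open>i\<close> and \<open>n - i\<close> add up, and the \<open>n + 1\<close>
  summands are absorbed by the other half of \<open>e\<close>.\<close>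

lemma exp_growth_le_conv:
  assumes c: "exp_growth_le c 0" and d: "exp_growth_le d 0"
    and f: "\<And>n. f n \<le> (\<Sum>i\<le>n. c i * d (n - i))"
  shows "exp_growth_le f 0"
  unfolding exp_growth_le_def
proof (intro allI impI)
  fix e :: real assume e: "e > 0"
  have unif: "\<exists>K>0. \<forall>n. real (c n) \<le> K * exp (real n * (e / 2))" if c: "exp_growth_le c 0" for c
  proof -
    have "\<forall>\<^sub>F n in sequentially. real (c n) \<le> exp (real n * (0 + e / 2))"
      using c half_gt_zero[OF e] unfolding exp_growth_le_def by blast
    then obtain n0 where n0: "\<And>n. n \<ge> n0 \<Longrightarrow> real (c n) \<le> exp (real n * (e / 2))"
      unfolding eventually_sequentially by auto
    \<comment> \<open>Adding up the finitely many early values turns the eventual bound into one for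
      every \<open>n\<close>, since the convolution involves small indices too.\<close>
    define K where "K = 1 + (\<Sum>i<n0. real (c i))"
    have "real (c n) \<le> K * exp (real n * (e / 2))" for n
    proof (cases "n < n0")
      case True
      have "real (c n) \<le> (\<Sum>i<n0. real (c i))" using True by (intro member_le_sum) auto
      also have "\<dots> \<le> K * 1" by (simp add: K_def)
      also have "\<dots> \<le> K * exp (real n * (e / 2))"
        using e by (intro mult_left_mono) (auto simp: K_def sum_nonneg add_nonneg_nonneg)
      finally show ?thesis .
    next
      case False
      have "real (c n) \<le> 1 * exp (real n * (e / 2))" using n0[of n] False by simp
      also have "\<dots> \<le> K * exp (real n * (e / 2))"
        by (intro mult_right_mono) (auto simp: K_def sum_nonneg)
      finally show ?thesis .
    qed
    moreover have "K > 0" by (simp add: K_def add_pos_nonneg sum_nonneg)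
    ultimately show ?thesis by blast
  qed
  obtain K where K: "K > 0" "\<And>n. real (c n) \<le> K * exp (real n * (e / 2))" using unif[OF c] by blast
  obtain L where L: "L > 0" "\<And>n. real (d n) \<le> L * exp (real n * (e / 2))" using unif[OF d] by blast
  have "real (f n) \<le> (real n + 1) * (K * L) * exp (real n * (e / 2))" for n
  proof -
    have "real (f n) \<le> real (\<Sum>i\<le>n. c i * d (n - i))" using f by (rule of_nat_mono)
    also have "\<dots> = (\<Sum>i\<le>n. real (c i) * real (d (n - i)))" by simp
    also have "\<dots> \<le> (\<Sum>i\<le>n. (K * L) * exp (real n * (e / 2)))"
    proof (rule sum_mono)
      fix i assume i: "i \<in> {..n}"
      have "real (c i) * real (d (n - i)) \<le> (K * exp (real i * (e / 2))) * (L * exp (real (n - i) * (e / 2)))"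
        by (intro mult_mono K L) (use K(1) in auto)
      also have "\<dots> = (K * L) * exp (real i * (e / 2) + real (n - i) * (e / 2))"
        by (simp only: exp_add mult_ac)
      also have "real i * (e / 2) + real (n - i) * (e / 2) = real n * (e / 2)"
      proof -
        have "real i + real (n - i) = real n" using i by simp
        then show ?thesis by (simp only: distrib_right[symmetric])
      qed
      finally show "real (c i) * real (d (n - i)) \<le> (K * L) * exp (real n * (e / 2))" .
    qed
    also have "\<dots> = (real n + 1) * (K * L) * exp (real n * (e / 2))" by simp
    finally show ?thesis .
  qed
  moreover have "\<forall>\<^sub>F n in sequentially. (real n + 1) * (K * L) * exp (real n * (e / 2)) \<le> exp (real n * e)"
  proof -
    define M where "M = K * L"
    have "\<forall>\<^sub>F n in sequentially. (real n + 1) * M \<le> exp (real n * (e / 2))"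
      using e by real_asymp
    then show ?thesis
    proof eventually_elim
      case (elim n)
      have "(real n + 1) * (K * L) * exp (real n * (e / 2)) \<le> exp (real n * (e / 2)) * exp (real n * (e / 2))"
        using elim by (intro mult_right_mono) (simp_all add: M_def)
      also have "\<dots> = exp (real n * e)" by (simp add: exp_add[symmetric])
      finally show ?case .
    qed
  qed
  ultimately show "\<forall>\<^sub>F n in sequentially. real (f n) \<le> exp (real n * (0 + e))"
    by (auto elim!: eventually_mono intro: order_trans)
qed

text \<open>A path that enters a set of vertices closed under successors never leaves it again.\<close>

lemma card_paths_split:
  assumes "finite S" "S2 \<subseteq> S" "\<And>b c. b \<in> S2 \<Longrightarrow> (b, c) \<in> E \<Longrightarrow> c \<in> S \<Longrightarrow> c \<in> S2"
  shows "card (paths E S n) \<le> (\<Sum>i\<le>n. card (paths E (S - S2) i) * card (paths E S2 (n - i)))"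
proof -
  let ?A = "\<lambda>i. (\<lambda>(xs, ys). xs @ ys) ` (paths E (S - S2) i \<times> paths E S2 (n - i))"
  have "paths E S n \<subseteq> (\<Union>i\<le>n. ?A i)"
  proof
    fix zs assume z: "zs \<in> paths E S n"
    define xs ys where "xs = takeWhile (\<lambda>b. b \<notin> S2) zs" and "ys = dropWhile (\<lambda>b. b \<notin> S2) zs"
    have zs: "zs = xs @ ys" by (simp add: xs_def ys_def)
    have p: "is_path E xs" "is_path E ys" using z unfolding zs paths_def by (auto simp: successively_append_iff)
    have s: "set xs \<subseteq> S" "set ys \<subseteq> S" "length xs + length ys = n" using z unfolding zs paths_def by auto
    have "set xs \<subseteq> S - S2" using s(1) set_takeWhileD unfolding xs_def by fastforce
    moreover have "set ys \<subseteq> S2"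
    proof (cases ys)
      case (Cons b bs)
      then have "b \<in> S2" unfolding ys_def by (simp add: dropWhile_eq_Cons_conv)
      have "set vs \<subseteq> S2" if "b \<in> S2" "is_path E (b # vs)" "set vs \<subseteq> S" for vs b
        using that
      proof (induction vs arbitrary: b)
        case (Cons c vs)
        then have "c \<in> S2" using assms(3) by auto
        then show ?case using Cons by auto
      qed simp
      then show ?thesis using \<open>b \<in> S2\<close> p(2) s(2) Cons by simp
    qed simp
    ultimately have "(xs, ys) \<in> paths E (S - S2) (length xs) \<times> paths E S2 (n - length xs)"
      using p s(3) by (auto simp: paths_def)
    then have "zs \<in> ?A (length xs)" unfolding zs by (rule rev_image_eqI) simp
    moreover have "length xs \<le> n" using s(3) by simp
    ultimately show "zs \<in> (\<Union>i\<le>n. ?A i)" by blast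
  qed
  moreover have fin: "finite (paths E (S - S2) i \<times> paths E S2 j)" for i j
    using assms finite_paths finite_subset by blast
  ultimately have "card (paths E S n) \<le> card (\<Union>i\<le>n. ?A i)"
    by (intro card_mono) auto
  also have "\<dots> \<le> (\<Sum>i\<le>n. card (?A i))" by (rule card_UN_le) simp
  also have "\<dots> \<le> (\<Sum>i\<le>n. card (paths E (S - S2) i) * card (paths E S2 (n - i)))"
    using card_image_le[OF fin] by (intro sum_mono) (simp add: card_cartesian_product)
  finally show ?thesis .
qed

lemma exp_growth_le_eventually_0:
  assumes "\<And>n. n \<ge> n0 \<Longrightarrow> c n = 0" shows "exp_growth_le c 0"
  unfolding exp_growth_le_def
  by (intro allI impI eventually_sequentiallyI[of n0]) (simp add: assms)

text \<open>Induction on the vertex set. If some \<open>a\<close> does not reach all of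
  \<open>S\<close> inside \<open>S\<close>, the set \<open>R a\<close> it reaches is closed under
  successors in \<open>S\<close>, and \<open>card_paths_split\<close> reduces to two smaller sets.
  Otherwise the vertices of \<open>S\<close> reach each other and \<open>S\<close> lies in one
  component.\<close>

lemma paths_growth_zero:
  fixes F :: "'a markov_tuple"
  assumes comp: "\<And>C. irreducible_component F C \<Longrightarrow> exp_growth_le (\<lambda>n. card (paths (edges F (syms F)) C n)) 0"
    and fin: "finite (syms F)" and S: "S \<subseteq> syms F"
  shows "exp_growth_le (\<lambda>n. card (paths (edges F (syms F)) S n)) 0"
proof -
  let ?E = "edges F (syms F)"
  have "finite S" using fin S by (rule rev_finite_subset)
  then show ?thesis using S
  proof (induction S rule: finite_psubset_induct)
    case (psubset S)
    define R where "R a = {b \<in> S. (a, b) \<in> (?E \<inter> S \<times> S)\<^sup>*}" for a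
    show ?case
    proof (cases "\<exists>a\<in>S. R a \<noteq> S")
      case True
      then obtain a where a: "a \<in> S" "R a \<noteq> S" by blast
      have "R a \<subseteq> S" by (auto simp: R_def)
      have "a \<in> R a" using a(1) by (simp add: R_def)
      have "R a \<subset> S" "S - R a \<subset> S" using a \<open>R a \<subseteq> S\<close> \<open>a \<in> R a\<close> by auto
      then have g: "exp_growth_le (\<lambda>n. card (paths ?E (S - R a) n)) 0" "exp_growth_le (\<lambda>n. card (paths ?E (R a) n)) 0"
        using psubset by auto
      show ?thesis
      proof (rule exp_growth_le_conv[OF g])
        fix n
        show "card (paths ?E S n) \<le> (\<Sum>i\<le>n. card (paths ?E (S - R a) i) * card (paths ?E (R a) (n - i)))"
        proof (rule card_paths_split[OF psubset(1) \<open>R a \<subseteq> S\<close>])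
          show "c \<in> R a" if "b \<in> R a" "(b, c) \<in> ?E" "c \<in> S" for b c
            using that by (auto simp: R_def intro: rtrancl_into_rtrancl)
        qed
      qed
    next
      case False
      then have conn: "(a, b) \<in> ?E\<^sup>*" if "a \<in> S" "b \<in> S" for a b
      proof -
        have "b \<in> R a" using False that by blast
        then have "(a, b) \<in> (?E \<inter> S \<times> S)\<^sup>*" by (simp add: R_def)
        then show ?thesis by (rule rtrancl_mono[THEN subsetD, rotated]) simp
      qed
      show ?thesis
      proof (cases "S = {}")
        case True
        show ?thesis unfolding True
          by (rule exp_growth_le_eventually_0[of 1]) (auto simp: paths_def)
      next
        case False
        then obtain a where a: "a \<in> S" by blast
        \<comment> \<open>Mutual reachability is taken in the whole graph and not just inside
          \<open>S\<close>, so that \<open>C\<close> is a full component.\<close>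
        define C where "C = {b. (a, b) \<in> ?E\<^sup>* \<and> (b, a) \<in> ?E\<^sup>*}"
        have "a \<in> syms F" by (rule subsetD[OF psubset.prems a])
        have Csub: "C \<subseteq> syms F"
        proof
          fix b assume "b \<in> C"
          then have "(a, b) \<in> ?E\<^sup>*" by (simp add: C_def)
          then show "b \<in> syms F" using \<open>a \<in> syms F\<close> by (cases rule: rtranclE) (auto simp: edges_def)
        qed
        moreover have "a \<in> C" by (simp add: C_def)
        ultimately have C: "irreducible_component F C"
          unfolding irreducible_component_iff C_def by (blast intro: rtrancl_trans)
        have "S \<subseteq> C"
        proof
          fix b assume "b \<in> S"
          then show "b \<in> C" unfolding C_def using conn[OF a] conn[OF _ a] by simp
        qed
        have "card (paths ?E S n) \<le> card (paths ?E C n)" for n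
        proof (rule card_mono)
          show "finite (paths ?E C n)" by (rule finite_paths[OF finite_subset[OF Csub fin]])
          show "paths ?E S n \<subseteq> paths ?E C n" unfolding paths_def using \<open>S \<subseteq> C\<close> by blast
        qed
        then show ?thesis by (rule exp_growth_le_mono[OF comp[OF C]]) simp
      qed
    qed
  qed
qed

lemma paths_edges: "C \<subseteq> D \<Longrightarrow> paths (edges F D) C n = paths (edges F C) C n"
  unfolding paths_def
  by (intro Collect_cong conj_cong refl successively_cong) (auto simp: edges_def)

text \<open>A vertex of \<open>C\<close> without successor in \<open>C\<close> cannot reach any
  other vertex, so \<open>C\<close> is then a single vertex without loop and carries no path of
  length 2.\<close>

lemma irreducible_component_cases:
  assumes C: "irreducible_component F C" and fin: "finite (syms F)"
  obtains "irreducible_graph C (edges F C)" | "sft_restr F C = {}" "\<And>n. n \<ge> 2 \<Longrightarrow> paths (edges F C) C n = {}"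
proof (cases "\<forall>u\<in>C. \<exists>v. (u, v) \<in> edges F C")
  case True
  have "irreducible_graph C (edges F C)"
  proof
    show "finite C" "C \<noteq> {}" using C fin by (auto simp: irreducible_component_iff intro: finite_subset)
    show "edges F C \<subseteq> C \<times> C" by (auto simp: edges_def)
    show "(u, v) \<in> (edges F C)\<^sup>*" if "u \<in> C" "v \<in> C" for u v
      by (rule irreducible_component_strongly_connected[OF C that])
    show "\<exists>v. (u, v) \<in> edges F C" if "u \<in> C" for u using True that by blast
  qed
  then show ?thesis by (rule that)
next
  case False
  then obtain u where u: "u \<in> C" "\<And>v. (u, v) \<notin> edges F C" by blast
  have "C = {u}"
  proof (rule ccontr)
    assume "C \<noteq> {u}"
    then obtain v where "v \<in> C" "v \<noteq> u" using u by blast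
    then have "(u, v) \<in> (edges F C)\<^sup>*" using irreducible_component_strongly_connected[OF C] u by blast
    then show False using \<open>v \<noteq> u\<close> u(2) by (metis converse_rtranclE)
  qed
  then have E: "edges F C = {}" using u(2) by (auto simp: edges_def)
  have "C \<subseteq> syms F" using C by (simp add: irreducible_component_iff)
  then have "sft_restr F C = {}" unfolding sft_restr_eq_walks[OF \<open>C \<subseteq> syms F\<close>] E by (auto simp: walks_def)
  moreover have "paths (edges F C) C n = {}" if n: "n \<ge> 2" for n
  proof (rule equals0I)
    fix xs assume "xs \<in> paths (edges F C) C n"
    then have "is_path {} xs" "Suc 0 < length xs" using n by (auto simp: paths_def E)
    then show False using successively_nth by fastforce
  qed
  ultimately show ?thesis by (rule that(2))
qed

text \<open>Read contrapositively: exponential growth of the whole shift is already present in some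
  irreducible component.\<close>

lemma words_sft_growth_zero:
  fixes F :: "'a markov_tuple"
  assumes fin: "finite (syms F)"
    and comp: "\<And>C. irreducible_component F C \<Longrightarrow> exp_growth_le (\<lambda>n. card (words n (sft_restr F C))) 0"
  shows "exp_growth_le (\<lambda>n. card (words n (sft F))) 0"
proof -
  have "exp_growth_le (\<lambda>n. card (paths (edges F (syms F)) C n)) 0" if C: "irreducible_component F C" for C
  proof -
    have Cs: "C \<subseteq> syms F" using C by (simp add: irreducible_component_iff)
    show ?thesis unfolding paths_edges[OF Cs]
    proof (rule irreducible_component_cases[OF C fin])
      assume "irreducible_graph C (edges F C)"
      then interpret irreducible_graph C "edges F C" .
      show "exp_growth_le (\<lambda>n. card (paths (edges F C) C n)) 0"
      proof (rule exp_growth_leI_poly[OF comp[OF C], where K = 1 and \<delta> = 0 and k = 0, simplified])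
        show "\<forall>\<^sub>F n in sequentially. real (card (paths (edges F C) C n))
          \<le> (real n + 1) * real (card (words n (sft_restr F C)))"
          using eventually_gt_at_top[of 0]
        proof eventually_elim
          case (elim n)
          show ?case unfolding sft_restr_eq_walks[OF Cs] words_walks[OF elim]
            by (simp add: mult_le_cancel_right1)
        qed
      qed
    next
      assume "\<And>n. n \<ge> 2 \<Longrightarrow> paths (edges F C) C n = {}"
      then show "exp_growth_le (\<lambda>n. card (paths (edges F C) C n)) 0"
        by (intro exp_growth_le_eventually_0[of 2]) simp
    qed
  qed
  then have "exp_growth_le (\<lambda>n. card (paths (edges F (syms F)) (syms F) n)) 0"
    by (rule paths_growth_zero[OF _ fin subset_refl])
  then show ?thesis
  proof (rule exp_growth_le_mono)
    fix n
    show "card (words n (sft F)) \<le> card (paths (edges F (syms F)) (syms F) n)"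
      unfolding sft_eq_walks
      by (intro card_mono finite_paths fin words_subset_paths) (auto simp: edges_def)
  qed simp
qed

section \<open>Measure-theoretic entropy\<close>

text \<open>Termwise this is \<open>ln t <= t - 1\<close> for \<open>t = q i / p i\<close>. Asking
  only for \<open>sum q I <= 1\<close> admits test weights that are not normalized.\<close>

lemma gibbs_inequality:
  fixes p q :: "'i \<Rightarrow> real"
  assumes "finite I" and p: "\<And>i. i \<in> I \<Longrightarrow> p i \<ge> 0" and q: "\<And>i. i \<in> I \<Longrightarrow> q i > 0"
    and p1: "sum p I = 1" and q1: "sum q I \<le> 1"
  shows "- (\<Sum>i\<in>I. p i * ln (p i)) \<le> (\<Sum>i\<in>I. p i * - ln (q i))"
proof -
  have "p i * (ln (q i) - ln (p i)) \<le> q i - p i" if "i \<in> I" for i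
  proof (cases "p i = 0")
    case False
    with p[OF that] have pos: "p i > 0" by simp
    have "ln (q i) - ln (p i) = ln (q i / p i)" using pos q[OF that] by (simp add: ln_div)
    also have "\<dots> \<le> q i / p i - 1" using pos q[OF that] by (intro ln_le_minus_one) simp
    finally have "p i * (ln (q i) - ln (p i)) \<le> p i * (q i / p i - 1)"
      using pos by (intro mult_left_mono) auto
    also have "\<dots> = q i - p i" using pos by (simp add: field_simps)
    finally show ?thesis .
  qed (use q[OF that] in auto)
  then have "(\<Sum>i\<in>I. p i * (ln (q i) - ln (p i))) \<le> (\<Sum>i\<in>I. q i - p i)"
    by (rule sum_mono)
  also have "\<dots> \<le> 0" using p1 q1 by (simp add: sum_subtractf)
  finally show ?thesis
    by (simp add: sum_subtractf right_diff_distrib sum_negf)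
qed

text \<open>Approximable sets are closed under complements, as symmetric differences do not change,
  and under countable unions, as a finite part of the union carries all but \<open>e/2\<close> of
  its measure.\<close>

lemma (in finite_measure) approx_by_algebra:
  assumes alg: "algebra (space M) G" and sub: "G \<subseteq> sets M"
    and A: "A \<in> sigma_sets (space M) G" and e: "e > 0"
  shows "\<exists>B\<in>G. measure M ((A - B) \<union> (B - A)) < e"
  using A e
proof (induction A arbitrary: e rule: sigma_sets.induct)
  case (Basic a) then show ?case by (intro bexI[of _ a]) auto
next
  case Empty
  interpret algebra "space M" G by fact
  show ?case using Empty by (intro bexI[of _ "{}"]) auto
next
  case (Compl a)
  interpret algebra "space M" G by fact
  obtain B where B: "B \<in> G" "measure M ((a - B) \<union> (B - a)) < e"
    using Compl by blast
  have "a \<subseteq> space M" using sigma_sets_into_sp[OF space_closed Compl(1)] .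
  then have "(space M - a - (space M - B)) \<union> (space M - B - (space M - a)) = (a - B) \<union> (B - a)"
    using sets_into_space[OF B(1)] by blast
  then show ?case using B by (intro bexI[of _ "space M - B"]) auto
next
  case (Union a)
  interpret algebra "space M" G by fact
  have meas: "a i \<in> sets M" for i
    using Union(1) sub sets.sigma_sets_subset by blast
  define U where "U n = (\<Union>i<n. a i)" for n :: nat
  have "(\<lambda>n. measure M (U n)) \<longlonglongrightarrow> measure M (\<Union>n. U n)"
    by (intro finite_Lim_measure_incseq) (auto simp: U_def incseq_def meas intro: less_le_trans)
  moreover have UU: "(\<Union>n. U n) = (\<Union>i. a i)" by (auto simp: U_def)
  ultimately have "(\<lambda>n. measure M (U n)) \<longlonglongrightarrow> measure M (\<Union>i. a i)" by simp
  then have "\<exists>n0. \<forall>n\<ge>n0. norm (measure M (U n) - measure M (\<Union>i. a i)) < e/2"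
    using Union.prems by (intro LIMSEQ_D) auto
  then obtain n where n: "\<bar>measure M (U n) - measure M (\<Union>i. a i)\<bar> < e/2" by auto
  \<comment> \<open>The summand 1 in the denominator keeps the tolerance positive for
    \<open>n = 0\<close>.\<close>
  have "\<forall>i. \<exists>B. B \<in> G \<and> measure M ((a i - B) \<union> (B - a i)) < e / (2 * (real n + 1))"
    using Union(2) Union.prems by (simp add: Bex_def[symmetric])
  then obtain B where B: "\<And>i. B i \<in> G"
    "\<And>i. measure M ((a i - B i) \<union> (B i - a i)) < e / (2 * (real n + 1))" by metis
  have BM: "B i \<in> sets M" for i using B sub by auto
  define C where "C = (\<Union>i<n. B i)"
  have "C \<in> G" using B by (auto simp: C_def)
  have Umeas: "U n \<in> sets M" unfolding U_def using meas by auto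
  have "measure M (((\<Union>i. a i) - C) \<union> (C - (\<Union>i. a i)))
      \<le> measure M (((\<Union>i. a i) - U n) \<union> (\<Union>i<n. (a i - B i) \<union> (B i - a i)))"
    by (intro finite_measure_mono) (use meas BM Umeas in \<open>auto simp: U_def C_def\<close>)
  also have "\<dots> \<le> measure M ((\<Union>i. a i) - U n) + measure M (\<Union>i<n. (a i - B i) \<union> (B i - a i))"
    by (intro measure_Un_le) (use meas BM Umeas in auto)
  also have "measure M ((\<Union>i. a i) - U n) = measure M (\<Union>i. a i) - measure M (U n)"
    by (intro finite_measure_Diff) (use meas Umeas UU in auto)
  also have "measure M (\<Union>i<n. (a i - B i) \<union> (B i - a i)) \<le> (\<Sum>i<n. measure M ((a i - B i) \<union> (B i - a i)))"
    by (intro finite_measure_subadditive_finite) (use meas BM in auto)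
  also have "\<dots> \<le> (\<Sum>i<n. e / (2 * (real n + 1)))"
    by (intro sum_mono less_imp_le B)
  also have "\<dots> \<le> e/2" using Union.prems by (simp add: field_simps)
  finally have "measure M (((\<Union>i. a i) - C) \<union> (C - (\<Union>i. a i))) < e" using n by linarith
  then show ?case using \<open>C \<in> G\<close> by blast
qed

lemma distr_funpow:
  assumes "T \<in> measurable \<mu> \<mu>" "distr \<mu> \<mu> T = \<mu>"
  shows "(T ^^ n) \<in> measurable \<mu> \<mu>" "distr \<mu> \<mu> (T ^^ n) = \<mu>"
proof -
  have "(T ^^ n) \<in> measurable \<mu> \<mu> \<and> distr \<mu> \<mu> (T ^^ n) = \<mu>"
  proof (induction n)
    case 0 show ?case by (simp add: id_def distr_id2)
  next
    case (Suc n)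
    then have m: "T ^^ n \<in> measurable \<mu> \<mu>" by simp
    have "distr \<mu> \<mu> (T \<circ> (T ^^ n)) = distr (distr \<mu> \<mu> (T ^^ n)) \<mu> T"
      using distr_distr[OF assms(1) m] by simp
    then show ?case using Suc m assms by (auto intro: measurable_comp simp: comp_def)
  qed
  then show "(T ^^ n) \<in> measurable \<mu> \<mu>" "distr \<mu> \<mu> (T ^^ n) = \<mu>" by auto
qed

lemma measure_vimage_funpow:
  assumes T: "T \<in> measurable \<mu> \<mu>" "distr \<mu> \<mu> T = \<mu>" and E: "E \<in> sets \<mu>"
  shows "measure \<mu> ((T ^^ t) -` E \<inter> space \<mu>) = measure \<mu> E"
proof -
  have "measure (distr \<mu> \<mu> (T ^^ t)) E = measure \<mu> ((T ^^ t) -` E \<inter> space \<mu>)"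
    by (rule measure_distr[OF distr_funpow(1)[OF T] E])
  then show ?thesis
    by (rule trans[OF sym arg_cong[OF distr_funpow(2)[OF T], of "\<lambda>m. measure m E"]])
qed

lemma (in prob_space) integral_sum_indicator:
  fixes a b c :: real
  assumes "\<And>t. S t \<in> sets M"
  shows "integrable M (\<lambda>x. a + (\<Sum>t<n. b + c * indicator (S t) x))"
    and "(\<integral>x. a + (\<Sum>t<n. b + c * indicator (S t) x) \<partial>M) = a + (\<Sum>t<n. b + c * measure M (S t))"
proof -
  have const: "has_bochner_integral M (\<lambda>x. d) d" for d :: real
    using prob_space by (simp add: has_bochner_integral_iff)
  have "has_bochner_integral M (\<lambda>x. a + (\<Sum>t<n. b + c * indicator (S t) x)) (a + (\<Sum>t<n. b + c * measure M (S t)))"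
    using assms by (intro has_bochner_integral_add has_bochner_integral_sum const
      has_bochner_integral_mult_right has_bochner_integral_real_indicator) (auto simp: emeasure_eq_measure)
  then show "integrable M (\<lambda>x. a + (\<Sum>t<n. b + c * indicator (S t) x))"
    "(\<integral>x. a + (\<Sum>t<n. b + c * indicator (S t) x) \<partial>M) = a + (\<Sum>t<n. b + c * measure M (S t))"
    by (auto simp: has_bochner_integral_iff)
qed

text \<open>The test distribution in Gibbs' inequality picks one of the \<open>\<eta>\<close>-words uniformly and then
  perturbs each letter independently with probability at most \<open>\<delta>\<close>; no conditional entropies
  are needed.\<close>

lemma shannon_entropy_dyn_join_le:
  fixes \<mu> :: "'x measure" and \<eta> :: "'x \<Rightarrow> 'x set"
  assumes P: "prob_space \<mu>" and T: "T \<in> measurable \<mu> \<mu>" "distr \<mu> \<mu> T = \<mu>"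
    and fp: "finite_partition \<mu> \<xi>"
    and \<eta>: "\<And>x. x \<in> space \<mu> \<Longrightarrow> \<eta> x \<in> \<xi>"
    and E: "E \<in> sets \<mu>" "measure \<mu> E \<le> \<delta>" and \<delta>: "0 < \<delta>" "\<delta> < 1"
    and close: "\<And>x. x \<in> space \<mu> - E \<Longrightarrow> x \<in> \<eta> x"
    and S: "S \<subseteq> space \<mu>" "AE x in \<mu>. x \<in> S"
  shows "shannon_entropy \<mu> (dyn_join (space \<mu>) T n \<xi>)
    \<le> ln (card ((\<lambda>x. \<lambda>t\<in>{..<n}. \<eta> ((T ^^ t) x)) ` S))
      + n * (- ln (1 - \<delta>) + \<delta> * ln (card \<xi> / \<delta>))"
proof -
  interpret prob_space \<mu> by fact
  let ?X = "space \<mu>" and ?I = "{..<n}"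
  define W where "W = (\<lambda>x. \<lambda>t\<in>{..<n}. \<eta> ((T ^^ t) x)) ` S"
  define L where "L = PiE ?I (\<lambda>_. \<xi>)"
  define atom where "atom i = ?X \<inter> (\<Inter>t<n. (T ^^ t) -` i t)" for i
  define lab where "lab x = (THE A. A \<in> \<xi> \<and> x \<in> A)" for x
  define word where "word x = (\<lambda>t\<in>?I. lab ((T ^^ t) x))" for x
  have fin\<xi>: "finite \<xi>" and part: "partition_on ?X \<xi>" and sets\<xi>: "\<xi> \<subseteq> sets \<mu>"
    using fp by (auto simp: finite_partition_def)
  have Tm: "(T ^^ t) \<in> measurable \<mu> \<mu>" for t using distr_funpow[OF T] by simp
  have TX: "(T ^^ t) x \<in> ?X" if "x \<in> ?X" for x t using measurable_space[OF Tm that] .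
  have labI: "lab x = A" if "A \<in> \<xi>" "x \<in> A" for x A
    unfolding lab_def
  proof (rule the_equality)
    fix B assume "B \<in> \<xi> \<and> x \<in> B"
    then show "B = A"
      using disjointD[OF partition_onD2[OF part], of A B] \<open>A \<in> \<xi>\<close> \<open>x \<in> A\<close> by auto
  qed (simp add: that)
  have lab: "lab x \<in> \<xi>" "x \<in> lab x" if "x \<in> ?X" for x
  proof -
    have "x \<in> \<Union>\<xi>" using that unfolding partition_onD1[OF part] .
    then obtain A where A: "A \<in> \<xi>" "x \<in> A" by (rule UnionE)
    have "lab x = A" using A by (rule labI)
    show "lab x \<in> \<xi>" unfolding \<open>lab x = A\<close> by (rule A)
    show "x \<in> lab x" unfolding \<open>lab x = A\<close> by (rule A)
  qed
  have finL: "finite L" unfolding L_def by (rule finite_PiE) (simp_all add: fin\<xi>)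
  have WL: "W \<subseteq> L"
  proof
    fix j assume "j \<in> W"
    then obtain x where x: "x \<in> S" "j = (\<lambda>t\<in>?I. \<eta> ((T ^^ t) x))" unfolding W_def by blast
    have "\<eta> ((T ^^ t) x) \<in> \<xi>" for t using \<eta>[OF TX[OF subsetD[OF S(1) x(1)]]] .
    then show "j \<in> L" by (simp add: x L_def)
  qed
  have finW: "finite W" using WL finL by (rule finite_subset)
  have "S \<noteq> {}"
  proof
    assume "S = {}"
    with S(2) show False using AE_False by simp
  qed
  then have W0: "W \<noteq> {}" by (auto simp: W_def)
  define N where "N = real (card W)"
  have N0: "N > 0" "N \<ge> 1" using W0 finW by (auto simp: N_def Suc_le_eq card_gt_0_iff)
  have \<xi>0: "\<xi> \<noteq> {}" using \<open>S \<noteq> {}\<close> S(1) \<eta> by blast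
  define r where "r = real (card \<xi>)"
  have r1: "r \<ge> 1" using \<xi>0 fin\<xi> by (auto simp: r_def Suc_le_eq card_gt_0_iff)
  \<comment> \<open>The weight of the true letter \<open>A\<close> given the letter \<open>B\<close>
    of an \<open>\<eta>\<close>-word: agreement has weight \<open>1 - \<delta>\<close>, any other
    letter \<open>\<delta> / r\<close>. For fixed \<open>B\<close> the total is at most 1.\<close>
  define p where "p A B = (if A = B then 1 - \<delta> else \<delta> / r)" for A B :: "'x set"
  have p0: "p A B > 0" for A B using \<delta> r1 by (auto simp: p_def)
  have psum: "(\<Sum>A\<in>\<xi>. p A B) \<le> 1" if "B \<in> \<xi>" for B
  proof -
    have "(\<Sum>A\<in>\<xi>. p A B) = p B B + (\<Sum>A\<in>\<xi> - {B}. p A B)"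
      using that fin\<xi> by (simp add: sum.remove)
    also have "(\<Sum>A\<in>\<xi> - {B}. p A B) = (\<Sum>A\<in>\<xi> - {B}. \<delta> / r)"
      by (intro sum.cong) (auto simp: p_def)
    also have "\<dots> \<le> (\<Sum>A\<in>\<xi>. \<delta> / r)" using fin\<xi> \<delta> r1 by (intro sum_mono2) auto
    also have "\<dots> = \<delta>" using r1 by (simp add: r_def)
    finally show ?thesis by (simp add: p_def)
  qed
  define Q where "Q i = (\<Sum>j\<in>W. (1 / N) * (\<Prod>t<n. p (i t) (j t)))" for i
  have Q0: "Q i > 0" for i
    unfolding Q_def using finW W0 N0 p0 by (intro sum_pos mult_pos_pos prod_pos) auto
  have Q1: "sum Q L \<le> 1"
  proof -
    have "sum Q L = (\<Sum>j\<in>W. (1 / N) * (\<Sum>i\<in>L. \<Prod>t<n. p (i t) (j t)))"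
      unfolding Q_def by (subst sum.swap) (simp add: sum_distrib_left)
    also have "\<dots> = (\<Sum>j\<in>W. (1 / N) * (\<Prod>t<n. \<Sum>A\<in>\<xi>. p A (j t)))"
      unfolding L_def using fin\<xi> by (subst prod_sum_PiE) auto
    also have "\<dots> \<le> (\<Sum>j\<in>W. (1 / N) * 1)"
    proof (intro sum_mono mult_left_mono)
      fix j assume "j \<in> W"
      then have "j t \<in> \<xi>" if "t < n" for t using WL that by (auto simp: L_def PiE_iff)
      then show "(\<Prod>t<n. \<Sum>A\<in>\<xi>. p A (j t)) \<le> 1"
        by (intro prod_le_1) (auto intro!: psum sum_nonneg less_imp_le[OF p0])
    qed (use N0 in auto)
    also have "\<dots> = 1" using N0 by (simp add: N_def)
    finally show ?thesis .
  qed
  have word_L: "word x \<in> L" if "x \<in> ?X" for x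
    using that lab TX by (auto simp: word_def L_def)
  have in_atom: "x \<in> atom i \<longleftrightarrow> i = word x" if "x \<in> ?X" "i \<in> L" for x i
  proof
    assume "x \<in> atom i"
    then have "lab ((T ^^ t) x) = i t" if "t < n" for t
      using that \<open>i \<in> L\<close> by (intro labI) (auto simp: atom_def L_def PiE_iff)
    then show "i = word x" using \<open>i \<in> L\<close>
      by (auto simp: word_def L_def PiE_iff extensional_def fun_eq_iff)
  next
    assume "i = word x"
    then show "x \<in> atom i" using that lab TX by (auto simp: atom_def word_def)
  qed
  have atom_sets: "atom i \<in> sets \<mu>" if "i \<in> L" for i
  proof -
    have "atom i = (\<Inter>t\<in>{..<n}. (T ^^ t) -` i t \<inter> ?X) \<inter> ?X" by (auto simp: atom_def)
    also have "\<dots> \<in> sets \<mu>"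
    proof (cases "n = 0")
      case False
      have "(T ^^ t) -` i t \<inter> ?X \<in> sets \<mu>" if "t < n" for t
        using \<open>i \<in> L\<close> that sets\<xi> by (intro measurable_sets[OF Tm]) (auto simp: L_def PiE_iff)
      with False have "(\<Inter>t\<in>{..<n}. (T ^^ t) -` i t \<inter> ?X) \<in> sets \<mu>"
        by (intro sets.finite_INT) auto
      then show ?thesis by auto
    qed auto
    finally show ?thesis .
  qed
  have sum_int: "(\<Sum>i\<in>L. measure \<mu> (atom i) * k i) = (\<integral>x. k (word x) \<partial>\<mu>)"
    and k_int: "integrable \<mu> (\<lambda>x. k (word x))" for k :: "_ \<Rightarrow> real"
  proof -
    have eq: "(\<Sum>i\<in>L. indicator (atom i) x * k i) = k (word x)" if "x \<in> ?X" for x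
    proof -
      have "(\<Sum>i\<in>L. indicator (atom i) x * k i) = (\<Sum>i\<in>L. if i = word x then k i else 0)"
        using that in_atom by (intro sum.cong) (auto simp: indicator_def)
      then show ?thesis using word_L[OF that] finL by simp
    qed
    have int: "integrable \<mu> (\<lambda>x. indicator (atom i) x * k i)" if "i \<in> L" for i
      using atom_sets[OF that] by (auto intro!: integrable_mult_left simp: integrable_indicator_iff emeasure_eq_measure)
    have "(\<integral>x. k (word x) \<partial>\<mu>) = (\<integral>x. (\<Sum>i\<in>L. indicator (atom i) x * k i) \<partial>\<mu>)"
      by (intro Bochner_Integration.integral_cong) (auto simp: eq)
    also have "\<dots> = (\<Sum>i\<in>L. \<integral>x. indicator (atom i) x * k i \<partial>\<mu>)"
      using int by (intro Bochner_Integration.integral_sum) auto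
    also have "\<dots> = (\<Sum>i\<in>L. measure \<mu> (atom i) * k i)"
      using atom_sets sets.sets_into_space[OF atom_sets] by (intro sum.cong) (auto simp: Int_absorb2)
    finally show "(\<Sum>i\<in>L. measure \<mu> (atom i) * k i) = (\<integral>x. k (word x) \<partial>\<mu>)" by simp
    have "integrable \<mu> (\<lambda>x. (\<Sum>i\<in>L. indicator (atom i) x * k i))"
      using int by (intro Bochner_Integration.integrable_sum) auto
    then show "integrable \<mu> (\<lambda>x. k (word x))"
      by (subst Bochner_Integration.integrable_cong[OF refl, of \<mu> _ "(\<lambda>x. (\<Sum>i\<in>L. indicator (atom i) x * k i))"]) (auto simp: eq)
  qed
  have dj: "dyn_join ?X T n \<xi> = atom ` L"
  proof (intro equalityI subsetI)
    fix B assume "B \<in> dyn_join ?X T n \<xi>"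
    then obtain V where V: "B = ?X \<inter> (\<Inter>i<n. (T ^^ i) -` V i)" "\<forall>i<n. V i \<in> \<xi>"
      by (auto simp: dyn_join_def)
    have "B = atom (restrict V ?I)" unfolding V atom_def by auto
    then show "B \<in> atom ` L" using V by (auto simp: L_def)
  next
    fix B assume "B \<in> atom ` L"
    then show "B \<in> dyn_join ?X T n \<xi>" unfolding dyn_join_def atom_def L_def by (auto simp: PiE_iff)
  qed
  have "shannon_entropy \<mu> (dyn_join ?X T n \<xi>) = - (\<Sum>i\<in>L. measure \<mu> (atom i) * ln (measure \<mu> (atom i)))"
    unfolding shannon_entropy_def dj
  \<comment> \<open>Different words give the same atom only if it is empty, so the entropy may be
    summed over words.\<close>
  proof (subst sum.reindex_nontrivial[OF finL])
    fix i j assume ij: "i \<in> L" "j \<in> L" "i \<noteq> j" "atom i = atom j"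
    have "atom i = {}"
    proof (rule ccontr)
      assume "atom i \<noteq> {}"
      then obtain x where "x \<in> atom i" "x \<in> atom j" using ij by auto
      moreover then have "x \<in> ?X" by (auto simp: atom_def)
      ultimately show False using in_atom[of x i] in_atom[of x j] ij by auto
    qed
    then show "measure \<mu> (atom i) * ln (measure \<mu> (atom i)) = 0" by simp
  qed (simp add: comp_def)
  also have "\<dots> \<le> (\<Sum>i\<in>L. measure \<mu> (atom i) * - ln (Q i))"
  proof (rule gibbs_inequality[OF finL _ Q0 _ Q1])
    show "(\<Sum>i\<in>L. measure \<mu> (atom i)) = 1"
      using sum_int[of "\<lambda>_. 1"] prob_space by simp
  qed auto
  also have "\<dots> = (\<integral>x. - ln (Q (word x)) \<partial>\<mu>)" by (rule sum_int[of "\<lambda>i. - ln (Q i)"])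
  also have "\<dots> \<le> (\<integral>x. ln N + (\<Sum>t<n. - ln (1 - \<delta>) + ln (r / \<delta>) * indicator ((T ^^ t) -` E \<inter> ?X) x) \<partial>\<mu>)"
  proof (rule integral_mono_AE)
    show "integrable \<mu> (\<lambda>x. ln N + (\<Sum>t<n. - ln (1 - \<delta>) + ln (r / \<delta>) * indicator ((T ^^ t) -` E \<inter> ?X) x))"
      by (intro integral_sum_indicator(1) measurable_sets[OF Tm E(1)])
    show "AE x in \<mu>. - ln (Q (word x)) \<le> ln N + (\<Sum>t<n. - ln (1 - \<delta>) + ln (r / \<delta>) * indicator ((T ^^ t) -` E \<inter> ?X) x)"
      using S(2)
    proof eventually_elim
      fix x assume x: "x \<in> S"
      then have xX: "x \<in> ?X" using S by auto
      let ?j = "\<lambda>t\<in>?I. \<eta> ((T ^^ t) x)"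
      have j: "?j \<in> W" using x by (auto simp: W_def)
      have pos: "(1 / N) * (\<Prod>t<n. p (word x t) (?j t)) > 0"
        using N0 p0 by (intro mult_pos_pos prod_pos) auto
      \<comment> \<open>Of the mixture \<open>Q\<close> only the summand of the
        \<open>\<eta>\<close>-word of \<open>x\<close> itself is kept; this is where
        \<open>ln N\<close> comes from.\<close>
      have "(1 / N) * (\<Prod>t<n. p (word x t) (?j t)) \<le> Q (word x)"
        unfolding Q_def
      proof (rule member_le_sum[where f = "\<lambda>j. (1 / N) * (\<Prod>t<n. p (word x t) (j t))" and i = ?j, OF j _ finW])
        show "0 \<le> (1 / N) * (\<Prod>t<n. p (word x t) (j t))" for j
          using N0(1) p0 by (intro mult_nonneg_nonneg prod_nonneg) (simp_all add: less_imp_le)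
      qed
      then have "ln ((1 / N) * (\<Prod>t<n. p (word x t) (?j t))) \<le> ln (Q (word x))"
        by (rule ln_mono) (rule pos)
      then have "- ln (Q (word x)) \<le> - ln ((1 / N) * (\<Prod>t<n. p (word x t) (?j t)))"
        by (rule le_imp_neg_le)
      also have "\<dots> = ln N - (\<Sum>t<n. ln (p (word x t) (?j t)))"
      proof -
        have "ln (\<Prod>t<n. p (word x t) (?j t)) = (\<Sum>t<n. ln (p (word x t) (?j t)))"
          by (intro ln_prod) (simp_all add: p0 less_imp_neq[OF p0, symmetric])
        moreover have "(\<Prod>t<n. p (word x t) (?j t)) > 0" using p0 by (intro prod_pos) auto
        ultimately show ?thesis using N0(1) by (simp only: ln_mult_pos ln_div zero_less_divide_1_iff) simp
      qed
      also have "\<dots> = ln N + (\<Sum>t<n. - ln (p (lab ((T ^^ t) x)) (\<eta> ((T ^^ t) x))))"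
        by (simp add: sum_negf word_def)
      also have "\<dots> \<le> ln N + (\<Sum>t<n. - ln (1 - \<delta>) + ln (r / \<delta>) * indicator ((T ^^ t) -` E \<inter> ?X) x)"
      proof (intro add_left_mono sum_mono)
        fix t assume "t \<in> {..<n}"
        let ?y = "(T ^^ t) x"
        have y: "?y \<in> ?X" using TX xX by auto
        have l0: "ln (1 - \<delta>) \<le> 0" using \<delta> by simp
        have l1: "ln (r / \<delta>) \<ge> 0" using \<delta> r1 by (intro ln_ge_zero) (auto simp: field_simps)
        have l2: "ln (\<delta> / r) = - ln (r / \<delta>)" using \<delta> r1 by (simp add: ln_div)
        show "- ln (p (lab ?y) (\<eta> ?y)) \<le> - ln (1 - \<delta>) + ln (r / \<delta>) * indicator ((T ^^ t) -` E \<inter> ?X) x"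
        proof (cases "?y \<in> E")
          case True
          then show ?thesis using l0 l1 l2 xX by (auto simp: p_def)
        next
          case False
          then have "lab ?y = \<eta> ?y" using close[of ?y] y \<eta>[OF y] by (intro labI) auto
          then have "p (lab ?y) (\<eta> ?y) = 1 - \<delta>" unfolding p_def by (rule if_P)
          moreover have "indicator ((T ^^ t) -` E \<inter> ?X) x = (0 :: real)" using False by simp
          ultimately show ?thesis by simp
        qed
      qed
      finally show "- ln (Q (word x)) \<le> ln N + (\<Sum>t<n. - ln (1 - \<delta>) + ln (r / \<delta>) * indicator ((T ^^ t) -` E \<inter> ?X) x)" .
    qed
  qed (rule k_int[of "\<lambda>i. - ln (Q i)"])
  finally have main: "shannon_entropy \<mu> (dyn_join ?X T n \<xi>) \<le> (\<integral>x. ln N + (\<Sum>t<n. - ln (1 - \<delta>) + ln (r / \<delta>) * indicator ((T ^^ t) -` E \<inter> ?X) x) \<partial>\<mu>)" .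
  have s: "(T ^^ t) -` E \<inter> ?X \<in> sets \<mu>" for t using measurable_sets[OF Tm E(1)] .
  \<comment> \<open>By invariance \<open>E\<close> is visited at each time \<open>t\<close> with the
    same probability, so every time step costs the same.\<close>
  have "(\<integral>x. ln N + (\<Sum>t<n. - ln (1 - \<delta>) + ln (r / \<delta>) * indicator ((T ^^ t) -` E \<inter> ?X) x) \<partial>\<mu>)
      = ln N + (\<Sum>t<n. - ln (1 - \<delta>) + ln (r / \<delta>) * measure \<mu> E)"
    by (subst integral_sum_indicator(2)[OF s]) (simp only: measure_vimage_funpow[OF T E(1)])
  also have "\<dots> \<le> ln N + (\<Sum>t<n. - ln (1 - \<delta>) + ln (r / \<delta>) * \<delta>)"
    using E(2) \<delta> r1 by (intro add_left_mono sum_mono mult_left_mono) (auto simp: field_simps intro!: ln_ge_zero)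
  also have "\<dots> = ln N + n * (- ln (1 - \<delta>) + \<delta> * ln (r / \<delta>))" by (simp add: mult.commute)
  finally show ?thesis using main unfolding N_def r_def W_def by linarith
qed

lemma perturbation_cost_small:
  fixes r e :: real
  assumes "r \<ge> 1" "e > 0"
  obtains \<delta> where "0 < \<delta>" "\<delta> < 1" "- ln (1 - \<delta>) + \<delta> * ln (r / \<delta>) < e"
proof -
  have r: "r > 0" using assms by simp
  have "((\<lambda>\<delta>. - ln (1 - \<delta>) + \<delta> * (ln r - ln \<delta>)) \<longlongrightarrow> 0) (at_right 0)"
    using r by real_asymp
  then have "\<forall>\<^sub>F \<delta> in at_right 0. - ln (1 - \<delta>) + \<delta> * (ln r - ln \<delta>) < e"
    using assms(2) by (intro order_tendstoD(2))
  moreover have "\<forall>\<^sub>F \<delta> in at_right (0::real). \<delta> < 1 \<and> \<delta> > 0"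
    by (intro eventually_conj eventually_at_right_less eventually_at_rightI[of 0 1]) auto
  ultimately have "\<forall>\<^sub>F \<delta> in at_right 0. - ln (1 - \<delta>) + \<delta> * (ln r - ln \<delta>) < e \<and> (\<delta> < 1 \<and> \<delta> > 0)"
    by (rule eventually_conj)
  from eventually_happens'[OF _ this] obtain \<delta>
    where d: "- ln (1 - \<delta>) + \<delta> * (ln r - ln \<delta>) < e" "\<delta> < 1" "\<delta> > 0"
    by (auto simp: trivial_limit_at_right_real)
  have "ln (r / \<delta>) = ln r - ln \<delta>" using r d(3) by (simp add: ln_div)
  with d show ?thesis using that[of \<delta>] by simp
qed

text \<open>It suffices to count patterns with respect to finite subfamilies of a generating
  algebra, along a set of full measure. An arbitrary partition is replaced by the labelling
  \<open>\<eta>\<close>, which reads off such a pattern and is wrong with probability at most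
  \<open>\<delta>\<close>; \<open>shannon_entropy_dyn_join_le\<close> turns this error into a cost
  per step below \<open>e / 2\<close>.\<close>

lemma h_measure_le:
  fixes \<mu> :: "'x measure"
  assumes P: "prob_space \<mu>" and T: "T \<in> measurable \<mu> \<mu>" "distr \<mu> \<mu> T = \<mu>"
    and alg: "algebra (space \<mu>) G" and gen: "sets \<mu> = sigma_sets (space \<mu>) G"
    and S: "S \<subseteq> space \<mu>" "AE x in \<mu>. x \<in> S" and h: "h \<ge> 0"
    and count: "\<And>B. finite B \<Longrightarrow> B \<subseteq> G \<Longrightarrow>
      exp_growth_le (\<lambda>n. card ((\<lambda>x. \<lambda>t\<in>{..<n}. {b \<in> B. (T ^^ t) x \<in> b}) ` S)) h"
  shows "h_measure \<mu> T \<le> ennreal h"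
  unfolding h_measure_def
proof (rule SUP_least, rule ennreal_le_epsilon)
  interpret prob_space \<mu> by fact
  fix \<xi> and e :: real assume "\<xi> \<in> {\<xi>. finite_partition \<mu> \<xi>}" and e: "e > 0"
  then have fp: "finite_partition \<mu> \<xi>" by simp
  then have fin: "finite \<xi>" and part: "partition_on (space \<mu>) \<xi>" and sets: "\<xi> \<subseteq> sets \<mu>"
    by (auto simp: finite_partition_def)
  have "\<xi> \<noteq> {}" using partition_onD1[OF part] not_empty by auto
  then obtain A0 where A0: "A0 \<in> \<xi>" by blast
  define r where "r = real (card \<xi>)"
  have r: "r \<ge> 1" using \<open>\<xi> \<noteq> {}\<close> fin by (simp add: r_def Suc_le_eq card_gt_0_iff)
  obtain \<delta> where \<delta>: "0 < \<delta>" "\<delta> < 1" "- ln (1 - \<delta>) + \<delta> * ln (r / \<delta>) < e / 2"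
    using perturbation_cost_small[OF r, of "e / 2"] e by auto
  have "\<exists>B\<in>G. measure \<mu> ((A - B) \<union> (B - A)) < \<delta> / r" if "A \<in> \<xi>" for A
  proof (rule approx_by_algebra[OF alg])
    show "G \<subseteq> events" unfolding gen by blast
    show "A \<in> sigma_sets (space \<mu>) G" using that sets gen by blast
    show "0 < \<delta> / r" using \<delta> r by simp
  qed
  then obtain B where B: "\<And>A. A \<in> \<xi> \<Longrightarrow> B A \<in> G"
    "\<And>A. A \<in> \<xi> \<Longrightarrow> measure \<mu> ((A - B A) \<union> (B A - A)) < \<delta> / r" by metis
  have Bm: "B A \<in> events" "A \<in> events" if "A \<in> \<xi>" for A
    using B(1)[OF that] gen that sets by blast+
  define E where "E = (\<Union>A\<in>\<xi>. (A - B A) \<union> (B A - A))"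
  have E: "E \<in> events" unfolding E_def using fin Bm by blast
  have "measure \<mu> E \<le> (\<Sum>A\<in>\<xi>. measure \<mu> ((A - B A) \<union> (B A - A)))"
    unfolding E_def using fin Bm by (intro finite_measure_subadditive_finite) auto
  also have "\<dots> \<le> (\<Sum>A\<in>\<xi>. \<delta> / r)" by (intro sum_mono less_imp_le B)
  also have "\<dots> = \<delta>" using r by (simp add: r_def)
  finally have E\<delta>: "measure \<mu> E \<le> \<delta>" .
  \<comment> \<open>Decoding of a pattern: the atom whose approximating set is the only one
    containing the point, with \<open>A0\<close> as default for patterns without a unique candidate.
    Outside \<open>E\<close> there is always exactly one.\<close>
  define g where "g P = (if \<exists>!A. A \<in> \<xi> \<and> B A \<in> P then THE A. A \<in> \<xi> \<and> B A \<in> P else A0)" for P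
  define \<eta> where "\<eta> x = g {b \<in> B ` \<xi>. x \<in> b}" for x
  have g: "g P \<in> \<xi>" for P
  proof (cases "\<exists>!A. A \<in> \<xi> \<and> B A \<in> P")
    case True
    then show ?thesis using theI'[OF True] unfolding g_def by simp
  qed (simp add: g_def A0)
  have close: "x \<in> \<eta> x" if x: "x \<in> space \<mu> - E" for x
  proof -
    have iff: "x \<in> B A \<longleftrightarrow> x \<in> A" if "A \<in> \<xi>" for A using x that unfolding E_def by blast
    have "x \<in> \<Union>\<xi>" using x partition_onD1[OF part] by simp
    then obtain A where A: "A \<in> \<xi>" "x \<in> A" by (rule UnionE)
    have uniq: "A' = A" if "A' \<in> \<xi>" "x \<in> A'" for A'
      using disjointD[OF partition_onD2[OF part] that(1) A(1)] that A by blast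
    have *: "A' \<in> \<xi> \<and> B A' \<in> {b \<in> B ` \<xi>. x \<in> b} \<longleftrightarrow> A' = A" for A'
    proof
      assume "A' \<in> \<xi> \<and> B A' \<in> {b \<in> B ` \<xi>. x \<in> b}"
      then have "A' \<in> \<xi>" "x \<in> B A'" by simp_all
      then show "A' = A" using iff[of A'] uniq[of A'] by simp
    next
      assume "A' = A"
      then show "A' \<in> \<xi> \<and> B A' \<in> {b \<in> B ` \<xi>. x \<in> b}" using iff[of A] A by simp
    qed
    have "\<eta> x = A" unfolding \<eta>_def g_def * by simp
    then show ?thesis using A(2) by (rule ssubst)
  qed
  let ?pat = "\<lambda>n. (\<lambda>x. \<lambda>t\<in>{..<n}. {b \<in> B ` \<xi>. (T ^^ t) x \<in> b}) ` S"
  let ?W = "\<lambda>n. (\<lambda>x. \<lambda>t\<in>{..<n}. \<eta> ((T ^^ t) x)) ` S"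
  have card_le: "card (?W n) \<le> card (?pat n)" for n
  proof -
    have "?pat n \<subseteq> PiE {..<n} (\<lambda>_. Pow (B ` \<xi>))"
      by (intro image_subsetI restrict_PiE_iff[THEN iffD2] ballI) blast
    then have finp: "finite (?pat n)"
      by (rule finite_subset) (use fin in \<open>auto intro: finite_PiE\<close>)
    have "?W n = (\<lambda>f. \<lambda>t\<in>{..<n}. g (f t)) ` ?pat n"
      unfolding image_image \<eta>_def by (intro image_cong refl restrict_ext) simp
    then show ?thesis using card_image_le[OF finp] by simp
  qed
  have growth: "exp_growth_le (\<lambda>n. card (?pat n)) h"
    using B(1) fin by (intro count) auto
  then have "\<forall>\<^sub>F n in sequentially. real (card (?pat n)) \<le> exp (real n * (h + e / 2))"
    using e unfolding exp_growth_le_def by (meson half_gt_zero)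
  then have "\<forall>\<^sub>F n in sequentially. ennreal (shannon_entropy \<mu> (dyn_join (space \<mu>) T n \<xi>) / real n) \<le> ennreal (h + e)"
    using eventually_gt_at_top[of 0]
  proof eventually_elim
    fix n :: nat assume n: "real (card (?pat n)) \<le> exp (real n * (h + e / 2))" "n > 0"
    have "ln (card (?W n)) \<le> real n * (h + e / 2)"
    proof (cases "card (?W n) = 0")
      case True
      then show ?thesis using h e by simp
    next
      case False
      then have "ln (card (?W n)) \<le> ln (exp (real n * (h + e / 2)))"
        using card_le[of n] n(1) by (subst ln_le_cancel_iff) auto
      then show ?thesis by simp
    qed
    moreover have "shannon_entropy \<mu> (dyn_join (space \<mu>) T n \<xi>)
      \<le> ln (card (?W n)) + n * (- ln (1 - \<delta>) + \<delta> * ln (card \<xi> / \<delta>))"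
    proof (rule shannon_entropy_dyn_join_le[OF P T fp _ E E\<delta> \<delta>(1,2) close S])
      show "\<eta> x \<in> \<xi>" for x unfolding \<eta>_def by (rule g)
    qed
    moreover have "n * (- ln (1 - \<delta>) + \<delta> * ln (card \<xi> / \<delta>)) \<le> n * (e / 2)"
      using \<delta>(3) unfolding r_def by (intro mult_left_mono) auto
    ultimately have "shannon_entropy \<mu> (dyn_join (space \<mu>) T n \<xi>) \<le> real n * (h + e)"
      by (simp add: algebra_simps)
    then show "ennreal (shannon_entropy \<mu> (dyn_join (space \<mu>) T n \<xi>) / real n) \<le> ennreal (h + e)"
      using n(2) by (intro ennreal_leI) (simp add: field_simps)
  qed
  then have "partition_entropy \<mu> T \<xi> \<le> ennreal (h + e)"
    unfolding partition_entropy_def by (rule Limsup_bounded)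
  then show "partition_entropy \<mu> T \<xi> \<le> ennreal h + ennreal e"
    using h e by (simp add: ennreal_plus)
qed

section \<open>Recurrence and codes under an ergodic measure\<close>

lemma infinite_Collect_nat_iff: "infinite {n. P n} \<longleftrightarrow> (\<forall>m. \<exists>n\<ge>m. P (n::nat))"
  by (simp add: infinite_nat_iff_unbounded_le)

text \<open>For positive measure, the set \<open>L\<close> of points visiting \<open>A\<close>
  infinitely often is exactly invariant, as the definition of ergodicity demands, and has at least
  the measure of \<open>A\<close>, because every tail union contains a preimage of
  \<open>A\<close>.\<close>

lemma ergodic_recurrence:
  assumes erg: "ergodic_prob X T \<mu>" and A: "A \<in> sets \<mu>"
  shows "measure \<mu> A = 0 \<Longrightarrow> AE x in \<mu>. \<forall>n. (T ^^ n) x \<notin> A"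
    and "measure \<mu> A > 0 \<Longrightarrow> AE x in \<mu>. infinite {n. (T ^^ n) x \<in> A}"
proof -
  from erg have P: "prob_space \<mu>" and T: "T \<in> measurable \<mu> \<mu>" "distr \<mu> \<mu> T = \<mu>"
    and inv: "\<And>B. B \<in> sets \<mu> \<Longrightarrow> T -` B \<inter> space \<mu> = B \<Longrightarrow> measure \<mu> B = 0 \<or> measure \<mu> B = 1"
    by (auto simp: ergodic_prob_def invariant_prob_def)
  interpret prob_space \<mu> by fact
  let ?V = "\<lambda>n. (T ^^ n) -` A \<inter> space \<mu>"
  have V: "?V n \<in> sets \<mu>" for n
    by (rule measurable_sets[OF distr_funpow(1)[OF T] A])
  have mV: "measure \<mu> (?V n) = measure \<mu> A" for n
    by (rule measure_vimage_funpow[OF T A])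
  show "AE x in \<mu>. \<forall>n. (T ^^ n) x \<notin> A" if "measure \<mu> A = 0"
  proof -
    have "AE x in \<mu>. (T ^^ n) x \<notin> A" for n
    proof (rule AE_I)
      show "{x \<in> space \<mu>. \<not> (T ^^ n) x \<notin> A} \<subseteq> ?V n" by blast
      show "emeasure \<mu> (?V n) = 0" using mV[of n] that by (simp add: emeasure_eq_measure)
    qed (rule V)
    then show ?thesis by (simp add: AE_all_countable)
  qed
  show "AE x in \<mu>. infinite {n. (T ^^ n) x \<in> A}" if pos: "measure \<mu> A > 0"
  proof -
    define U where "U m = (\<Union>n\<in>{m..}. ?V n)" for m
    have U: "U m \<in> sets \<mu>" for m unfolding U_def using V by (intro sets.countable_UN') auto
    define L where "L = (\<Inter>m. U m)"
    have L: "L \<in> sets \<mu>" unfolding L_def using U by (intro sets.countable_INT) auto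
    have L_iff: "x \<in> L \<longleftrightarrow> x \<in> space \<mu> \<and> (\<forall>m. \<exists>n\<ge>m. (T ^^ n) x \<in> A)" for x
      unfolding L_def U_def by auto
    have "(\<lambda>m. measure \<mu> (U m)) \<longlonglongrightarrow> measure \<mu> (\<Inter>m. U m)"
    proof (rule finite_Lim_measure_decseq)
      show "range U \<subseteq> sets \<mu>" using U by blast
      show "decseq U" unfolding U_def decseq_def by (intro allI impI UN_mono) auto
    qed
    moreover have "measure \<mu> A \<le> measure \<mu> (U m)" for m
    proof -
      have "measure \<mu> (?V m) \<le> measure \<mu> (U m)"
        by (rule finite_measure_mono[OF _ U]) (auto simp: U_def)
      then show ?thesis using mV[of m] by linarith
    qed
    ultimately have "measure \<mu> A \<le> measure \<mu> L"
      unfolding L_def by (intro LIMSEQ_le_const) auto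
    moreover have "T -` L \<inter> space \<mu> = L"
    proof (intro set_eqI iffI)
      fix x assume "x \<in> T -` L \<inter> space \<mu>"
      then have x: "x \<in> space \<mu>" and "\<forall>m. \<exists>n\<ge>m. (T ^^ n) (T x) \<in> A" using L_iff by auto
      then have "\<exists>n\<ge>m. (T ^^ n) x \<in> A" for m
        by (metis funpow_swap1 funpow_simps_right(2) comp_apply le_SucI)
      with x show "x \<in> L" using L_iff by blast
    next
      fix x assume "x \<in> L"
      then have x: "x \<in> space \<mu>" and i: "\<forall>m. \<exists>n\<ge>m. (T ^^ n) x \<in> A" using L_iff by auto
      have "\<exists>n\<ge>m. (T ^^ n) (T x) \<in> A" for m
      proof -
        obtain n where n: "n \<ge> Suc m" "(T ^^ n) x \<in> A" using i by blast
        then obtain k where "n = Suc k" "k \<ge> m" by (metis Suc_le_D Suc_le_mono)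
        then show ?thesis using n(2) by (metis funpow_simps_right(2) comp_apply)
      qed
      moreover have "T x \<in> space \<mu>" using x T(1) by (rule measurable_space[rotated])
      ultimately have "T x \<in> L" using L_iff by blast
      then show "x \<in> T -` L \<inter> space \<mu>" using x by blast
    qed
    ultimately have "measure \<mu> L = 1" using inv[OF L] pos by linarith
    then have "AE x in \<mu>. x \<in> L" using L by (simp add: prob_eq_1)
    then show ?thesis
      by (rule AE_mp) (simp add: L_iff infinite_Collect_nat_iff)
  qed
qed

text \<open>\<open>meas\<close> speaks of the first letter, because equivariance moves every other
  letter to position 0.\<close>

locale ergodic_coding =
  fixes F :: "'a markov_tuple" and X :: "'x topology" and T :: "'x \<Rightarrow> 'x" and \<mu> :: "'x measure"
    and \<phi> :: "'x \<Rightarrow> nat \<Rightarrow> 'a"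
  assumes erg: "ergodic_prob X T \<mu>" and fin: "finite (syms F)"
    and sft: "\<And>x. x \<in> topspace X \<Longrightarrow> \<phi> x \<in> sft F"
    and equiv: "\<And>x. x \<in> topspace X \<Longrightarrow> \<phi> (T x) = lshift (\<phi> x)"
    and meas: "\<And>a. {x \<in> topspace X. \<phi> x 0 = a} \<in> sets \<mu>"
begin

lemma space: "space \<mu> = topspace X" and T: "T \<in> measurable \<mu> \<mu>" "distr \<mu> \<mu> T = \<mu>"
  and prob: "prob_space \<mu>"
  using erg by (auto simp: ergodic_prob_def invariant_prob_def)

lemma T_funpow_space: "x \<in> topspace X \<Longrightarrow> (T ^^ n) x \<in> topspace X"
  using measurable_space[OF distr_funpow(1)[OF T]] unfolding space .

lemma equiv_funpow: "x \<in> topspace X \<Longrightarrow> \<phi> ((T ^^ n) x) = (lshift ^^ n) (\<phi> x)"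
  by (induction n) (simp_all add: equiv T_funpow_space)

lemma letter_at: "x \<in> topspace X \<Longrightarrow> \<phi> x n = \<phi> ((T ^^ n) x) 0"
  by (simp add: equiv_funpow lshift_funpow)

lemma meas_n: "{x \<in> topspace X. \<phi> x n = a} \<in> sets \<mu>"
proof -
  have "{x \<in> topspace X. \<phi> x n = a} = (T ^^ n) -` {x \<in> topspace X. \<phi> x 0 = a} \<inter> space \<mu>"
    by (auto simp: space T_funpow_space letter_at[symmetric])
  then show ?thesis using measurable_sets[OF distr_funpow(1)[OF T] meas[of a]] by simp
qed

lemma word_dichotomy:
  "(AE x in \<mu>. \<forall>n. (lshift ^^ n) (\<phi> x) \<notin> cylinder F w) \<or>
   (AE x in \<mu>. infinite {n. (lshift ^^ n) (\<phi> x) \<in> cylinder F w})"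
proof -
  interpret prob_space \<mu> by (rule prob)
  define A where "A = {x \<in> topspace X. \<phi> x \<in> cylinder F w}"
  have "A = (\<Inter>i\<in>{..<length w}. {x \<in> topspace X. \<phi> x i = w ! i}) \<inter> space \<mu>"
    by (auto simp: A_def cylinder_def sft space)
  also have "\<dots> \<in> sets \<mu>"
  proof (cases "w = []")
    case False
    then have "(\<Inter>i\<in>{..<length w}. {x \<in> topspace X. \<phi> x i = w ! i}) \<in> sets \<mu>"
      by (intro sets.finite_INT meas_n) auto
    then show ?thesis by blast
  qed simp
  finally have A: "A \<in> sets \<mu>" .
  have iff: "(T ^^ n) x \<in> A \<longleftrightarrow> (lshift ^^ n) (\<phi> x) \<in> cylinder F w" if "x \<in> space \<mu>" for x n
    using that by (simp add: A_def space T_funpow_space equiv_funpow)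
  show ?thesis
  proof (cases "measure \<mu> A = 0")
    case True
    have "AE x in \<mu>. \<forall>n. (lshift ^^ n) (\<phi> x) \<notin> cylinder F w"
      using ergodic_recurrence(1)[OF erg A True]
      by (rule AE_mp) (rule AE_I2, simp add: iff)
    then show ?thesis ..
  next
    case False
    then have "measure \<mu> A > 0" by (simp add: zero_less_measure_iff)
    have "AE x in \<mu>. infinite {n. (lshift ^^ n) (\<phi> x) \<in> cylinder F w}"
      using ergodic_recurrence(2)[OF erg A \<open>measure \<mu> A > 0\<close>]
      by (rule AE_mp) (rule AE_I2, simp add: iff)
    then show ?thesis ..
  qed
qed

text \<open>Letters of positive measure almost surely recur infinitely often, the others almost
  surely never occur. A single typical orbit then leads from each letter of \<open>Pos\<close> to
  each other one, which places \<open>Pos\<close> in one component.\<close>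

lemma component:
  obtains C where "irreducible_component F C" "AE x in \<mu>. \<phi> x \<in> sft_restr F C"
proof -
  interpret prob_space \<mu> by (rule prob)
  let ?E = "edges F (syms F)"
  let ?A = "\<lambda>a. {x \<in> topspace X. \<phi> x 0 = a}"
  define Pos where "Pos = {a \<in> syms F. measure \<mu> (?A a) > 0}"
  have "AE x in \<mu>. a \<in> Pos \<longrightarrow> infinite {n. \<phi> x n = a}" for a
  proof (cases "a \<in> Pos")
    case True
    then have "measure \<mu> (?A a) > 0" by (simp add: Pos_def)
    from ergodic_recurrence(2)[OF erg meas this] show ?thesis
      by (rule AE_mp) (rule AE_I2, simp add: space T_funpow_space letter_at[symmetric])
  qed simp
  moreover have "AE x in \<mu>. a \<notin> Pos \<longrightarrow> (\<forall>n. \<phi> x n \<noteq> a)" if "a \<in> syms F" for a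
  proof (cases "a \<in> Pos")
    case False
    then have "measure \<mu> (?A a) = 0" using that by (simp add: Pos_def zero_less_measure_iff)
    from ergodic_recurrence(1)[OF erg meas this] show ?thesis
      by (rule AE_mp) (rule AE_I2, simp add: space T_funpow_space letter_at[symmetric])
  qed simp
  ultimately have "AE x in \<mu>. (\<forall>a\<in>syms F. a \<in> Pos \<longrightarrow> infinite {n. \<phi> x n = a}) \<and>
      (\<forall>a\<in>syms F. a \<notin> Pos \<longrightarrow> (\<forall>n. \<phi> x n \<noteq> a))"
    using fin by (intro AE_conjI AE_finite_allI) auto
  then have ae: "AE x in \<mu>. (\<forall>a\<in>Pos. infinite {n. \<phi> x n = a}) \<and> (\<forall>n. \<phi> x n \<in> Pos)"
  proof (rule AE_mp)
    show "AE x in \<mu>. (\<forall>a\<in>syms F. a \<in> Pos \<longrightarrow> infinite {n. \<phi> x n = a}) \<and>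
      (\<forall>a\<in>syms F. a \<notin> Pos \<longrightarrow> (\<forall>n. \<phi> x n \<noteq> a)) \<longrightarrow>
      (\<forall>a\<in>Pos. infinite {n. \<phi> x n = a}) \<and> (\<forall>n. \<phi> x n \<in> Pos)"
    proof (rule AE_I2, intro impI conjI)
      fix x assume x: "x \<in> space \<mu>" and
        h: "(\<forall>a\<in>syms F. a \<in> Pos \<longrightarrow> infinite {n. \<phi> x n = a}) \<and>
          (\<forall>a\<in>syms F. a \<notin> Pos \<longrightarrow> (\<forall>n. \<phi> x n \<noteq> a))"
      show "\<forall>a\<in>Pos. infinite {n. \<phi> x n = a}" using h by (simp add: Pos_def)
      have "\<phi> x n \<in> syms F" for n using sft[of x] x by (simp add: space sft_def)
      then show "\<forall>n. \<phi> x n \<in> Pos" using h by blast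
    qed
  qed
  have "\<exists>x\<in>space \<mu>. (\<forall>a\<in>Pos. infinite {n. \<phi> x n = a}) \<and> (\<forall>n. \<phi> x n \<in> Pos)"
  proof (rule ccontr)
    assume "\<not> ?thesis"
    then have "AE x in \<mu>. \<not> ((\<forall>a\<in>Pos. infinite {n. \<phi> x n = a}) \<and> (\<forall>n. \<phi> x n \<in> Pos))"
      by (intro AE_I2) blast
    with ae have "AE x in \<mu>. False" by eventually_elim blast
    then show False by simp
  qed
  then obtain x where x: "x \<in> space \<mu>" "\<And>a. a \<in> Pos \<Longrightarrow> infinite {n. \<phi> x n = a}" "\<And>n. \<phi> x n \<in> Pos"
    by blast
  have w: "\<phi> x \<in> walks ?E" using sft[of x] x(1) by (simp add: space sft_eq_walks)
  have reach: "(a, b) \<in> ?E\<^sup>*" if ab: "a \<in> Pos" "b \<in> Pos" for a b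
  proof -
    obtain n where n: "\<phi> x n = a" using x(2)[OF ab(1)] by (auto simp: infinite_Collect_nat_iff)
    obtain m where m: "m \<ge> n" "\<phi> x m = b" using x(2)[OF ab(2)] by (auto simp: infinite_Collect_nat_iff)
    show ?thesis using walks_rtrancl[OF w m(1)] n m by simp
  qed
  define a where "a = \<phi> x 0"
  have a: "a \<in> Pos" "a \<in> syms F" using x(3) by (auto simp: a_def Pos_def)
  define C where "C = {b. (a, b) \<in> ?E\<^sup>* \<and> (b, a) \<in> ?E\<^sup>*}"
  have "C \<subseteq> syms F"
  proof
    fix b assume "b \<in> C"
    then have "(a, b) \<in> ?E\<^sup>*" by (simp add: C_def)
    then show "b \<in> syms F" using a(2) by (cases rule: rtranclE) (auto simp: edges_def)
  qed
  moreover have "a \<in> C" by (simp add: C_def)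
  ultimately have C: "irreducible_component F C"
    unfolding irreducible_component_iff by (auto simp: C_def intro: rtrancl_trans)
  have "Pos \<subseteq> C" using reach a(1) by (auto simp: C_def)
  have "AE x in \<mu>. \<phi> x \<in> sft_restr F C"
    using ae by (rule AE_mp)
      (rule AE_I2, use sft \<open>Pos \<subseteq> C\<close> in \<open>auto simp: sft_restr_def space\<close>)
  with C show ?thesis by (rule that)
qed

end

section \<open>Topological entropy and symbolic systems\<close>

text \<open>\<open>dyn_join\<close> ranges over sequences with arbitrary values from
  \<open>n\<close> on; cutting these off shows that the join of a finite cover is finite.\<close>

lemma dyn_join_eq_image:
  "dyn_join S T n \<U> = (\<lambda>V. S \<inter> (\<Inter>i<n. (T ^^ i) -` V i)) ` PiE {..<n} (\<lambda>_. \<U>)"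
proof (intro equalityI subsetI)
  fix B assume "B \<in> dyn_join S T n \<U>"
  then obtain V where V: "B = S \<inter> (\<Inter>i<n. (T ^^ i) -` V i)" "\<forall>i<n. V i \<in> \<U>"
    by (auto simp: dyn_join_def)
  show "B \<in> (\<lambda>V. S \<inter> (\<Inter>i<n. (T ^^ i) -` V i)) ` PiE {..<n} (\<lambda>_. \<U>)"
  proof (rule image_eqI)
    show "B = S \<inter> (\<Inter>i<n. (T ^^ i) -` restrict V {..<n} i)" unfolding V(1) by simp
    show "restrict V {..<n} \<in> PiE {..<n} (\<lambda>_. \<U>)" using V(2) by simp
  qed
qed (auto simp: dyn_join_def PiE_iff)

lemma Union_dyn_join:
  assumes "\<Union>\<U> = S" "\<And>x. x \<in> S \<Longrightarrow> T x \<in> S"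
  shows "\<Union>(dyn_join S T n \<U>) = S"
proof
  show "S \<subseteq> \<Union>(dyn_join S T n \<U>)"
  proof
    fix x assume x: "x \<in> S"
    have "(T ^^ i) x \<in> \<Union>\<U>" for i using x assms by (induction i) auto
    then have "\<forall>i. \<exists>U. U \<in> \<U> \<and> (T ^^ i) x \<in> U" by blast
    then obtain V where V: "\<And>i. V i \<in> \<U> \<and> (T ^^ i) x \<in> V i" by metis
    show "x \<in> \<Union>(dyn_join S T n \<U>)"
    proof (rule UnionI)
      show "S \<inter> (\<Inter>i<n. (T ^^ i) -` V i) \<in> dyn_join S T n \<U>"
        unfolding dyn_join_def using V by blast
      show "x \<in> S \<inter> (\<Inter>i<n. (T ^^ i) -` V i)" using x V by simp
    qed
  qed
qed (auto simp: dyn_join_def)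

lemma ennreal_ln_div_mono: "c \<le> d \<Longrightarrow> ennreal (ln (real c) / real n) \<le> ennreal (ln (real d) / real n)"
  by (cases "c = 0") (auto intro!: ennreal_leI divide_right_mono)

text \<open>The open cover by the complements of all but one of the \<open>Z b\<close> separates points whose
  orbits visit the \<open>Z b\<close> in different orders.\<close>

lemma limsup_words_le_h_top:
  fixes X :: "'x topology" and Z :: "'b \<Rightarrow> 'x set"
  assumes B: "finite B" "B \<noteq> {}" and Z: "\<And>b. b \<in> B \<Longrightarrow> closedin X (Z b)"
    and disj: "\<And>b c. b \<in> B \<Longrightarrow> c \<in> B \<Longrightarrow> b \<noteq> c \<Longrightarrow> Z b \<inter> Z c = {}"
    and T: "\<And>x. x \<in> topspace X \<Longrightarrow> T x \<in> topspace X"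
    and Y: "\<And>y n. y \<in> Y \<Longrightarrow> y n \<in> B"
    and orbit: "\<And>y. y \<in> Y \<Longrightarrow> \<exists>x\<in>topspace X. \<forall>n. (T ^^ n) x \<in> Z (y n)"
  shows "limsup (\<lambda>n. ennreal (ln (real (card (words n Y))) / real n)) \<le> h_top X T"
proof -
  define U where "U b = topspace X - (\<Union>c\<in>B - {b}. Z c)" for b
  have U: "openin X (U b)" for b
    unfolding U_def using B Z by (intro openin_diff openin_topspace closedin_Union) auto
  have "\<Union>(U ` B) = topspace X"
  proof
    show "topspace X \<subseteq> \<Union>(U ` B)"
    proof
      fix x assume x: "x \<in> topspace X"
      show "x \<in> \<Union>(U ` B)"
      proof (cases "\<exists>b\<in>B. x \<in> Z b")
        case True
        then obtain b where b: "b \<in> B" "x \<in> Z b" by blast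
        then have "x \<in> U b" unfolding U_def using x disj by blast
        then show ?thesis using b(1) by blast
      next
        case False
        then have "x \<in> U b" for b unfolding U_def using x by blast
        then show ?thesis using B(2) by blast
      qed
    qed
  qed (auto simp: U_def)
  then have cover: "open_cover X (U ` B)" using U by (auto simp: open_cover_def)
  have fin: "finite (dyn_join (topspace X) T n (U ` B))" for n
    unfolding dyn_join_eq_image using B(1) by (intro finite_imageI finite_PiE) auto
  have Un: "\<Union>(dyn_join (topspace X) T n (U ` B)) = topspace X" for n
    using cover T by (intro Union_dyn_join) (auto simp: open_cover_def)
  have "card (words n Y) \<le> min_subcover_card X (dyn_join (topspace X) T n (U ` B))" for n
  proof -
    have "\<exists>k. \<exists>\<V>\<subseteq>dyn_join (topspace X) T n (U ` B). finite \<V> \<and> \<Union>\<V> = topspace X \<and> card \<V> = k"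
      using fin Un by blast
    from LeastI_ex[OF this] obtain \<V> where \<V>: "\<V> \<subseteq> dyn_join (topspace X) T n (U ` B)" "finite \<V>"
      "\<Union>\<V> = topspace X" "card \<V> = min_subcover_card X (dyn_join (topspace X) T n (U ` B))"
      unfolding min_subcover_card_def by blast
    \<comment> \<open>Each word selects an element of a minimal subcover containing a point with
      this itinerary. That the word can be recovered from the element makes the selection
      injective.\<close>
    have "\<exists>V. V \<in> \<V> \<and> (\<exists>x\<in>V. \<forall>i<n. (T ^^ i) x \<in> Z (w ! i))" if w: "w \<in> words n Y" for w
    proof -
      obtain y where y: "y \<in> Y" "w = map y [0..<n]" using w by (auto simp: words_def)
      obtain x where x: "x \<in> topspace X" "\<And>n. (T ^^ n) x \<in> Z (y n)" using orbit[OF y(1)] by blast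
      then obtain V where "V \<in> \<V>" "x \<in> V" using \<V>(3) by blast
      moreover have "\<forall>i<n. (T ^^ i) x \<in> Z (w ! i)" using x(2) y(2) by simp
      ultimately show ?thesis by blast
    qed
    then obtain f where f: "\<And>w. w \<in> words n Y \<Longrightarrow> f w \<in> \<V> \<and> (\<exists>x\<in>f w. \<forall>i<n. (T ^^ i) x \<in> Z (w ! i))"
      by metis
    have "inj_on f (words n Y)"
    proof (rule inj_onI)
      fix v w assume vw: "v \<in> words n Y" "w \<in> words n Y" "f v = f w"
      have "f v \<in> dyn_join (topspace X) T n (U ` B)" using f[OF vw(1)] \<V>(1) by blast
      then obtain W where W: "f v = topspace X \<inter> (\<Inter>i<n. (T ^^ i) -` W i)" "\<forall>i<n. W i \<in> U ` B"
        unfolding dyn_join_def by blast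
      have len: "length u = n" and uB: "i < n \<Longrightarrow> u ! i \<in> B" if "u \<in> words n Y" for u i
        using that Y by (auto simp: words_def)
      \<comment> \<open>Among the sets \<open>U b\<close> only \<open>U (u ! i)\<close> meets
        \<open>Z (u ! i)\<close>, so the word forces the factors \<open>W i\<close> of the selected
        element.\<close>
      have step: "W i = U (u ! i)" if u: "u \<in> words n Y" "f u = f v" and i: "i < n" for u i
      proof -
        obtain x where x: "x \<in> f v" "(T ^^ i) x \<in> Z (u ! i)" using f[OF u(1)] u(2) i by auto
        obtain b where b: "b \<in> B" "W i = U b" using W(2) i by blast
        have "(T ^^ i) x \<in> U b" using x(1) W(1) b(2) i by auto
        then have "u ! i = b" using x(2) uB[OF u(1) i] unfolding U_def by blast
        then show ?thesis using b(2) by simp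
      qed
      show "v = w"
      proof (rule nth_equalityI)
        show "length v = length w" using len vw by simp
        fix i assume "i < length v"
        then have i: "i < n" using len vw by simp
        obtain x where x: "x \<in> f v" "(T ^^ i) x \<in> Z (v ! i)" using f[OF vw(1)] i by auto
        have "(T ^^ i) x \<in> U (w ! i)" using x(1) W(1) step[OF vw(2) vw(3)[symmetric] i] i by auto
        then show "v ! i = w ! i" using x(2) uB[OF vw(1) i] unfolding U_def by blast
      qed
    qed
    then have "card (words n Y) \<le> card \<V>"
      using f by (intro card_inj_on_le[OF _ _ \<V>(2)]) auto
    then show ?thesis using \<V>(4) by simp
  qed
  then have "limsup (\<lambda>n. ennreal (ln (real (card (words n Y))) / real n)) \<le> cover_entropy X T (U ` B)"
    unfolding cover_entropy_def by (intro Limsup_mono always_eventually allI ennreal_ln_div_mono)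
  also have "\<dots> \<le> h_top X T" unfolding h_top_def using cover by (intro SUP_upper) simp
  finally show ?thesis .
qed

lemma sets_borel_of_top: "sets (borel_of_top X) = sigma_sets (topspace X) {U. openin X U}"
  and space_borel_of_top: "space (borel_of_top X) = topspace X"
  using openin_subset by (auto simp: borel_of_top_def intro!: sets_measure_of space_measure_of)

section \<open>Spaces of symbol sequences: topology, Borel sets and both entropies\<close>

locale symbolic =
  fixes F :: "'a markov_tuple" and S :: "(nat \<Rightarrow> 'a) set"
  assumes fin: "finite (syms F)" and S: "\<And>x n. x \<in> S \<Longrightarrow> x n \<in> syms F"
begin

lemma topspace: "topspace (symbolic_space F S) = S"
  using S by (auto simp: symbolic_space_def)

lemma openin_iff:
  "openin (symbolic_space F S) U \<longleftrightarrow> U \<subseteq> S \<and> (\<forall>x\<in>U. \<exists>k. \<forall>y\<in>S. (\<forall>i<k. y i = x i) \<longrightarrow> y \<in> U)"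
proof
  assume "openin (symbolic_space F S) U"
  then obtain W where W: "openin (product_topology (\<lambda>_. discrete_topology (syms F)) UNIV) W" "U = W \<inter> S"
    unfolding symbolic_space_def openin_subtopology by blast
  show "U \<subseteq> S \<and> (\<forall>x\<in>U. \<exists>k. \<forall>y\<in>S. (\<forall>i<k. y i = x i) \<longrightarrow> y \<in> U)"
  proof (intro conjI ballI)
    show "U \<subseteq> S" using W by blast
    fix x assume x: "x \<in> U"
    then obtain V where V: "finite {i. V i \<noteq> syms F}" "x \<in> Pi\<^sub>E UNIV V" "Pi\<^sub>E UNIV V \<subseteq> W"
      using W unfolding openin_product_topology_alt by fastforce
    obtain k where k: "\<And>i. V i \<noteq> syms F \<Longrightarrow> i < k"
      using V(1) unfolding finite_nat_set_iff_bounded by blast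
    have "y \<in> U" if y: "y \<in> S" "\<forall>i<k. y i = x i" for y
    proof -
      have "y i \<in> V i" for i
      proof (cases "i < k")
        case True then show ?thesis using y(2) V(2) by auto
      next
        case False then show ?thesis using k[of i] S[OF y(1), of i] by auto
      qed
      then have "y \<in> W" using V(3) by (auto simp: PiE_iff)
      then show ?thesis using W(2) y(1) by blast
    qed
    then show "\<exists>k. \<forall>y\<in>S. (\<forall>i<k. y i = x i) \<longrightarrow> y \<in> U" by blast
  qed
next
  assume U: "U \<subseteq> S \<and> (\<forall>x\<in>U. \<exists>k. \<forall>y\<in>S. (\<forall>i<k. y i = x i) \<longrightarrow> y \<in> U)"
  define cyl where "cyl x k = Pi\<^sub>E UNIV (\<lambda>i. if i < k then {x i} else syms F)" for x and k :: nat
  have cyl: "openin (product_topology (\<lambda>_. discrete_topology (syms F)) UNIV) (cyl x k)" if "x \<in> S" for x k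
    unfolding cyl_def openin_PiE_gen using S[OF that]
    by (intro disjI2 conjI ballI) (auto intro: finite_subset[of _ "{..<k}"])
  have mem: "y \<in> cyl x k \<longleftrightarrow> (\<forall>i<k. y i = x i)" if "y \<in> S" for x y k
    using S[OF that] by (auto simp: cyl_def PiE_iff)
  define W where "W = (\<Union>(x, k)\<in>{(x, k). x \<in> U \<and> (\<forall>y\<in>S. (\<forall>i<k. y i = x i) \<longrightarrow> y \<in> U)}. cyl x k)"
  have "openin (product_topology (\<lambda>_. discrete_topology (syms F)) UNIV) W"
    unfolding W_def using cyl U by (intro openin_Union) auto
  moreover have "U = W \<inter> S"
  proof (intro equalityI subsetI)
    fix x assume x: "x \<in> U"
    then obtain k where "\<forall>y\<in>S. (\<forall>i<k. y i = x i) \<longrightarrow> y \<in> U" using U by blast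
    moreover have "x \<in> cyl x k" using x U mem[of x x k] by blast
    ultimately show "x \<in> W \<inter> S" unfolding W_def using x U by blast
  next
    fix y assume "y \<in> W \<inter> S"
    then show "y \<in> U" unfolding W_def using mem[of y] by blast
  qed
  ultimately show "openin (symbolic_space F S) U"
    unfolding symbolic_space_def openin_subtopology by blast
qed

definition determined :: "nat \<Rightarrow> (nat \<Rightarrow> 'a) set \<Rightarrow> bool" where
  "determined k B \<longleftrightarrow> (\<forall>x\<in>S. \<forall>y\<in>S. (\<forall>i<k. x i = y i) \<longrightarrow> (x \<in> B \<longleftrightarrow> y \<in> B))"

text \<open>As the alphabet is finite, these are the finite unions of cylinders in \<open>S\<close>:
  an algebra generating the Borel sets, to which \<open>h_measure_le\<close> applies.\<close>

definition clopens :: "(nat \<Rightarrow> 'a) set set" where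
  "clopens = {B. B \<subseteq> S \<and> (\<exists>k. determined k B)}"

lemma determined_mono: "determined k B \<Longrightarrow> k \<le> l \<Longrightarrow> determined l B"
  unfolding determined_def by (meson order_less_le_trans)

lemma openin_clopens: "B \<in> clopens \<Longrightarrow> openin (symbolic_space F S) B"
proof -
  assume "B \<in> clopens"
  then obtain k where B: "B \<subseteq> S" "determined k B" by (auto simp: clopens_def)
  have "y \<in> B" if "x \<in> B" "y \<in> S" "\<forall>i<k. y i = x i" for x y
    using B that unfolding determined_def by (metis subsetD)
  then show ?thesis unfolding openin_iff using B(1) by blast
qed

lemma algebra_clopens: "algebra S clopens"
  unfolding algebra_iff_Un
proof (intro conjI ballI)
  show "clopens \<subseteq> Pow S" "{} \<in> clopens" by (auto simp: clopens_def determined_def)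
  fix A assume A: "A \<in> clopens"
  then show "S - A \<in> clopens" unfolding clopens_def determined_def by blast
  fix B assume B: "B \<in> clopens"
  obtain k l where "determined k A" "determined l B" using A B by (auto simp: clopens_def)
  then have "determined (max k l) A" "determined (max k l) B" by (auto intro: determined_mono)
  then have "determined (max k l) (A \<union> B)" unfolding determined_def by blast
  then show "A \<union> B \<in> clopens" using A B by (auto simp: clopens_def)
qed

lemma closedin_clopens: "B \<in> clopens \<Longrightarrow> closedin (symbolic_space F S) B"
proof -
  assume B: "B \<in> clopens"
  interpret algebra S clopens by (rule algebra_clopens)
  have "S - B \<in> clopens" using B by blast
  then show ?thesis unfolding closedin_def topspace using openin_clopens B by (auto simp: clopens_def)
qed

lemma finite_words: "finite (words n S)"
  by (rule finite_subset[OF _ finite_lists_length_eq[OF fin, of n]]) (auto simp: words_def S)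

text \<open>An open set is the union over \<open>k\<close> of the sets \<open>V k\<close> of points
  whose whole \<open>k\<close>-cylinder lies in it, a countable union of members of the
  algebra.\<close>

lemma sets_symbolic: "sets (borel_of_top (symbolic_space F S)) = sigma_sets S clopens"
  unfolding sets_borel_of_top topspace
proof (rule sigma_sets_eqI)
  fix B assume "B \<in> clopens"
  then show "B \<in> sigma_sets S {U. openin (symbolic_space F S) U}"
    using openin_clopens by blast
next
  fix U assume "U \<in> {U. openin (symbolic_space F S) U}"
  then have U: "U \<subseteq> S" "\<And>x. x \<in> U \<Longrightarrow> \<exists>k. \<forall>y\<in>S. (\<forall>i<k. y i = x i) \<longrightarrow> y \<in> U"
    using openin_iff by auto
  define V where "V k = {x \<in> S. \<forall>y\<in>S. (\<forall>i<k. y i = x i) \<longrightarrow> y \<in> U}" for k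
  have "U = (\<Union>k. V k)"
  proof (intro equalityI subsetI)
    fix x assume "x \<in> U"
    with U obtain k where "\<forall>y\<in>S. (\<forall>i<k. y i = x i) \<longrightarrow> y \<in> U" "x \<in> S" by blast
    then have "x \<in> V k" by (simp add: V_def)
    then show "x \<in> (\<Union>k. V k)" by blast
  next
    fix x assume "x \<in> (\<Union>k. V k)"
    then show "x \<in> U" unfolding V_def by auto
  qed
  moreover have "V k \<in> clopens" for k
  proof -
    have "y \<in> V k" if "x \<in> V k" "y \<in> S" "\<forall>i<k. x i = y i" for x y
      using that by (simp add: V_def)
    then have "determined k (V k)" unfolding determined_def by metis
    then show ?thesis unfolding clopens_def V_def by blast
  qed
  ultimately show "U \<in> sigma_sets S clopens" by (auto intro!: sigma_sets.Union)
qed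

lemma letter_clopen: "{x \<in> S. x i = a} \<in> clopens"
proof -
  have "determined (Suc i) {x \<in> S. x i = a}" by (simp add: determined_def)
  then show ?thesis by (auto simp: clopens_def)
qed

lemma letter_sets: "{x \<in> S. x i = a} \<in> sets (borel_of_top (symbolic_space F S))"
  unfolding sets_symbolic using letter_clopen by blast

text \<open>The assumption says that a sequence outside \<open>S\<close> is recognized by a finite
  prefix, so \<open>S\<close> is closed in the compact full shift.\<close>

lemma compactI:
  assumes "\<And>x. (\<And>n. x n \<in> syms F) \<Longrightarrow> x \<notin> S \<Longrightarrow> \<exists>k. \<forall>y. (\<forall>i<k. y i = x i) \<longrightarrow> y \<notin> S"
  shows "compact_space (symbolic_space F S)"
proof -
  interpret full: symbolic F "{x. \<forall>n. x n \<in> syms F}" by unfold_locales (use fin in auto)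
  have eq: "symbolic_space F {x. \<forall>n. x n \<in> syms F} = product_topology (\<lambda>_. discrete_topology (syms F)) UNIV"
    unfolding symbolic_space_def by (rule subtopology_superset) (auto simp: PiE_iff)
  have "openin (symbolic_space F {x. \<forall>n. x n \<in> syms F}) ({x. \<forall>n. x n \<in> syms F} - S)"
    unfolding full.openin_iff
  proof (intro conjI ballI)
    fix x assume "x \<in> {x. \<forall>n. x n \<in> syms F} - S"
    then obtain k where "\<forall>y. (\<forall>i<k. y i = x i) \<longrightarrow> y \<notin> S" using assms[of x] by auto
    then show "\<exists>k. \<forall>y\<in>{x. \<forall>n. x n \<in> syms F}. (\<forall>i<k. y i = x i) \<longrightarrow> y \<in> {x. \<forall>n. x n \<in> syms F} - S"
      by (intro exI[of _ k]) simp
  qed simp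
  then have "closedin (symbolic_space F {x. \<forall>n. x n \<in> syms F}) S"
    unfolding closedin_def full.topspace using S by blast
  moreover have "compact_space (symbolic_space F {x. \<forall>n. x n \<in> syms F})"
    unfolding eq using fin by (simp add: compact_space_product_topology compact_space_discrete_topology)
  ultimately have "compactin (symbolic_space F {x. \<forall>n. x n \<in> syms F}) S"
    by (intro closedin_compact_space)
  then have "compactin (product_topology (\<lambda>_. discrete_topology (syms F)) UNIV) S"
    unfolding eq .
  then show ?thesis unfolding symbolic_space_def by (rule compact_space_subtopology)
qed

lemma metrizable: "metrizable_space (symbolic_space F S)"
  unfolding symbolic_space_def
  by (intro metrizable_space_subtopology) (simp add: metrizable_space_product_topology)

lemma continuous_lshift:
  assumes "\<And>x. x \<in> S \<Longrightarrow> lshift x \<in> S"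
  shows "continuous_map (symbolic_space F S) (symbolic_space F S) lshift"
  unfolding continuous_map_def topspace
proof (intro conjI allI impI)
  show "lshift \<in> S \<rightarrow> S" using assms by blast
  fix U assume "openin (symbolic_space F S) U"
  then have U: "\<And>x. x \<in> U \<Longrightarrow> \<exists>k. \<forall>y\<in>S. (\<forall>i<k. y i = x i) \<longrightarrow> y \<in> U" by (simp add: openin_iff)
  show "openin (symbolic_space F S) {x \<in> S. lshift x \<in> U}"
    unfolding openin_iff
  proof (intro conjI ballI)
    fix x assume "x \<in> {x \<in> S. lshift x \<in> U}"
    then have "lshift x \<in> U" by simp
    from U[OF this] obtain k where k: "\<forall>y\<in>S. (\<forall>i<k. y i = lshift x i) \<longrightarrow> y \<in> U" by (rule exE)
    have "\<forall>y\<in>S. (\<forall>i<Suc k. y i = x i) \<longrightarrow> y \<in> {x \<in> S. lshift x \<in> U}"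
    proof (intro ballI impI CollectI conjI)
      fix y assume y: "y \<in> S" "\<forall>i<Suc k. y i = x i"
      have "\<forall>i<k. lshift y i = lshift x i" using y(2) by (simp add: lshift_def)
      then show "lshift y \<in> U" using k assms[OF y(1)] by simp
    qed
    then show "\<exists>k. \<forall>y\<in>S. (\<forall>i<k. y i = x i) \<longrightarrow> y \<in> {x \<in> S. lshift x \<in> U}" by (rule exI)
  qed blast
qed

text \<open>The symbolic form of the Lebesgue number: finitely many cylinders suffice, and a longer
  cylinder around a point is contained in a shorter one.\<close>

lemma cover_lebesgue_number:
  assumes comp: "compact_space (symbolic_space F S)" and cov: "open_cover (symbolic_space F S) \<U>"
  obtains k where "\<And>x. x \<in> S \<Longrightarrow> \<exists>U\<in>\<U>. \<forall>y\<in>S. (\<forall>i<k. y i = x i) \<longrightarrow> y \<in> U"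
proof -
  have cov': "\<And>U. U \<in> \<U> \<Longrightarrow> openin (symbolic_space F S) U" "\<Union>\<U> = S"
    using cov by (auto simp: open_cover_def topspace)
  define cyl where "cyl x k = {y \<in> S. \<forall>i<k. y i = x i}" for x and k :: nat
  have op: "openin (symbolic_space F S) (cyl x k)" for x k
  proof (rule openin_clopens)
    have "determined k (cyl x k)" by (simp add: determined_def cyl_def)
    then show "cyl x k \<in> clopens" by (auto simp: clopens_def cyl_def)
  qed
  have "\<exists>k. \<exists>U\<in>\<U>. cyl x k \<subseteq> U" if x: "x \<in> S" for x
  proof -
    have "x \<in> \<Union>\<U>" unfolding cov'(2) by (rule x)
    then obtain U where U: "U \<in> \<U>" "x \<in> U" by (rule UnionE)
    have "\<forall>x\<in>U. \<exists>k. \<forall>y\<in>S. (\<forall>i<k. y i = x i) \<longrightarrow> y \<in> U"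
      using cov'(1)[OF U(1)] unfolding openin_iff by (rule conjunct2)
    from bspec[OF this U(2)] obtain k where "\<forall>y\<in>S. (\<forall>i<k. y i = x i) \<longrightarrow> y \<in> U" by (rule exE)
    then have "cyl x k \<subseteq> U" by (auto simp: cyl_def)
    then show ?thesis using U(1) by blast
  qed
  then obtain K where K: "\<And>x. x \<in> S \<Longrightarrow> \<exists>U\<in>\<U>. cyl x (K x) \<subseteq> U" by metis
  have "S \<subseteq> (\<Union>x\<in>S. cyl x (K x))" by (auto simp: cyl_def)
  moreover have "compactin (symbolic_space F S) S" using comp by (simp add: compact_space_def topspace)
  ultimately obtain \<F> where \<F>: "finite \<F>" "\<F> \<subseteq> (\<lambda>x. cyl x (K x)) ` S" "S \<subseteq> \<Union>\<F>"
    using compactinD[of "symbolic_space F S" S "(\<lambda>x. cyl x (K x)) ` S"] op by blast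
  then obtain A where A: "finite A" "A \<subseteq> S" "\<F> = (\<lambda>x. cyl x (K x)) ` A"
    using finite_subset_image[OF \<F>(1,2)] by blast
  obtain k where k: "\<And>a. a \<in> A \<Longrightarrow> K a \<le> k"
    using finite_nat_set_iff_bounded_le[of "K ` A"] A(1) by auto
  have "\<exists>U\<in>\<U>. \<forall>y\<in>S. (\<forall>i<k. y i = x i) \<longrightarrow> y \<in> U" if x: "x \<in> S" for x
  proof -
    obtain a where a: "a \<in> A" "x \<in> cyl a (K a)" using x \<F>(3) A(3) by blast
    obtain U where U: "U \<in> \<U>" "cyl a (K a) \<subseteq> U" using K a(1) A(2) by blast
    have "y \<in> U" if "y \<in> S" "\<forall>i<k. y i = x i" for y
    proof -
      have "y i = a i" if "i < K a" for i
        using that k[OF a(1)] a(2) \<open>\<forall>i<k. y i = x i\<close> by (auto simp: cyl_def)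
      then show ?thesis using U(2) \<open>y \<in> S\<close> by (auto simp: cyl_def)
    qed
    then show ?thesis using U(1) by blast
  qed
  then show ?thesis by (rule that)
qed

text \<open>With \<open>k\<close> a Lebesgue number of the cover, all points sharing a prefix of
  length \<open>n + k\<close> lie in one element of the \<open>n\<close>-fold join, so the words of
  length \<open>n + k\<close> index a subcover. The shift by the constant \<open>k\<close> does not
  affect the rate.\<close>

lemma h_top_le:
  assumes comp: "compact_space (symbolic_space F S)" and inv: "\<And>x. x \<in> S \<Longrightarrow> lshift x \<in> S"
    and h: "h \<ge> 0" and growth: "exp_growth_le (\<lambda>n. card (words n S)) h"
  shows "h_top (symbolic_space F S) lshift \<le> ennreal h"
  unfolding h_top_def
proof (rule SUP_least, rule ennreal_le_epsilon)
  fix \<U> and e :: real assume "\<U> \<in> {\<U>. open_cover (symbolic_space F S) \<U>}" and e: "e > 0"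
  then have cov: "open_cover (symbolic_space F S) \<U>" by simp
  obtain k where k: "\<And>x. x \<in> S \<Longrightarrow> \<exists>U\<in>\<U>. \<forall>y\<in>S. (\<forall>i<k. y i = x i) \<longrightarrow> y \<in> U"
    by (rule cover_lebesgue_number[OF comp cov]) blast
  then have "\<forall>x\<in>S. \<exists>U. U \<in> \<U> \<and> (\<forall>y\<in>S. (\<forall>i<k. y i = x i) \<longrightarrow> y \<in> U)" by (simp add: Bex_def)
  from bchoice[OF this] obtain u
    where "\<forall>x\<in>S. u x \<in> \<U> \<and> (\<forall>y\<in>S. (\<forall>i<k. y i = x i) \<longrightarrow> y \<in> u x)" by (rule exE)
  then have u: "\<And>x. x \<in> S \<Longrightarrow> u x \<in> \<U>" "\<And>x y. x \<in> S \<Longrightarrow> y \<in> S \<Longrightarrow> \<forall>i<k. y i = x i \<Longrightarrow> y \<in> u x"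
    by simp_all
  have invn: "(lshift ^^ n) x \<in> S" if "x \<in> S" for n x using that inv by (induction n) auto
  have min: "min_subcover_card (symbolic_space F S) (dyn_join S lshift n \<U>) \<le> card (words (n + k) S)" for n
  proof -
    have "\<forall>w\<in>words (n + k) S. \<exists>x. x \<in> S \<and> w = map x [0..<n + k]" by (auto simp: words_def)
    from bchoice[OF this] obtain p where "\<forall>w\<in>words (n + k) S. p w \<in> S \<and> w = map (p w) [0..<n + k]" by (rule exE)
    then have p: "p w \<in> S \<and> w = map (p w) [0..<n + k]" if "w \<in> words (n + k) S" for w using that by blast
    define V where "V w = S \<inter> (\<Inter>i<n. (lshift ^^ i) -` u ((lshift ^^ i) (p w)))" for w
    let ?\<V> = "V ` words (n + k) S"
    have sub: "?\<V> \<subseteq> dyn_join S lshift n \<U>"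
    proof
      fix D assume "D \<in> ?\<V>"
      then obtain w where w: "w \<in> words (n + k) S" "D = V w" by blast
      then have "u ((lshift ^^ i) (p w)) \<in> \<U>" for i using u(1)[OF invn] p by simp
      then show "D \<in> dyn_join S lshift n \<U>" unfolding w(2) V_def dyn_join_def
        by (intro CollectI exI[of _ "\<lambda>i. u ((lshift ^^ i) (p w))"] conjI refl allI impI)
    qed
    have Un: "\<Union>?\<V> = S"
    proof
      show "S \<subseteq> \<Union>?\<V>"
      proof
        fix x assume x: "x \<in> S"
        define w where "w = map x [0..<n + k]"
        have w: "w \<in> words (n + k) S" using x by (auto simp: words_def w_def)
        have pw: "p w \<in> S" "map x [0..<n + k] = map (p w) [0..<n + k]" using p[OF w] by (simp_all add: w_def)
        then have eq: "x i = p w i" if "i < n + k" for i using that by simp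
        have "(lshift ^^ i) x \<in> u ((lshift ^^ i) (p w))" if i: "i < n" for i
        proof (rule u(2)[OF invn[OF pw(1)] invn[OF x]])
          show "\<forall>j<k. (lshift ^^ i) x j = (lshift ^^ i) (p w) j"
            using i eq by (simp add: lshift_funpow)
        qed
        then have "x \<in> V w" using x by (simp add: V_def)
        then show "x \<in> \<Union>?\<V>" using w by blast
      qed
    qed (auto simp: V_def)
    have "min_subcover_card (symbolic_space F S) (dyn_join S lshift n \<U>) \<le> card ?\<V>"
      unfolding min_subcover_card_def topspace
    proof (rule Least_le)
      show "\<exists>\<V>\<subseteq>dyn_join S lshift n \<U>. finite \<V> \<and> \<Union>\<V> = S \<and> card \<V> = card ?\<V>"
        by (intro exI[of _ ?\<V>] conjI sub finite_imageI finite_words Un refl)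
    qed
    also have "\<dots> \<le> card (words (n + k) S)" by (rule card_image_le[OF finite_words])
    finally show ?thesis .
  qed
  have "exp_growth_le (\<lambda>n. min_subcover_card (symbolic_space F S) (dyn_join S lshift n \<U>)) h"
  proof (rule exp_growth_leI_poly[OF growth, where K = 1 and \<delta> = 0 and k = k, simplified])
    show "\<forall>\<^sub>F n in sequentially. real (min_subcover_card (symbolic_space F S) (dyn_join S lshift n \<U>))
      \<le> (real n + 1) * real (card (words (n + k) S))"
    proof (intro always_eventually allI)
      fix n
      have "real (min_subcover_card (symbolic_space F S) (dyn_join S lshift n \<U>)) \<le> 1 * real (card (words (n + k) S))"
        using min by simp
      also have "\<dots> \<le> (real n + 1) * real (card (words (n + k) S))" by (intro mult_right_mono) auto
      finally show "real (min_subcover_card (symbolic_space F S) (dyn_join S lshift n \<U>))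
      \<le> (real n + 1) * real (card (words (n + k) S))" .
    qed
  qed
  then have "\<forall>\<^sub>F n in sequentially. real (min_subcover_card (symbolic_space F S) (dyn_join S lshift n \<U>)) \<le> exp (real n * (h + e))"
    using e by (simp add: exp_growth_le_def)
  then have "\<forall>\<^sub>F n in sequentially. ennreal (ln (real (min_subcover_card (symbolic_space F S) (dyn_join S lshift n \<U>))) / real n) \<le> ennreal (h + e)"
    using eventually_gt_at_top[of 0]
  proof eventually_elim
    case (elim n)
    let ?m = "min_subcover_card (symbolic_space F S) (dyn_join S lshift n \<U>)"
    have "ln (real ?m) \<le> real n * (h + e)"
    proof (cases "?m = 0")
      case False
      then have "ln (real ?m) \<le> ln (exp (real n * (h + e)))" using elim(1) by (subst ln_le_cancel_iff) auto
      then show ?thesis by simp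
    qed (use h e in simp)
    then show ?case using elim(2) by (intro ennreal_leI) (simp add: field_simps)
  qed
  then have "cover_entropy (symbolic_space F S) lshift \<U> \<le> ennreal (h + e)"
    unfolding cover_entropy_def topspace by (rule Limsup_bounded)
  then show "cover_entropy (symbolic_space F S) lshift \<U> \<le> ennreal h + ennreal e"
    using h e by (simp add: ennreal_plus)
qed

text \<open>The cylinders of the first letters are closed and disjoint, and every point of
  \<open>Y\<close> is its own itinerary.\<close>

lemma limsup_words_le_h_top_symbolic:
  assumes inv: "\<And>x. x \<in> S \<Longrightarrow> lshift x \<in> S" and Y: "Y \<subseteq> S"
  shows "limsup (\<lambda>n. ennreal (ln (real (card (words n Y))) / real n)) \<le> h_top (symbolic_space F S) lshift"
proof (cases "syms F = {}")
  case True
  then have "Y = {}" using S Y by blast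
  then show ?thesis by (simp add: words_def Limsup_const)
next
  case False
  show ?thesis
  proof (rule limsup_words_le_h_top[OF fin False, where Z = "\<lambda>b. {x \<in> S. x 0 = b}"])
    show "closedin (symbolic_space F S) {x \<in> S. x 0 = b}" for b
      by (rule closedin_clopens[OF letter_clopen])
    show "\<exists>x\<in>topspace (symbolic_space F S). \<forall>n. (lshift ^^ n) x \<in> {x \<in> S. x 0 = y n}" if "y \<in> Y" for y
    proof (intro bexI allI CollectI conjI)
      show "y \<in> topspace (symbolic_space F S)" using that Y topspace by blast
      show "(lshift ^^ n) y \<in> S" for n using that Y inv by (induction n) auto
    qed (simp add: lshift_funpow)
  qed (use S Y inv topspace in auto)
qed

end

lemma card_image_factor:
  assumes "finite (g ` A)" "\<And>x y. x \<in> A \<Longrightarrow> y \<in> A \<Longrightarrow> g x = g y \<Longrightarrow> f x = f y"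
  shows "card (f ` A) \<le> card (g ` A)"
proof -
  have "f ` A = (\<lambda>z. f (inv_into A g z)) ` g ` A"
    unfolding image_image
    by (intro image_cong refl assms(2)) (auto simp: inv_into_into f_inv_into_f)
  then show ?thesis using card_image_le[OF assms(1)] by simp
qed

text \<open>Finitely many members of the algebra look at a common number \<open>k\<close> of
  coordinates, so their patterns up to time \<open>n\<close> depend only on the prefix of length
  \<open>n + k\<close>.\<close>

lemma (in symbolic) h_measure_le_words:
  assumes inv: "invariant_prob (symbolic_space F S) lshift \<mu>"
    and S': "S' \<subseteq> S" "AE x in \<mu>. x \<in> S'" and h: "h \<ge> 0"
    and growth: "exp_growth_le (\<lambda>n. card (words n S')) h"
  shows "h_measure \<mu> lshift \<le> ennreal h"
proof -
  have P: "prob_space \<mu>" and T: "lshift \<in> measurable \<mu> \<mu>" "distr \<mu> \<mu> lshift = \<mu>"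
    and sp: "space \<mu> = S" and st: "sets \<mu> = sigma_sets S clopens"
    using inv by (auto simp: invariant_prob_def topspace sets_symbolic)
  show ?thesis
  proof (rule h_measure_le[OF P T, of clopens S' h])
    show "algebra (space \<mu>) clopens" unfolding sp by (rule algebra_clopens)
    show "sets \<mu> = sigma_sets (space \<mu>) clopens" unfolding sp by (rule st)
    show "S' \<subseteq> space \<mu>" unfolding sp by (rule S')
    fix B assume B: "finite B" "B \<subseteq> clopens"
    then have "\<forall>b\<in>B. \<exists>k. determined k b" by (auto simp: clopens_def)
    then obtain K where K: "\<And>b. b \<in> B \<Longrightarrow> determined (K b) b" by metis
    obtain k where k: "\<And>b. b \<in> B \<Longrightarrow> K b \<le> k"
      using finite_nat_set_iff_bounded_le[of "K ` B"] B(1) by auto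
    have det: "determined k b" if "b \<in> B" for b using K[OF that] k[OF that] by (rule determined_mono)
    have TS: "(lshift ^^ n) x \<in> S" if "x \<in> S" for n x
      using measurable_space[OF distr_funpow(1)[OF T]] that unfolding sp .
    have "card ((\<lambda>x. \<lambda>t\<in>{..<n}. {b \<in> B. (lshift ^^ t) x \<in> b}) ` S') \<le> card (words (n + k) S')" for n
      unfolding words_def
    proof (rule card_image_factor)
      have "(\<lambda>x. map x [0..<n + k]) ` S' \<subseteq> words (n + k) S" using S'(1) by (auto simp: words_def)
      then show "finite ((\<lambda>x. map x [0..<n + k]) ` S')" using finite_words by (rule finite_subset)
      fix x y assume xy: "x \<in> S'" "y \<in> S'" "map x [0..<n + k] = map y [0..<n + k]"
      have eq: "x i = y i" if "i < n + k" for i using xy(3) that by simp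
      show "(\<lambda>t\<in>{..<n}. {b \<in> B. (lshift ^^ t) x \<in> b}) = (\<lambda>t\<in>{..<n}. {b \<in> B. (lshift ^^ t) y \<in> b})"
      proof (rule restrict_ext)
        fix t assume "t \<in> {..<n}"
        then have e: "\<forall>i<k. (lshift ^^ t) x i = (lshift ^^ t) y i" using eq by (simp add: lshift_funpow)
        have "(lshift ^^ t) x \<in> S" "(lshift ^^ t) y \<in> S" using xy S'(1) by (auto intro: TS)
        then have "(lshift ^^ t) x \<in> b \<longleftrightarrow> (lshift ^^ t) y \<in> b" if "b \<in> B" for b
          using det[OF that] e unfolding determined_def by blast
        then show "{b \<in> B. (lshift ^^ t) x \<in> b} = {b \<in> B. (lshift ^^ t) y \<in> b}" by blast
      qed
    qed
    note le = this
    show "exp_growth_le (\<lambda>n. card ((\<lambda>x. \<lambda>t\<in>{..<n}. {b \<in> B. (lshift ^^ t) x \<in> b}) ` S')) h"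
    proof (rule exp_growth_leI_poly[OF growth, where K = 1 and \<delta> = 0 and k = k, simplified])
      show "\<forall>\<^sub>F n in sequentially. real (card ((\<lambda>x. \<lambda>t\<in>{..<n}. {b \<in> B. (lshift ^^ t) x \<in> b}) ` S'))
        \<le> (real n + 1) * real (card (words (n + k) S'))"
      proof (intro always_eventually allI)
        fix n
        have "real (card ((\<lambda>x. \<lambda>t\<in>{..<n}. {b \<in> B. (lshift ^^ t) x \<in> b}) ` S')) \<le> 1 * real (card (words (n + k) S'))"
          using le[of n] by simp
        also have "\<dots> \<le> (real n + 1) * real (card (words (n + k) S'))" by (intro mult_right_mono) auto
        finally show "real (card ((\<lambda>x. \<lambda>t\<in>{..<n}. {b \<in> B. (lshift ^^ t) x \<in> b}) ` S'))
          \<le> (real n + 1) * real (card (words (n + k) S'))" .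
      qed
    qed
  qed (use S' h in auto)
qed

section \<open>The coding of trajectories\<close>

text \<open>Once decreasing coordinates \<open>r i\<close> are replaced by \<open>q - r i\<close>,
  all coordinates increase with \<open>t\<close> and the tuples form a chain. Along a chain the sum
  of the coordinates tells tuples apart, and it takes at most \<open>N * q + 1\<close> values:
  linear in \<open>N\<close> instead of exponential.\<close>

lemma card_monotone_tuples:
  fixes t :: "'x \<Rightarrow> real" and r :: "nat \<Rightarrow> 'x \<Rightarrow> nat"
  assumes bound: "\<And>i x. i < N \<Longrightarrow> x \<in> A \<Longrightarrow> r i x \<le> q"
    and mono: "\<And>i. i < N \<Longrightarrow> (\<forall>x\<in>A. \<forall>y\<in>A. t x \<le> t y \<longrightarrow> r i x \<le> r i y) \<or>
      (\<forall>x\<in>A. \<forall>y\<in>A. t x \<le> t y \<longrightarrow> r i y \<le> r i x)"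
  shows "card ((\<lambda>x. map (\<lambda>i. r i x) [0..<N]) ` A) \<le> N * q + 1"
proof -
  define inc where "inc i \<longleftrightarrow> (\<forall>x\<in>A. \<forall>y\<in>A. t x \<le> t y \<longrightarrow> r i x \<le> r i y)" for i
  define r' where "r' i x = (if inc i then r i x else q - r i x)" for i x
  define s where "s x = (\<Sum>i<N. r' i x)" for x
  have r'_mono: "r' i x \<le> r' i y" if "i < N" "x \<in> A" "y \<in> A" "t x \<le> t y" for i x y
  proof (cases "inc i")
    case True
    then have "r i x \<le> r i y" using that unfolding inc_def by simp
    then show ?thesis using True by (simp add: r'_def)
  next
    case False
    have "inc i \<or> (\<forall>x\<in>A. \<forall>y\<in>A. t x \<le> t y \<longrightarrow> r i y \<le> r i x)"
      using mono[OF that(1)] unfolding inc_def .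
    then have "\<forall>x\<in>A. \<forall>y\<in>A. t x \<le> t y \<longrightarrow> r i y \<le> r i x" using False by (rule disjE[OF _ notE])
    then have "r i y \<le> r i x" using that by simp
    then show ?thesis using False by (simp add: r'_def diff_le_mono2)
  qed
  have r'_inj: "r i x = r i y" if "i < N" "x \<in> A" "y \<in> A" "r' i x = r' i y" for i x y
    using that bound[OF that(1,2)] bound[OF that(1,3)] unfolding r'_def by (simp split: if_splits)
  have sle: "s ` A \<subseteq> {..N * q}"
  proof
    fix z assume "z \<in> s ` A"
    then obtain x where x: "x \<in> A" "z = s x" by blast
    have "s x \<le> (\<Sum>i<N. q)" unfolding s_def
      by (intro sum_mono) (use x bound in \<open>simp add: r'_def\<close>)
    then show "z \<in> {..N * q}" using x by simp
  qed
  have eq: "\<forall>i<N. r' i x = r' i y" if xy: "x \<in> A" "y \<in> A" "s x = s y" "t x \<le> t y" for x y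
  proof (rule ccontr)
    assume "\<not> (\<forall>i<N. r' i x = r' i y)"
    then obtain i where i: "i < N" "r' i x \<noteq> r' i y" by blast
    have "s x < s y" unfolding s_def
    proof (rule sum_strict_mono_ex1)
      show "\<forall>i\<in>{..<N}. r' i x \<le> r' i y" using r'_mono xy by simp
      show "\<exists>i\<in>{..<N}. r' i x < r' i y" using i r'_mono[OF i(1) xy(1,2,4)] by (intro bexI[of _ i]) auto
    qed simp
    then show False using xy(3) by simp
  qed
  have "card ((\<lambda>x. map (\<lambda>i. r i x) [0..<N]) ` A) \<le> card (s ` A)"
  proof (rule card_image_factor)
    show "finite (s ` A)" using sle by (rule finite_subset) simp
    fix x y assume xy: "x \<in> A" "y \<in> A" "s x = s y"
    have r'_eq: "r' i x = r' i y" if i: "i < N" for i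
    proof (cases "t x \<le> t y")
      case True
      show ?thesis by (rule eq[OF xy True, rule_format, OF i])
    next
      case False
      then have "t y \<le> t x" by simp
      then show ?thesis by (rule eq[OF xy(2,1) xy(3)[symmetric], rule_format, OF _ i, symmetric])
    qed
    have "r i x = r i y" if i: "i < N" for i by (rule r'_inj[OF i xy(1,2) r'_eq[OF i]])
    then show "map (\<lambda>i. r i x) [0..<N] = map (\<lambda>i. r i y) [0..<N]" by (intro map_cong) simp_all
  qed
  also have "\<dots> \<le> card {..N * q}" by (rule card_mono[OF _ sle]) simp
  finally show ?thesis by simp
qed

section \<open>Partition points, inverse branches and the Markov property\<close>

locale markov =
  fixes F :: "'a markov_tuple"
  assumes mm: "markov_multi_map F" and pp: "properly_parametrized F"
begin

lemma fin: "finite (syms F)"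
  using mm by (simp add: markov_multi_map_def)

lemma pt_less: "i < j \<Longrightarrow> j \<le> nparts F \<Longrightarrow> pt F i < pt F j"
proof (induction j)
  case (Suc j)
  have "pt F j < pt F (Suc j)" using Suc.prems mm by (simp add: markov_multi_map_def)
  moreover have "i < j \<or> i = j" using Suc.prems by linarith
  ultimately show ?case using Suc by auto
qed simp

lemma pt_le: "i \<le> j \<Longrightarrow> j \<le> nparts F \<Longrightarrow> pt F i \<le> pt F j"
  using pt_less[of i j] by (cases "i = j") auto

lemma pts_01: "p \<in> pts F \<Longrightarrow> 0 \<le> p \<and> p \<le> 1"
proof -
  assume "p \<in> pts F"
  then obtain i where i: "i \<le> nparts F" "p = pt F i" by (auto simp: pts_def)
  have "pt F 0 = 0" "pt F (nparts F) = 1" using mm by (simp_all add: markov_multi_map_def)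
  then show ?thesis using pt_le[of 0 i] pt_le[of i "nparts F"] i by simp
qed

lemma pts_gap: "i < nparts F \<Longrightarrow> p \<in> pts F \<Longrightarrow> p \<le> pt F i \<or> pt F (Suc i) \<le> p"
proof -
  assume i: "i < nparts F" and "p \<in> pts F"
  then obtain j where j: "j \<le> nparts F" "p = pt F j" by (auto simp: pts_def)
  show ?thesis using pt_le[of j i] pt_le[of "Suc i" j] i j by (cases "j \<le> i") auto
qed

lemma sdom_sym0:
  assumes "a \<in> sym0 F"
  obtains i where "i < nparts F" "sdom F a = {pt F i..pt F (Suc i)}" "sdom0 F a = {pt F i<..<pt F (Suc i)}"
    "pt F i < pt F (Suc i)"
proof -
  obtain i where i: "i < nparts F" "sdom F a = {pt F i..pt F (Suc i)}"
    using mm assms unfolding markov_multi_map_def by blast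
  moreover have "sdom0 F a = {pt F i<..<pt F (Suc i)}" using assms i by (simp add: sdom0_def)
  ultimately show ?thesis using that pt_less[of i "Suc i"] by simp
qed

lemma sdom_sym12:
  assumes "a \<in> syms F" "a \<notin> sym0 F"
  obtains p where "p \<in> pts F" "sdom F a = {p}" "sdom0 F a = {p}" "finv F a = (\<lambda>_. p)"
proof -
  have "a \<in> sym1 F \<union> sym2 F" using assms by (auto simp: syms_def)
  then obtain i where i: "i \<le> nparts F" "sdom F a = {pt F i}"
    using mm unfolding markov_multi_map_def by blast
  then show ?thesis using that[of "pt F i"] assms(2) by (simp add: sdom0_def finv_def pts_def)
qed

lemma srng_cases:
  assumes "a \<in> syms F"
  obtains u v where "u \<in> pts F" "v \<in> pts F" "u < v" "srng F a = {u..v}" "srng0 F a = {u<..<v}"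
  | u where "a \<notin> sym0 F" "u \<in> pts F" "srng F a = {u}" "srng0 F a = {u}"
proof -
  consider "a \<in> sym0 F" | "a \<in> sym1 F" | "a \<in> sym2 F" using assms by (auto simp: syms_def)
  then show ?thesis
  proof cases
    case 1
    then obtain u v where uv: "u \<in> pts F" "v \<in> pts F" "u < v" "srng F a = {u..v}"
      using mm unfolding markov_multi_map_def by blast
    then show ?thesis using that(1)[OF uv] 1 by (simp add: srng0_def)
  next
    case 2
    then obtain u v where uv: "u \<in> pts F" "v \<in> pts F" "u < v" "srng F a = {u..v}"
      using mm unfolding markov_multi_map_def by blast
    then show ?thesis using that(1)[OF uv] 2 by (simp add: srng0_def)
  next
    case 3
    have "\<forall>a\<in>sym2 F. \<exists>u\<in>pts F. srng F a = {u}"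
      using mm unfolding markov_multi_map_def by (elim conjE)
    from bspec[OF this 3] obtain u where u: "u \<in> pts F" "srng F a = {u}" by (rule bexE)
    have d: "sym0 F \<inter> sym2 F = {}" "sym1 F \<inter> sym2 F = {}"
      using mm by (simp_all add: markov_multi_map_def)
    have "a \<notin> sym0 F \<union> sym1 F" using d 3 by blast
    then show ?thesis using that(2)[OF _ u] u by (simp add: srng0_def)
  qed
qed

lemma sdom0_sub: "sdom0 F a \<subseteq> sdom F a"
  by (simp add: sdom0_def interior_subset)

lemma srng0_sub: "srng0 F a \<subseteq> srng F a"
  by (simp add: srng0_def interior_subset)

lemma sdom_01: "a \<in> syms F \<Longrightarrow> sdom F a \<subseteq> {0..1}"
proof (cases "a \<in> sym0 F")
  case True
  obtain i where i: "i < nparts F" "sdom F a = {pt F i..pt F (Suc i)}" by (rule sdom_sym0[OF True], rule that)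
  have "pt F i \<in> pts F" "pt F (Suc i) \<in> pts F" using i(1) by (auto simp: pts_def)
  from pts_01[OF this(1)] pts_01[OF this(2)] show ?thesis unfolding i(2) by auto
next
  case False
  assume a: "a \<in> syms F"
  obtain p where "p \<in> pts F" "sdom F a = {p}" by (rule sdom_sym12[OF a False], rule that)
  then show ?thesis using pts_01[of p] by simp
qed

lemma compact_srng: "a \<in> syms F \<Longrightarrow> compact (srng F a)"
  by (erule srng_cases) auto

text \<open>The transition rule compares interiors; taking closures gives the inclusion that makes
  the inverse branches composable.\<close>

lemma sdom_subset_srng:
  assumes "b \<in> syms F" "a \<in> syms F" "sdom0 F b \<subseteq> srng0 F a"
  shows "sdom F b \<subseteq> srng F a"
proof -
  have "sdom F b \<subseteq> closure (sdom0 F b)"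
  proof (cases "b \<in> sym0 F")
    case True
    then show ?thesis by (rule sdom_sym0) (simp add: closure_greaterThanLessThan)
  next
    case False
    show ?thesis by (rule sdom_sym12[OF assms(1) False]) simp
  qed
  also have "\<dots> \<subseteq> closure (srng F a)" using assms(3) srng0_sub by (intro closure_mono) blast
  also have "\<dots> = srng F a" using compact_srng[OF assms(2)] by (simp add: compact_imp_closed closure_closed)
  finally show ?thesis .
qed

text \<open>The Markov property: the end points of \<open>R(a)\<close> are partition points and an
  open partition interval contains none, so one common point forces inclusion.\<close>

lemma sdom0_meets_srng0:
  assumes "b \<in> syms F" "a \<in> syms F" "x \<in> sdom0 F b" "x \<in> srng0 F a"
  shows "sdom0 F b \<subseteq> srng0 F a"
proof (cases "b \<in> sym0 F")
  case False
  show ?thesis by (rule sdom_sym12[OF assms(1) False]) (use assms(3,4) in simp)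
next
  case True
  obtain i where i: "i < nparts F" "sdom0 F b = {pt F i<..<pt F (Suc i)}" by (rule sdom_sym0[OF True], rule that)
  show ?thesis
  proof (rule srng_cases[OF assms(2)])
    fix u v assume uv: "u \<in> pts F" "v \<in> pts F" "srng0 F a = {u<..<v}"
    show ?thesis using pts_gap[OF i(1) uv(1)] pts_gap[OF i(1) uv(2)] assms(3,4) unfolding i(2) uv(3) by auto
  next
    fix u assume u: "u \<in> pts F" "srng0 F a = {u}"
    show ?thesis using pts_gap[OF i(1) u(1)] assms(3,4) unfolding i(2) u(2) by auto
  qed
qed

lemma finv_sym0:
  assumes a: "a \<in> sym0 F"
  shows "finv F a ` srng F a = sdom F a" "continuous_on (srng F a) (finv F a)"
    "\<And>x. x \<in> sdom F a \<Longrightarrow> fmap F a x \<in> srng F a \<and> finv F a (fmap F a x) = x"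
    "\<And>y. y \<in> srng F a \<Longrightarrow> fmap F a (finv F a y) = y"
    "strict_mono_on (srng F a) (finv F a) \<or> strict_antimono_on (srng F a) (finv F a)"
proof -
  obtain g where g: "homeomorphism (sdom F a) (srng F a) (fmap F a) g"
  proof -
    have "\<forall>a\<in>sym0 F. \<exists>g. homeomorphism (sdom F a) (srng F a) (fmap F a) g"
      using mm unfolding markov_multi_map_def by (elim conjE)
    from bspec[OF this a] show ?thesis using that by (rule exE)
  qed
  have inj: "inj_on (fmap F a) (sdom F a)"
    using g unfolding homeomorphism_def by (metis inj_on_inverseI)
  have eq: "finv F a y = g y" if y: "y \<in> srng F a" for y
  proof -
    have "fmap F a (g y) = y" "g y \<in> sdom F a" using g y unfolding homeomorphism_def by auto
    then show ?thesis using a inv_into_f_f[OF inj, of "g y"] by (simp add: finv_def)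
  qed
  show im: "finv F a ` srng F a = sdom F a"
    using g eq unfolding homeomorphism_def by (metis image_cong)
  have "continuous_on (srng F a) g" using g unfolding homeomorphism_def by blast
  then show c: "continuous_on (srng F a) (finv F a)"
    using eq by (metis continuous_on_cong)
  show "fmap F a x \<in> srng F a \<and> finv F a (fmap F a x) = x" if "x \<in> sdom F a" for x
    using g eq that unfolding homeomorphism_def by (metis imageI)
  show fg: "fmap F a (finv F a y) = y" if "y \<in> srng F a" for y
    using g eq[OF that] that unfolding homeomorphism_def by metis
  have "inj_on (finv F a) (srng F a)" using fg by (rule inj_on_inverseI)
  moreover have "is_interval (srng F a)"
  proof -
    have "a \<in> syms F" using a by (simp add: syms_def)
    then show ?thesis by (rule srng_cases) (simp_all add: is_interval_1)
  qed
  ultimately show "strict_mono_on (srng F a) (finv F a) \<or> strict_antimono_on (srng F a) (finv F a)"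
    using injective_eq_monotone_map[OF _ c] by blast
qed

text \<open>A strictly monotone surjection between compact intervals maps end points to end points,
  in the same or in the reverse order, and therefore matches the interiors.\<close>

lemma finv_sym0_interior:
  assumes a: "a \<in> sym0 F" and y: "y \<in> srng F a"
  shows "finv F a y \<in> sdom0 F a \<longleftrightarrow> y \<in> srng0 F a"
proof -
  obtain i where i: "sdom F a = {pt F i..pt F (Suc i)}" "sdom0 F a = {pt F i<..<pt F (Suc i)}"
    "pt F i < pt F (Suc i)" by (rule sdom_sym0[OF a], rule that)
  have as: "a \<in> syms F" using a by (simp add: syms_def)
  obtain u v where uv: "u < v" "srng F a = {u..v}" "srng0 F a = {u<..<v}"
  proof (rule srng_cases[OF as])
    fix u v assume "u < v" "srng F a = {u..v}" "srng0 F a = {u<..<v}"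
    then show thesis by (rule that)
  next
    assume "a \<notin> sym0 F"
    then show thesis using a by simp
  qed
  let ?g = "finv F a"
  have mem: "?g z \<in> {pt F i..pt F (Suc i)}" if "z \<in> {u..v}" for z
    using finv_sym0(1)[OF a] that unfolding i uv by blast
  have sur: "\<exists>z\<in>{u..v}. ?g z = x" if "x \<in> {pt F i..pt F (Suc i)}" for x
  proof -
    have "x \<in> ?g ` {u..v}" using finv_sym0(1)[OF a] that unfolding i uv by simp
    then show ?thesis by blast
  qed
  obtain l where l: "l \<in> {u..v}" "?g l = pt F i" using sur[of "pt F i"] i(3) by auto
  obtain r where r: "r \<in> {u..v}" "?g r = pt F (Suc i)" using sur[of "pt F (Suc i)"] i(3) by auto
  have muv: "u \<in> {u..v}" "v \<in> {u..v}" and my: "y \<in> {u..v}" using uv y by auto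
  from finv_sym0(5)[OF a] show ?thesis unfolding uv(2)
  proof
    assume m: "strict_mono_on {u..v} ?g"
    have less: "?g z < ?g w" if "z \<in> {u..v}" "w \<in> {u..v}" "z < w" for z w
      using strict_mono_onD[OF m that] .
    have lu: "?g u = pt F i"
      using less[OF muv(1) l(1)] mem[OF muv(1)] l by (cases "u = l") auto
    have rv: "?g v = pt F (Suc i)"
      using less[OF r(1) muv(2)] mem[OF muv(2)] r by (cases "v = r") auto
    show ?thesis unfolding i(2) uv(3)
    proof
      assume "y \<in> {u<..<v}"
      then show "?g y \<in> {pt F i<..<pt F (Suc i)}" using less[OF muv(1) my] less[OF my muv(2)] lu rv by auto
    next
      assume "?g y \<in> {pt F i<..<pt F (Suc i)}"
      then have "y \<noteq> u" "y \<noteq> v" using lu rv by auto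
      then show "y \<in> {u<..<v}" using my by auto
    qed
  next
    assume m: "strict_antimono_on {u..v} ?g"
    have less: "?g w < ?g z" if "z \<in> {u..v}" "w \<in> {u..v}" "z < w" for z w
      by (rule monotone_onD[OF m that])
    have lu: "?g u = pt F (Suc i)"
      using less[OF muv(1) r(1)] mem[OF muv(1)] r by (cases "u = r") auto
    have rv: "?g v = pt F i"
      using less[OF l(1) muv(2)] mem[OF muv(2)] l by (cases "v = l") auto
    show ?thesis unfolding i(2) uv(3)
    proof
      assume "y \<in> {u<..<v}"
      then show "?g y \<in> {pt F i<..<pt F (Suc i)}" using less[OF muv(1) my] less[OF my muv(2)] lu rv by auto
    next
      assume "?g y \<in> {pt F i<..<pt F (Suc i)}"
      then have "y \<noteq> u" "y \<noteq> v" using lu rv by auto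
      then show "y \<in> {u<..<v}" using my by auto
    qed
  qed
qed

text \<open>All three kinds of symbols can be treated alike: their graphs are the graphs of the inverse
  branches.\<close>

lemma graph_sym_iff:
  assumes a: "a \<in> syms F"
  shows "(x, y) \<in> graph_sym F a \<longleftrightarrow> y \<in> srng F a \<and> x = finv F a y"
proof (cases "a \<in> sym0 F")
  case True
  show ?thesis
  proof
    assume "(x, y) \<in> graph_sym F a"
    then have "x \<in> sdom F a" "y = fmap F a x" using True by (auto simp: graph_sym_def)
    then show "y \<in> srng F a \<and> x = finv F a y" using finv_sym0(3)[OF True] by simp
  next
    assume h: "y \<in> srng F a \<and> x = finv F a y"
    have "x \<in> sdom F a" unfolding finv_sym0(1)[OF True, symmetric] using h by simp
    moreover have "fmap F a x = y" using h finv_sym0(4)[OF True] by simp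
    ultimately show "(x, y) \<in> graph_sym F a" using True by (auto simp: graph_sym_def)
  qed
next
  case False
  obtain p where "sdom F a = {p}" "finv F a = (\<lambda>_. p)" by (rule sdom_sym12[OF a False], rule that)
  then show ?thesis using False by (auto simp: graph_sym_def)
qed

lemma graph0_sym_iff:
  assumes a: "a \<in> syms F"
  shows "(x, y) \<in> graph0_sym F a \<longleftrightarrow> y \<in> srng0 F a \<and> x = finv F a y"
proof (cases "a \<in> sym0 F")
  case True
  show ?thesis
  proof
    assume "(x, y) \<in> graph0_sym F a"
    then have x: "x \<in> sdom0 F a" "y = fmap F a x" using True by (auto simp: graph0_sym_def)
    then have "x \<in> sdom F a" using sdom0_sub by blast
    then have "y \<in> srng F a" "x = finv F a y" using finv_sym0(3)[OF True] x(2) by auto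
    then show "y \<in> srng0 F a \<and> x = finv F a y" using finv_sym0_interior[OF True] x(1) by blast
  next
    assume h: "y \<in> srng0 F a \<and> x = finv F a y"
    then have y: "y \<in> srng F a" using srng0_sub by blast
    then have "x \<in> sdom0 F a" "fmap F a x = y" using h finv_sym0_interior[OF True] finv_sym0(4)[OF True] by auto
    then show "(x, y) \<in> graph0_sym F a" using True by (auto simp: graph0_sym_def)
  qed
next
  case False
  obtain p where "sdom0 F a = {p}" "finv F a = (\<lambda>_. p)" by (rule sdom_sym12[OF a False], rule that)
  then show ?thesis using False by (auto simp: graph0_sym_def)
qed

lemma finv_sdom: "a \<in> syms F \<Longrightarrow> y \<in> srng F a \<Longrightarrow> finv F a y \<in> sdom F a"
proof (cases "a \<in> sym0 F")
  case True
  assume "y \<in> srng F a"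
  then show ?thesis unfolding finv_sym0(1)[OF True, symmetric] by simp
next
  case False
  assume a: "a \<in> syms F"
  obtain p where "sdom F a = {p}" "finv F a = (\<lambda>_. p)" by (rule sdom_sym12[OF a False], rule that)
  then show ?thesis by simp
qed

lemma finv_sdom0: "a \<in> syms F \<Longrightarrow> y \<in> srng0 F a \<Longrightarrow> finv F a y \<in> sdom0 F a"
proof (cases "a \<in> sym0 F")
  case True
  assume "y \<in> srng0 F a"
  then show ?thesis using finv_sym0_interior[OF True] srng0_sub by blast
next
  case False
  assume a: "a \<in> syms F"
  obtain p where "sdom0 F a = {p}" "finv F a = (\<lambda>_. p)" by (rule sdom_sym12[OF a False], rule that)
  then show ?thesis by simp
qed

lemma continuous_finv: "a \<in> syms F \<Longrightarrow> continuous_on (srng F a) (finv F a)"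
proof (cases "a \<in> sym0 F")
  case False
  assume a: "a \<in> syms F"
  obtain p where "finv F a = (\<lambda>_. p)" by (rule sdom_sym12[OF a False], rule that)
  then show ?thesis by simp
qed (rule finv_sym0(2))

lemma finv_monotone:
  assumes a: "a \<in> syms F"
  shows "(\<forall>y\<in>srng F a. \<forall>z\<in>srng F a. y \<le> z \<longrightarrow> finv F a y \<le> finv F a z) \<or>
    (\<forall>y\<in>srng F a. \<forall>z\<in>srng F a. y \<le> z \<longrightarrow> finv F a z \<le> finv F a y)"
proof (cases "a \<in> sym0 F")
  case True
  from finv_sym0(5)[OF True] show ?thesis
  proof
    assume m: "strict_mono_on (srng F a) (finv F a)"
    have "finv F a y \<le> finv F a z" if "y \<in> srng F a" "z \<in> srng F a" "y \<le> z" for y z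
      using strict_mono_onD[OF m that(1,2)] that(3) by (cases "y = z") auto
    then show ?thesis by blast
  next
    assume m: "strict_antimono_on (srng F a) (finv F a)"
    have "finv F a z \<le> finv F a y" if yz: "y \<in> srng F a" "z \<in> srng F a" "y \<le> z" for y z
    proof (cases "y = z")
      case False
      then have "y < z" using yz by simp
      then have "finv F a z < finv F a y" by (rule monotone_onD[OF m yz(1,2)])
      then show ?thesis by simp
    qed simp
    then show ?thesis by blast
  qed
next
  case False
  obtain p where "finv F a = (\<lambda>_. p)" by (rule sdom_sym12[OF a False], rule that)
  then show ?thesis by simp
qed

lemma compact_graph_sym: "a \<in> syms F \<Longrightarrow> compact (graph_sym F a)"
proof -
  assume a: "a \<in> syms F"
  have "graph_sym F a = (\<lambda>y. (finv F a y, y)) ` srng F a"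
    using graph_sym_iff[OF a] by auto
  moreover have "compact ((\<lambda>y. (finv F a y, y)) ` srng F a)"
    using compact_srng[OF a] continuous_finv[OF a]
    by (intro compact_continuous_image continuous_on_Pair continuous_on_id) auto
  ultimately show ?thesis by simp
qed

lemma sdom0_or_pts: "a \<in> syms F \<Longrightarrow> x \<in> sdom F a \<Longrightarrow> a \<notin> sym0 F \<or> x \<notin> pts F \<Longrightarrow> x \<in> sdom0 F a"
proof (cases "a \<in> sym0 F")
  case True
  assume x: "x \<in> sdom F a" "a \<notin> sym0 F \<or> x \<notin> pts F"
  obtain i where i: "i < nparts F" "sdom F a = {pt F i..pt F (Suc i)}" "sdom0 F a = {pt F i<..<pt F (Suc i)}"
    by (rule sdom_sym0[OF True], rule that)
  have "pt F i \<in> pts F" "pt F (Suc i) \<in> pts F" using i(1) by (auto simp: pts_def)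
  then have "x \<noteq> pt F i" "x \<noteq> pt F (Suc i)" using x(2) True by blast+
  then show ?thesis using x(1) unfolding i by auto
qed (simp add: sdom0_def)

lemma trans_edge: "(a, b) \<in> edges F (syms F) \<longleftrightarrow> a \<in> syms F \<and> b \<in> syms F \<and> sdom0 F b \<subseteq> srng0 F a"
  by (auto simp: edges_def trans_mat_def)

lemma sftD: "a \<in> sft F \<Longrightarrow> a n \<in> syms F" "a \<in> sft F \<Longrightarrow> sdom0 F (a (Suc n)) \<subseteq> srng0 F (a n)"
  unfolding sft_eq_walks walks_def using trans_edge by auto

lemma sft_lshift: "a \<in> sft F \<Longrightarrow> (lshift ^^ n) a \<in> sft F"
  unfolding sft_eq_walks by (rule walks_lshift)

section \<open>Codes and shadows of trajectories\<close>

text \<open>The symbol is read off from \<open>G_0\<close>: the full graphs may overlap in end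
  points, while proper parametrization makes the \<open>G_0(a)\<close> a partition.\<close>

definition code :: "(nat \<Rightarrow> real) \<Rightarrow> nat \<Rightarrow> 'a" where
  "code x n = (THE a. a \<in> syms F \<and> (x n, x (Suc n)) \<in> graph0_sym F a)"

lemma code_props:
  assumes x: "x \<in> trajectories F"
  shows "code x n \<in> syms F" "x (Suc n) \<in> srng0 F (code x n)" "x n = finv F (code x n) (x (Suc n))"
    and code_unique: "\<And>a. a \<in> syms F \<Longrightarrow> (x n, x (Suc n)) \<in> graph0_sym F a \<Longrightarrow> code x n = a"
proof -
  have "(x n, x (Suc n)) \<in> graph_mm F" using x by (simp add: trajectories_def mm_apply_def)
  then obtain a where a: "a \<in> syms F" "(x n, x (Suc n)) \<in> graph0_sym F a"
    using pp unfolding properly_parametrized_def by blast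
  have uniq: "b = a" if "b \<in> syms F" "(x n, x (Suc n)) \<in> graph0_sym F b" for b
  proof (rule ccontr)
    assume "b \<noteq> a"
    then have "graph0_sym F b \<inter> graph0_sym F a = {}"
      using pp a(1) that(1) unfolding properly_parametrized_def disjoint_family_on_def by blast
    then show False using a(2) that(2) by blast
  qed
  then have c: "code x n = a" unfolding code_def using a by (intro the_equality) blast+
  show "code x n \<in> syms F" "x (Suc n) \<in> srng0 F (code x n)" "x n = finv F (code x n) (x (Suc n))"
    unfolding c using a graph0_sym_iff[OF a(1)] by auto
  show "code x n = b" if "b \<in> syms F" "(x n, x (Suc n)) \<in> graph0_sym F b" for b
    unfolding c using uniq[OF that] by simp
qed

text \<open>The point \<open>x (Suc n)\<close> lies in \<open>R_0\<close> of the present symbol and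
  in \<open>D_0\<close> of the next one, so \<open>sdom0_meets_srng0\<close> yields the
  transition.\<close>

lemma code_sft: "x \<in> trajectories F \<Longrightarrow> code x \<in> sft F"
proof -
  assume x: "x \<in> trajectories F"
  note c = code_props(1-3)[OF x]
  have "(code x n, code x (Suc n)) \<in> edges F (syms F)" for n
  proof -
    have "x (Suc n) \<in> sdom0 F (code x (Suc n))"
      using finv_sdom0[OF c(1) c(2)[of "Suc n"]] c(3)[of "Suc n"] by simp
    then have "sdom0 F (code x (Suc n)) \<subseteq> srng0 F (code x n)"
      using c(1,2) by (intro sdom0_meets_srng0) auto
    then show ?thesis using c(1) trans_edge by blast
  qed
  then show ?thesis unfolding sft_eq_walks walks_def by blast
qed

lemma trajectories_lshift: "x \<in> trajectories F \<Longrightarrow> lshift x \<in> trajectories F"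
  by (simp add: trajectories_def lshift_def)

lemma code_lshift: "code (lshift x) = lshift (code x)"
  by (simp add: fun_eq_iff code_def lshift_def)

text \<open>The closed graphs make this a closed condition, at the price that a trajectory may
  shadow sequences other than its code.\<close>

definition shadows :: "(nat \<Rightarrow> 'a) \<Rightarrow> (nat \<Rightarrow> real) set" where
  "shadows a = {x. \<forall>n. (x n, x (Suc n)) \<in> graph_sym F (a n)}"

lemma shadows_iff:
  assumes "a \<in> sft F"
  shows "x \<in> shadows a \<longleftrightarrow> (\<forall>n. x (Suc n) \<in> srng F (a n) \<and> x n = finv F (a n) (x (Suc n)))"
  using graph_sym_iff sftD(1)[OF assms] by (simp add: shadows_def)

lemma shadows_sdom:
  assumes "a \<in> sft F" "x \<in> shadows a" shows "x n \<in> sdom F (a n)"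
proof -
  have h: "x (Suc n) \<in> srng F (a n)" "x n = finv F (a n) (x (Suc n))" using assms shadows_iff by blast+
  show ?thesis using finv_sdom[OF sftD(1)[OF assms(1)] h(1)] unfolding h(2)[symmetric] .
qed

lemma shadows_trajectories: "a \<in> sft F \<Longrightarrow> shadows a \<subseteq> trajectories F"
proof
  fix x assume a: "a \<in> sft F" and x: "x \<in> shadows a"
  have "x n \<in> {0..1}" for n using shadows_sdom[OF a x] sdom_01[OF sftD(1)[OF a]] by blast
  moreover have "(x n, x (Suc n)) \<in> graph_mm F" for n
    using x sftD(1)[OF a] unfolding shadows_def graph_mm_def by blast
  ultimately show "x \<in> trajectories F" by (simp add: trajectories_def mm_apply_def)
qed

lemma shadows_lshift: "x \<in> shadows a \<Longrightarrow> (lshift ^^ n) x \<in> shadows ((lshift ^^ n) a)"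
  by (simp add: shadows_def lshift_funpow)

lemma shadows_code: "x \<in> trajectories F \<Longrightarrow> x \<in> shadows (code x)"
proof -
  assume x: "x \<in> trajectories F"
  have "x (Suc n) \<in> srng F (code x n) \<and> x n = finv F (code x n) (x (Suc n))" for n
    using code_props(2,3)[OF x, of n] srng0_sub by blast
  then show ?thesis using shadows_iff[OF code_sft[OF x]] by blast
qed

text \<open>Being in the interior of the right domain propagates backwards in time.\<close>

lemma code_eqI:
  assumes a: "a \<in> sft F" and x: "x \<in> shadows a" and inf: "infinite {n. x n \<in> sdom0 F (a n)}"
  shows "code x = a"
proof
  fix n
  have h: "x (Suc k) \<in> srng F (a k)" "x k = finv F (a k) (x (Suc k))" for k
    using x shadows_iff[OF a] by blast+
  have backw: "x (m - k) \<in> sdom0 F (a (m - k))" if "x m \<in> sdom0 F (a m)" "k \<le> m" for m k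
    using that
  proof (induction k)
    case (Suc k)
    then have "x (m - k) \<in> sdom0 F (a (m - k))" and e: "m - k = Suc (m - Suc k)" by auto
    then have "x (Suc (m - Suc k)) \<in> srng0 F (a (m - Suc k))"
      using sftD(2)[OF a, of "m - Suc k"] by auto
    then have "finv F (a (m - Suc k)) (x (Suc (m - Suc k))) \<in> sdom0 F (a (m - Suc k))"
      by (rule finv_sdom0[OF sftD(1)[OF a]])
    then show ?case unfolding h(2)[symmetric] .
  qed simp
  obtain m where m: "m \<ge> Suc n" "x m \<in> sdom0 F (a m)" using inf by (auto simp: infinite_Collect_nat_iff)
  then have "x (Suc n) \<in> sdom0 F (a (Suc n))" using backw[of m "m - Suc n"] by simp
  then have "x (Suc n) \<in> srng0 F (a n)" using sftD(2)[OF a] by blast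
  then have "(x n, x (Suc n)) \<in> graph0_sym F (a n)"
    using graph0_sym_iff[OF sftD(1)[OF a]] h(2) by blast
  then show "code x n = a n"
    using shadows_trajectories[OF a] x by (intro code_unique sftD(1)[OF a]) auto
qed

lemma shadows_word_interval:
  assumes a: "a \<in> sft F" and x: "x \<in> shadows a"
  shows "x m \<in> foldr (\<lambda>a S. finv F a ` S) (map a [m..<m + n]) (sdom F (a (m + n)))"
proof (induction n arbitrary: m)
  case 0
  show ?case using shadows_sdom[OF a x] by simp
next
  case (Suc n)
  have "[m..<m + Suc n] = m # [Suc m..<Suc m + n]" by (simp add: upt_conv_Cons)
  moreover have "x m = finv F (a m) (x (Suc m))" using x shadows_iff[OF a] by blast
  ultimately show ?case using Suc.IH[of "Suc m"] by simp
qed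

lemma shadows_point_interval:
  assumes "a \<in> sft F" "x \<in> shadows a" shows "x 0 \<in> point_interval F a"
  using shadows_word_interval[OF assms, of 0]
  by (auto simp: point_interval_def word_interval_def)

section \<open>Topology and Borel sets of the trajectory space\<close>

lemma closed_trajectories: "closed (trajectories F)"
proof -
  have "closed (graph_mm F)"
    unfolding graph_mm_def using fin compact_graph_sym by (intro closed_UN) (auto intro: compact_imp_closed)
  then have 1: "closed {x :: nat \<Rightarrow> real. (x n, x (Suc n)) \<in> graph_mm F}" for n
    using closed_vimage[of "graph_mm F" "\<lambda>x. (x n, x (Suc n))"]
    by (simp add: vimage_def continuous_on_Pair continuous_on_product_coordinates)
  have 2: "closed {x :: nat \<Rightarrow> real. x n \<in> {0..1}}" for n
    using closed_vimage[of "{0..1}" "\<lambda>x :: nat \<Rightarrow> real. x n"]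
    by (simp add: vimage_def continuous_on_product_coordinates)
  have "trajectories F = (\<Inter>n. {x. x n \<in> {0..1}}) \<inter> (\<Inter>n. {x. (x n, x (Suc n)) \<in> graph_mm F})"
    by (auto simp: trajectories_def mm_apply_def)
  also have "closed \<dots>" using 1 2 by (intro closed_Int closed_INT ballI)
  finally show ?thesis .
qed

lemma cube_eq: "product_topology (\<lambda>_. top_of_set {0..1 :: real}) (UNIV :: nat set) = top_of_set {x. \<forall>n. x n \<in> {0..1}}"
proof -
  have "product_topology (\<lambda>_. top_of_set {0..1 :: real}) (UNIV :: nat set)
      = subtopology (product_topology (\<lambda>_. euclidean) UNIV) (Pi\<^sub>E UNIV (\<lambda>_. {0..1}))"
    by (rule subtopology_product_topology[symmetric])
  moreover have "Pi\<^sub>E UNIV (\<lambda>_. {0..1}) = {x :: nat \<Rightarrow> real. \<forall>n. x n \<in> {0..1}}" by (auto simp: PiE_iff)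
  ultimately show ?thesis by (simp only: euclidean_product_topology)
qed

lemma compact_cube: "compact {x :: nat \<Rightarrow> real. \<forall>n. x n \<in> {0..1}}"
proof -
  have "compact_space (product_topology (\<lambda>_. top_of_set {0..1 :: real}) (UNIV :: nat set))"
    by (simp add: compact_space_product_topology compact_space_subtopology)
  then show ?thesis unfolding cube_eq compact_space_def compactin_subtopology compactin_euclidean_iff by simp
qed

lemma trajectories_cube: "trajectories F \<subseteq> {x. \<forall>n. x n \<in> {0..1}}"
  by (auto simp: trajectories_def)

lemma trajectory_space_eq: "trajectory_space F = top_of_set (trajectories F)"
  unfolding trajectory_space_def cube_eq subtopology_subtopology
  using trajectories_cube by (simp add: Int_absorb1)

lemma topspace_X: "topspace (trajectory_space F) = trajectories F"
  by (simp add: trajectory_space_eq)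

lemma compact_trajectories: "compact (trajectories F)"
  using compact_Int_closed[OF compact_cube closed_trajectories] trajectories_cube by (simp add: Int_absorb1)

lemma compact_X: "compact_space (trajectory_space F)"
  using compact_trajectories by (simp add: trajectory_space_eq compact_space_subtopology)

lemma closedin_X: "closed C \<Longrightarrow> closedin (trajectory_space F) {x \<in> trajectories F. x \<in> C}"
  unfolding trajectory_space_eq closedin_closed by (intro exI[of _ C]) auto

lemma continuous_lshift_X: "continuous_map (trajectory_space F) (trajectory_space F) lshift"
proof -
  have "continuous_on UNIV (lshift :: (nat \<Rightarrow> real) \<Rightarrow> _)"
    unfolding lshift_def by (intro continuous_on_coordinatewise_then_product continuous_on_product_coordinates)
  then show ?thesis unfolding trajectory_space_eq
    using trajectories_lshift by (auto simp: continuous_map_in_subtopology intro: continuous_on_subset)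
qed

lemma tds_X: "tds (trajectory_space F) lshift"
  unfolding tds_def using compact_X continuous_lshift_X
  by (simp add: trajectory_space_eq metrizable_space_subtopology metrizable_space_euclidean)

text \<open>Identifies the Borel sets of the relative topology with the traces of Borel sets of the
  sequence space, so that measurability can be checked coordinatewise.\<close>

lemma sets_X: "sets (borel_of_top (trajectory_space F)) = sets (restrict_space borel (trajectories F))"
proof -
  have "{U. openin (trajectory_space F) U} = (\<lambda>V. trajectories F \<inter> V) ` {V. open V}"
    unfolding trajectory_space_eq openin_open by blast
  then have "sets (borel_of_top (trajectory_space F)) = sigma_sets (trajectories F) ((\<inter>) (trajectories F) ` {V. open V})"
    unfolding sets_borel_of_top topspace_X by simp
  also have "\<dots> = (\<inter>) (trajectories F) ` sigma_sets UNIV {V. open V}"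
  proof (rule sigma_sets_Int[symmetric])
    show "trajectories F \<in> sigma_sets UNIV {V. open V}"
      using borel_closed[OF closed_trajectories] by (simp add: borel_def)
  qed simp
  also have "sigma_sets UNIV {V :: (nat \<Rightarrow> real) set. open V} = sets borel" by (simp add: borel_def)
  finally show ?thesis unfolding sets_restrict_space .
qed

lemma coordinate_measurable: "(\<lambda>x. x n) \<in> borel_measurable (borel_of_top (trajectory_space F))"
proof -
  have "(\<lambda>x :: nat \<Rightarrow> real. x n) \<in> borel_measurable borel"
    by (intro borel_measurable_continuous_onI continuous_on_product_coordinates)
  then have "(\<lambda>x :: nat \<Rightarrow> real. x n) \<in> borel_measurable (restrict_space borel (trajectories F))"
    by (rule measurable_restrict_space1)
  then show ?thesis using measurable_cong_sets[OF sets_X refl] by blast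
qed

text \<open>Membership depends only on how the first \<open>k\<close> coordinates compare with the
  thresholds in \<open>Q\<close>. Comparisons with thresholds are chosen because monotone branches
  control them.\<close>

definition grid_set :: "real set \<Rightarrow> nat \<Rightarrow> (nat \<Rightarrow> real) set \<Rightarrow> bool" where
  "grid_set Q k B \<longleftrightarrow> (\<forall>x\<in>trajectories F. \<forall>y\<in>trajectories F.
     (\<forall>i<k. \<forall>q\<in>Q. x i \<le> q \<longleftrightarrow> y i \<le> q) \<longrightarrow> (x \<in> B \<longleftrightarrow> y \<in> B))"

definition grid_sets :: "(nat \<Rightarrow> real) set set" where
  "grid_sets = {B \<in> sets (borel_of_top (trajectory_space F)). \<exists>Q k. finite Q \<and> grid_set Q k B}"

lemma grid_setsI:
  "B \<in> sets (borel_of_top (trajectory_space F)) \<Longrightarrow> finite Q \<Longrightarrow> grid_set Q k B \<Longrightarrow> B \<in> grid_sets"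
  unfolding grid_sets_def by (intro CollectI conjI exI)

lemma grid_setsE:
  assumes "B \<in> grid_sets"
  obtains Q k where "B \<in> sets (borel_of_top (trajectory_space F))" "finite Q" "grid_set Q k B"
proof -
  have "B \<in> sets (borel_of_top (trajectory_space F))" "\<exists>Q k. finite Q \<and> grid_set Q k B"
    using assms by (simp_all add: grid_sets_def)
  then show ?thesis using that by (elim exE conjE)
qed

lemma grid_setD:
  assumes "grid_set Q k B" "x \<in> trajectories F" "y \<in> trajectories F"
    "\<And>i q. i < k \<Longrightarrow> q \<in> Q \<Longrightarrow> x i \<le> q \<longleftrightarrow> y i \<le> q"
  shows "x \<in> B \<longleftrightarrow> y \<in> B"
proof -
  have "\<forall>y\<in>trajectories F. (\<forall>i<k. \<forall>q\<in>Q. x i \<le> q \<longleftrightarrow> y i \<le> q) \<longrightarrow> (x \<in> B \<longleftrightarrow> y \<in> B)"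
    using assms(1) unfolding grid_set_def by (rule bspec) (rule assms(2))
  then have "(\<forall>i<k. \<forall>q\<in>Q. x i \<le> q \<longleftrightarrow> y i \<le> q) \<longrightarrow> (x \<in> B \<longleftrightarrow> y \<in> B)"
    by (rule bspec) (rule assms(3))
  then show ?thesis by (rule mp) (intro allI impI ballI assms(4))
qed

lemma grid_set_mono: "grid_set Q k B \<Longrightarrow> Q \<subseteq> Q' \<Longrightarrow> k \<le> k' \<Longrightarrow> grid_set Q' k' B"
  unfolding grid_set_def by (meson order_less_le_trans subsetD)

lemma algebra_grid_sets: "algebra (trajectories F) grid_sets"
  unfolding algebra_iff_Un
proof (intro conjI ballI)
  let ?M = "borel_of_top (trajectory_space F)"
  have sp: "space ?M = trajectories F" by (simp add: space_borel_of_top topspace_X)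
  show "grid_sets \<subseteq> Pow (trajectories F)"
  proof
    fix B assume "B \<in> grid_sets"
    then have "B \<in> sets ?M" by (simp add: grid_sets_def)
    from sets.sets_into_space[OF this] show "B \<in> Pow (trajectories F)" unfolding sp by (rule PowI)
  qed
  have "grid_set {} 0 {}" by (simp add: grid_set_def)
  then show "{} \<in> grid_sets" unfolding grid_sets_def
    by (intro CollectI conjI exI[of _ "{}"] exI[of _ 0]) simp_all
  fix A assume A: "A \<in> grid_sets"
  then obtain Q k where Q: "A \<in> sets ?M" "finite Q" "grid_set Q k A" by (rule grid_setsE)
  have "trajectories F - A \<in> sets ?M" using sets.compl_sets[OF Q(1)] unfolding sp .
  moreover have "grid_set Q k (trajectories F - A)"
    unfolding grid_set_def
  proof (intro ballI impI)
    fix x y assume xy: "x \<in> trajectories F" "y \<in> trajectories F" "\<forall>i<k. \<forall>q\<in>Q. (x i \<le> q) = (y i \<le> q)"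
    have "x \<in> A \<longleftrightarrow> y \<in> A" by (rule grid_setD[OF Q(3) xy(1,2)]) (rule xy(3)[rule_format])
    then show "(x \<in> trajectories F - A) = (y \<in> trajectories F - A)" using xy(1,2) by simp
  qed
  ultimately show "trajectories F - A \<in> grid_sets" by (rule grid_setsI[OF _ Q(2)])
  fix B assume B: "B \<in> grid_sets"
  then obtain R l where R: "B \<in> sets ?M" "finite R" "grid_set R l B" by (rule grid_setsE)
  have g: "grid_set (Q \<union> R) (max k l) A" "grid_set (Q \<union> R) (max k l) B"
    by (rule grid_set_mono[OF Q(3)], simp, simp) (rule grid_set_mono[OF R(3)], simp, simp)
  have "grid_set (Q \<union> R) (max k l) (A \<union> B)"
    unfolding grid_set_def
  proof (intro ballI impI)
    fix x y assume xy: "x \<in> trajectories F" "y \<in> trajectories F"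
      "\<forall>i<max k l. \<forall>q\<in>Q \<union> R. (x i \<le> q) = (y i \<le> q)"
    have "x \<in> A \<longleftrightarrow> y \<in> A" by (rule grid_setD[OF g(1) xy(1,2)]) (rule xy(3)[rule_format])
    moreover have "x \<in> B \<longleftrightarrow> y \<in> B" by (rule grid_setD[OF g(2) xy(1,2)]) (rule xy(3)[rule_format])
    ultimately
    show "(x \<in> A \<union> B) = (y \<in> A \<union> B)" by simp
  qed
  moreover have "A \<union> B \<in> sets ?M" using Q(1) R(1) by (rule sets.Un)
  moreover have "finite (Q \<union> R)" using Q(2) R(2) by simp
  ultimately show "A \<union> B \<in> grid_sets" by (intro grid_setsI)
qed

text \<open>Each \<open>{x. x i <= q}\<close> is a grid set with the single threshold
  \<open>q\<close>; so the coordinates, and with them the identity into the sequence space, are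
  measurable for the generated sigma-algebra.\<close>

lemma sets_grid_sets: "sets (borel_of_top (trajectory_space F)) = sigma_sets (trajectories F) grid_sets"
proof
  let ?M = "borel_of_top (trajectory_space F)"
  have sp: "space ?M = trajectories F" by (simp add: space_borel_of_top topspace_X)
  show "sigma_sets (trajectories F) grid_sets \<subseteq> sets ?M"
  proof -
    have "grid_sets \<subseteq> sets ?M" by (simp add: grid_sets_def Collect_conj_eq)
    from sets.sigma_sets_subset[OF this] show ?thesis unfolding sp .
  qed
  interpret algebra "trajectories F" grid_sets by (rule algebra_grid_sets)
  define N where "N = sigma (trajectories F) grid_sets"
  have N: "space N = trajectories F" "sets N = sigma_sets (trajectories F) grid_sets"
    unfolding N_def using space_closed by (auto intro: space_measure_of sets_measure_of)
  have "(\<lambda>x. x i) \<in> borel_measurable N" for i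
    unfolding borel_measurable_iff_le
  proof
    fix q
    have "{x \<in> space ?M. x i \<le> q} \<in> sets ?M"
      using coordinate_measurable[of i] unfolding borel_measurable_iff_le by blast
    moreover have "grid_set {q} (Suc i) {x \<in> space ?M. x i \<le> q}" by (simp add: grid_set_def sp)
    ultimately have "{x \<in> space ?M. x i \<le> q} \<in> grid_sets" unfolding grid_sets_def
      by (intro CollectI conjI exI[of _ "{q}"] exI[of _ "Suc i"]) simp_all
    then show "{w \<in> space N. w i \<le> q} \<in> sets N" unfolding N sp by (rule sigma_sets.Basic)
  qed
  then have id: "(\<lambda>x. x) \<in> borel_measurable N" by (rule measurable_coordinatewise_then_product)
  show "sets ?M \<subseteq> sigma_sets (trajectories F) grid_sets"
  proof
    fix B assume "B \<in> sets ?M"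
    then have "B \<in> (\<inter>) (trajectories F) ` sets borel" unfolding sets_X sets_restrict_space .
    then obtain V where V: "B = trajectories F \<inter> V" "V \<in> sets borel" by (rule imageE)
    have "(\<lambda>x. x) -` V \<inter> space N \<in> sets N" using measurable_sets[OF id V(2)] .
    moreover have "(\<lambda>x. x) -` V \<inter> space N = B" unfolding N V(1) by blast
    ultimately show "B \<in> sigma_sets (trajectories F) grid_sets" unfolding N by simp
  qed
qed

section \<open>Itineraries of trajectories with a common code\<close>

text \<open>A common code makes each earlier coordinate the image of \<open>x N\<close> under the
  same composition of inverse branches, and compositions of monotone maps are monotone. Hence the
  induction downwards from \<open>N\<close>.\<close>

lemma coordinates_monotone:
  assumes A: "A \<subseteq> trajectories F" "\<And>x j. x \<in> A \<Longrightarrow> j < N \<Longrightarrow> code x j = a j" and i: "i \<le> N"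
  shows "(\<forall>x\<in>A. \<forall>y\<in>A. x N \<le> y N \<longrightarrow> x i \<le> y i) \<or> (\<forall>x\<in>A. \<forall>y\<in>A. x N \<le> y N \<longrightarrow> y i \<le> x i)"
  using i
proof (induction rule: inc_induct)
  case base
  show ?case by simp
next
  case (step j)
  show ?case
  proof (cases "A = {}")
    case False
    then obtain x0 where "x0 \<in> A" by blast
    then have aj: "a j \<in> syms F" using A step(2) code_props(1)[of x0 j] by auto
    have h: "x (Suc j) \<in> srng F (a j)" "x j = finv F (a j) (x (Suc j))" if xA: "x \<in> A" for x
    proof -
      have xt: "x \<in> trajectories F" using xA A(1) by blast
      have c: "code x j = a j" using A(2)[OF xA step(2)] .
      show "x (Suc j) \<in> srng F (a j)" using code_props(2)[OF xt, of j] srng0_sub unfolding c by blast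
      show "x j = finv F (a j) (x (Suc j))" using code_props(3)[OF xt, of j] unfolding c .
    qed
    from finv_monotone[OF aj] show ?thesis
    proof
      assume m: "\<forall>y\<in>srng F (a j). \<forall>z\<in>srng F (a j). y \<le> z \<longrightarrow> finv F (a j) y \<le> finv F (a j) z"
      from step.IH show ?thesis
      proof
        assume i: "\<forall>x\<in>A. \<forall>y\<in>A. x N \<le> y N \<longrightarrow> x (Suc j) \<le> y (Suc j)"
        have "x j \<le> y j" if xy: "x \<in> A" "y \<in> A" "x N \<le> y N" for x y
          using m[rule_format, OF h(1)[OF xy(1)] h(1)[OF xy(2)] i[rule_format, OF xy]]
          unfolding h(2)[OF xy(1), symmetric] h(2)[OF xy(2), symmetric] .
        then show ?thesis by blast
      next
        assume i: "\<forall>x\<in>A. \<forall>y\<in>A. x N \<le> y N \<longrightarrow> y (Suc j) \<le> x (Suc j)"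
        have "y j \<le> x j" if xy: "x \<in> A" "y \<in> A" "x N \<le> y N" for x y
          using m[rule_format, OF h(1)[OF xy(2)] h(1)[OF xy(1)] i[rule_format, OF xy]]
          unfolding h(2)[OF xy(1), symmetric] h(2)[OF xy(2), symmetric] .
        then show ?thesis by blast
      qed
    next
      assume m: "\<forall>y\<in>srng F (a j). \<forall>z\<in>srng F (a j). y \<le> z \<longrightarrow> finv F (a j) z \<le> finv F (a j) y"
      from step.IH show ?thesis
      proof
        assume i: "\<forall>x\<in>A. \<forall>y\<in>A. x N \<le> y N \<longrightarrow> x (Suc j) \<le> y (Suc j)"
        have "y j \<le> x j" if xy: "x \<in> A" "y \<in> A" "x N \<le> y N" for x y
          using m[rule_format, OF h(1)[OF xy(1)] h(1)[OF xy(2)] i[rule_format, OF xy]]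
          unfolding h(2)[OF xy(1), symmetric] h(2)[OF xy(2), symmetric] .
        then show ?thesis by blast
      next
        assume i: "\<forall>x\<in>A. \<forall>y\<in>A. x N \<le> y N \<longrightarrow> y (Suc j) \<le> x (Suc j)"
        have "x j \<le> y j" if xy: "x \<in> A" "y \<in> A" "x N \<le> y N" for x y
          using m[rule_format, OF h(1)[OF xy(2)] h(1)[OF xy(1)] i[rule_format, OF xy]]
          unfolding h(2)[OF xy(1), symmetric] h(2)[OF xy(2), symmetric] .
        then show ?thesis by blast
      qed
    qed
  qed simp
qed

text \<open>A code word does not fix the position of a trajectory relative to the thresholds, so
  threshold patterns are counted within each code word. There the coordinates depend monotonically
  on the last one, and \<open>card_monotone_tuples\<close> leaves a number of patterns linear in the
  length.\<close>

lemma h_measure_le_words_X: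
  assumes inv: "invariant_prob (trajectory_space F) lshift \<mu>"
    and S: "S \<subseteq> trajectories F" "AE x in \<mu>. x \<in> S" and h: "h \<ge> 0"
    and growth: "exp_growth_le (\<lambda>n. card (words n (code ` S))) h"
  shows "h_measure \<mu> lshift \<le> ennreal h"
proof -
  have P: "prob_space \<mu>" and T: "lshift \<in> measurable \<mu> \<mu>" "distr \<mu> \<mu> lshift = \<mu>"
    and sp: "space \<mu> = trajectories F" and st: "sets \<mu> = sigma_sets (trajectories F) grid_sets"
    using inv by (auto simp: invariant_prob_def topspace_X sets_grid_sets)
  show ?thesis
  proof (rule h_measure_le[OF P T, of grid_sets S h])
    show "algebra (space \<mu>) grid_sets" unfolding sp by (rule algebra_grid_sets)
    show "sets \<mu> = sigma_sets (space \<mu>) grid_sets" unfolding sp by (rule st)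
    show "S \<subseteq> space \<mu>" unfolding sp by (rule S)
    fix B assume B: "finite B" "B \<subseteq> grid_sets"
    then have "\<forall>b\<in>B. \<exists>Qk. finite (fst Qk) \<and> grid_set (fst Qk) (snd Qk) b" by (auto simp: grid_sets_def)
    from bchoice[OF this] obtain Qk where Qk: "\<forall>b\<in>B. finite (fst (Qk b)) \<and> grid_set (fst (Qk b)) (snd (Qk b)) b"
      by (rule exE)
    define Q where "Q = (\<Union>b\<in>B. fst (Qk b))"
    have finQ: "finite Q" unfolding Q_def using B(1) Qk by blast
    obtain k where k: "\<And>b. b \<in> B \<Longrightarrow> snd (Qk b) \<le> k"
      using finite_nat_set_iff_bounded_le[of "(\<lambda>b. snd (Qk b)) ` B"] B(1) by auto
    have det: "grid_set Q k b" if "b \<in> B" for b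
      using Qk that k[OF that] by (intro grid_set_mono[of "fst (Qk b)" "snd (Qk b)" b Q k]) (auto simp: Q_def)
    have TS: "(lshift ^^ n) x \<in> trajectories F" if "x \<in> trajectories F" for n x
      using that trajectories_lshift by (induction n) auto
    define pos where "pos x i = {q \<in> Q. x i \<le> q}" for x :: "nat \<Rightarrow> real" and i :: nat
    define pat where "pat N x = map (pos x) [0..<N]" for N x
    have finpat: "finite (pat N ` A)" for N A
    proof (rule finite_subset)
      show "pat N ` A \<subseteq> {xs. set xs \<subseteq> Pow Q \<and> length xs = N}" by (auto simp: pat_def pos_def)
      show "finite {xs. set xs \<subseteq> Pow Q \<and> length xs = N}" using finQ by (intro finite_lists_length_eq) simp
    qed
    have finw: "finite (words N (code ` S))" for N
    proof (rule finite_subset[OF _ finite_lists_length_eq[OF fin, of N]])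
      show "words N (code ` S) \<subseteq> {xs. set xs \<subseteq> syms F \<and> length xs = N}"
      proof
        fix w assume "w \<in> words N (code ` S)"
        then obtain x where x: "x \<in> S" "w = map (code x) [0..<N]" by (auto simp: words_def)
        then have "code x n \<in> syms F" for n using S(1) code_props(1)[of x n] by blast
        then show "w \<in> {xs. set xs \<subseteq> syms F \<and> length xs = N}" using x(2) by auto
      qed
    qed
    have fiber: "card (pat N ` {x \<in> S. map (code x) [0..<N] = w}) \<le> N * card Q + 1" for N w
    proof -
      define A where "A = {x \<in> S. map (code x) [0..<N] = w}"
      have A: "A \<subseteq> trajectories F" using S(1) by (auto simp: A_def)
      have cA: "code x j = w ! j" if "x \<in> A" "j < N" for x j
        using that by (auto simp: A_def)
      \<comment> \<open>The sets of thresholds above a number are nested, so their cardinalities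
        identify them; this turns patterns into tuples of natural numbers.\<close>
      have inj: "U = V" if UV: "U = {q \<in> Q. s \<le> q}" "V = {q \<in> Q. u \<le> q}" "card U = card V" for U V and s u :: real
      proof (cases "s \<le> u")
        case True
        then have "V \<subseteq> U" using UV by auto
        then show ?thesis using UV finQ card_subset_eq[of U V] by simp
      next
        case False
        then have "U \<subseteq> V" using UV by auto
        then show ?thesis using UV finQ card_subset_eq[of V U] by simp
      qed
      have "card (pat N ` A) \<le> card ((\<lambda>x. map (\<lambda>i. card (pos x i)) [0..<N]) ` A)"
      proof (rule card_image_factor)
        have "(\<lambda>x. map (\<lambda>i. card (pos x i)) [0..<N]) ` A = map card ` pat N ` A"
          unfolding image_image by (intro image_cong refl) (simp add: pat_def)
        then show "finite ((\<lambda>x. map (\<lambda>i. card (pos x i)) [0..<N]) ` A)" using finpat by simp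
        fix x y assume "map (\<lambda>i. card (pos x i)) [0..<N] = map (\<lambda>i. card (pos y i)) [0..<N]"
        then have "card (pos x i) = card (pos y i)" if "i < N" for i using that by simp
        then have "pos x i = pos y i" if "i < N" for i
          using that inj[of "pos x i" "x i" "pos y i" "y i"] by (simp add: pos_def)
        then show "pat N x = pat N y" by (simp add: pat_def)
      qed
      also have "\<dots> \<le> N * card Q + 1"
      proof (rule card_monotone_tuples[where t = "\<lambda>x. x N"])
        show "card (pos x i) \<le> card Q" for i x unfolding pos_def using finQ by (intro card_mono) auto
        fix i assume i: "i < N"
        \<comment> \<open>Fewer thresholds lie above a larger coordinate, so the two directions of
          monotonicity are exchanged.\<close>
        have anti: "card (pos y i) \<le> card (pos x i)" if "x i \<le> y i" for x y
          unfolding pos_def using finQ that by (intro card_mono) auto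
        have "(\<forall>x\<in>A. \<forall>y\<in>A. x N \<le> y N \<longrightarrow> x i \<le> y i) \<or> (\<forall>x\<in>A. \<forall>y\<in>A. x N \<le> y N \<longrightarrow> y i \<le> x i)"
        proof (rule coordinates_monotone[where a = "(!) w", OF A])
          show "code x j = w ! j" if "x \<in> A" "j < N" for x j by (rule cA[OF that])
        qed (use i in simp)
        then show "(\<forall>x\<in>A. \<forall>y\<in>A. x N \<le> y N \<longrightarrow> card (pos x i) \<le> card (pos y i)) \<or>
          (\<forall>x\<in>A. \<forall>y\<in>A. x N \<le> y N \<longrightarrow> card (pos y i) \<le> card (pos x i))"
        proof
          assume m: "\<forall>x\<in>A. \<forall>y\<in>A. x N \<le> y N \<longrightarrow> x i \<le> y i"
          have "card (pos y i) \<le> card (pos x i)" if xy: "x \<in> A" "y \<in> A" "x N \<le> y N" for x y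
            by (rule anti) (rule m[rule_format, OF xy])
          then show ?thesis by (intro disjI2 ballI impI)
        next
          assume m: "\<forall>x\<in>A. \<forall>y\<in>A. x N \<le> y N \<longrightarrow> y i \<le> x i"
          have "card (pos x i) \<le> card (pos y i)" if xy: "x \<in> A" "y \<in> A" "x N \<le> y N" for x y
            by (rule anti) (rule m[rule_format, OF xy])
          then show ?thesis by (intro disjI1 ballI impI)
        qed
      qed
      finally show ?thesis by (simp add: A_def)
    qed
    have le: "card ((\<lambda>x. \<lambda>t\<in>{..<n}. {b \<in> B. (lshift ^^ t) x \<in> b}) ` S)
      \<le> card (words (n + k) (code ` S)) * ((n + k) * card Q + 1)" for n
    proof -
      have "card ((\<lambda>x. \<lambda>t\<in>{..<n}. {b \<in> B. (lshift ^^ t) x \<in> b}) ` S) \<le> card (pat (n + k) ` S)"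
      proof (rule card_image_factor[OF finpat])
        fix x y assume xy: "x \<in> S" "y \<in> S" "pat (n + k) x = pat (n + k) y"
        have eq: "pos x i = pos y i" if "i < n + k" for i using xy(3) that by (simp add: pat_def)
        show "(\<lambda>t\<in>{..<n}. {b \<in> B. (lshift ^^ t) x \<in> b}) = (\<lambda>t\<in>{..<n}. {b \<in> B. (lshift ^^ t) y \<in> b})"
        proof (rule restrict_ext)
          fix t assume t: "t \<in> {..<n}"
          have e: "(lshift ^^ t) x i \<le> q \<longleftrightarrow> (lshift ^^ t) y i \<le> q" if "i < k" "q \<in> Q" for i q
          proof -
            have "q \<in> pos x (i + t) \<longleftrightarrow> q \<in> pos y (i + t)" using eq[of "i + t"] t that by simp
            then show ?thesis using that by (simp add: pos_def lshift_funpow)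
          qed
          have xyt: "(lshift ^^ t) x \<in> trajectories F" "(lshift ^^ t) y \<in> trajectories F"
            using xy S(1) by (auto intro: TS)
          have "(lshift ^^ t) x \<in> b \<longleftrightarrow> (lshift ^^ t) y \<in> b" if "b \<in> B" for b
            by (rule grid_setD[OF det[OF that] xyt e])
          then show "{b \<in> B. (lshift ^^ t) x \<in> b} = {b \<in> B. (lshift ^^ t) y \<in> b}" by blast
        qed
      qed
      also have "pat (n + k) ` S = (\<Union>w\<in>words (n + k) (code ` S). pat (n + k) ` {x \<in> S. map (code x) [0..<n + k] = w})"
        unfolding words_def by blast
      also have "card \<dots> \<le> (\<Sum>w\<in>words (n + k) (code ` S). card (pat (n + k) ` {x \<in> S. map (code x) [0..<n + k] = w}))"
        by (rule card_UN_le[OF finw])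
      also have "\<dots> \<le> (\<Sum>w\<in>words (n + k) (code ` S). (n + k) * card Q + 1)"
        by (intro sum_mono fiber)
      finally show ?thesis by (simp only: sum_constant of_nat_id)
    qed
    \<comment> \<open>Chosen so that \<open>(n + k) * card Q + 1 <= K * (n + 1)\<close> for every
      \<open>n\<close>.\<close>
    define K where "K = real ((k + 1) * card Q + 1)"
    show "exp_growth_le (\<lambda>n. card ((\<lambda>x. \<lambda>t\<in>{..<n}. {b \<in> B. (lshift ^^ t) x \<in> b}) ` S)) h"
    proof (rule exp_growth_leI_poly[OF growth, where K = K and \<delta> = 0 and k = k, simplified])
      show "K \<ge> 0" by (simp add: K_def)
      show "\<forall>\<^sub>F n in sequentially. real (card ((\<lambda>x. \<lambda>t\<in>{..<n}. {b \<in> B. (lshift ^^ t) x \<in> b}) ` S))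
        \<le> K * (real n + 1) * real (card (words (n + k) (code ` S)))"
      proof (intro always_eventually allI)
        fix n
        have "(n + k) * card Q + 1 \<le> ((k + 1) * card Q + 1) * (n + 1)"
        proof -
          have "(n + k) * card Q \<le> ((k + 1) * (n + 1)) * card Q" by (intro mult_le_mono1) simp
          then show ?thesis by (simp add: algebra_simps)
        qed
        then have "card (words (n + k) (code ` S)) * ((n + k) * card Q + 1)
          \<le> card (words (n + k) (code ` S)) * (((k + 1) * card Q + 1) * (n + 1))"
          by (rule mult_le_mono2)
        with le[of n] have "card ((\<lambda>x. \<lambda>t\<in>{..<n}. {b \<in> B. (lshift ^^ t) x \<in> b}) ` S)
          \<le> ((k + 1) * card Q + 1) * (n + 1) * card (words (n + k) (code ` S))"
          by (simp only: mult_ac)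
        then have "real (card ((\<lambda>x. \<lambda>t\<in>{..<n}. {b \<in> B. (lshift ^^ t) x \<in> b}) ` S))
          \<le> real (((k + 1) * card Q + 1) * (n + 1) * card (words (n + k) (code ` S)))"
          by (rule of_nat_mono)
        then show "real (card ((\<lambda>x. \<lambda>t\<in>{..<n}. {b \<in> B. (lshift ^^ t) x \<in> b}) ` S))
          \<le> K * (real n + 1) * real (card (words (n + k) (code ` S)))"
          unfolding K_def by (simp only: of_nat_mult of_nat_add of_nat_1)
      qed
    qed
  qed (use S h in auto)
qed

section \<open>Existence of shadows and closedness of the shadow relation\<close>

lemma closed_step: "b \<in> syms F \<Longrightarrow> closed {x :: nat \<Rightarrow> real. (x n, x (Suc n)) \<in> graph_sym F b}"
  using closed_vimage[of "graph_sym F b" "\<lambda>x. (x n, x (Suc n))"] compact_graph_sym[of b]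
  by (simp add: vimage_def continuous_on_Pair continuous_on_product_coordinates compact_imp_closed)

text \<open>Built backwards in time: a point of \<open>D(a_1)\<close> lies in \<open>R(a_0)\<close>
  and is pulled back by the inverse branch. The condition on \<open>x 0\<close> is carried along to
  permit the next pull-back.\<close>

lemma finite_shadow:
  "a \<in> sft F \<Longrightarrow> \<exists>x. (\<forall>n. x n \<in> {0..1}) \<and> x 0 \<in> sdom F (a 0) \<and> (\<forall>n<N. (x n, x (Suc n)) \<in> graph_sym F (a n))"
proof (induction N arbitrary: a)
  case 0
  have s: "a 0 \<in> syms F" by (rule sftD(1)[OF 0])
  have "sdom F (a 0) \<noteq> {}"
  proof (cases "a 0 \<in> sym0 F")
    case True
    then show ?thesis by (rule sdom_sym0) simp
  next
    case False
    with s show ?thesis by (rule sdom_sym12) simp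
  qed
  then obtain t where t: "t \<in> sdom F (a 0)" by blast
  then have "t \<in> {0..1}" using sdom_01[OF s] by blast
  then show ?case using t by (intro exI[of _ "\<lambda>_. t"]) simp
next
  case (Suc N)
  have s: "a 0 \<in> syms F" "a 1 \<in> syms F" using sftD(1)[OF Suc.prems] by auto
  obtain x where x: "\<And>n. x n \<in> {0..1}" "x 0 \<in> sdom F (lshift a 0)"
    "\<And>n. n < N \<Longrightarrow> (x n, x (Suc n)) \<in> graph_sym F (lshift a n)"
    using Suc.IH[OF sft_lshift[OF Suc.prems, of 1]] by auto
  have "sdom F (a 1) \<subseteq> srng F (a 0)"
    by (rule sdom_subset_srng[OF s(2,1)]) (use sftD(2)[OF Suc.prems, of 0] in simp)
  then have r: "x 0 \<in> srng F (a 0)" using x(2) by (auto simp: lshift_def)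
  define t where "t = finv F (a 0) (x 0)"
  have g: "(t, x 0) \<in> graph_sym F (a 0)" unfolding graph_sym_iff[OF s(1)] t_def using r by simp
  have t: "t \<in> sdom F (a 0)" unfolding t_def by (rule finv_sdom[OF s(1) r])
  then have "t \<in> {0..1}" using sdom_01[OF s(1)] by blast
  show ?case
  proof (intro exI[of _ "\<lambda>n. case n of 0 \<Rightarrow> t | Suc m \<Rightarrow> x m"] conjI allI impI)
    fix n
    show "(case n of 0 \<Rightarrow> t | Suc m \<Rightarrow> x m) \<in> {0..1}"
      using x(1) \<open>t \<in> {0..1}\<close> by (cases n) simp_all
    show "(case n of 0 \<Rightarrow> t | Suc m \<Rightarrow> x m, case Suc n of 0 \<Rightarrow> t | Suc m \<Rightarrow> x m) \<in> graph_sym F (a n)"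
      if "n < Suc N"
      using g x(3)[of "n - 1"] that by (cases n) (simp_all add: lshift_def)
  qed (use t in simp)
qed

text \<open>The sequences of the cube that realize the first \<open>N\<close> steps form nested
  nonempty closed sets. This covers every point of the shift; goodness enters only when the code of
  the shadow matters.\<close>

lemma shadows_nonempty:
  assumes a: "a \<in> sft F"
  shows "\<exists>x. x \<in> shadows a"
proof -
  let ?Q = "{x :: nat \<Rightarrow> real. \<forall>n. x n \<in> {0..1}}"
  define C where "C N = ?Q \<inter> (\<Inter>n\<in>{..<N}. {x. (x n, x (Suc n)) \<in> graph_sym F (a n)})" for N
  have "(\<Inter>N. C N) \<noteq> {}"
  proof (rule compact_space_imp_nest[of "top_of_set ?Q" C])
    show "compact_space (top_of_set ?Q)"
      unfolding compact_space_def compactin_subtopology compactin_euclidean_iff using compact_cube by simp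
    show "closedin (top_of_set ?Q) (C N)" for N
      unfolding C_def closedin_closed
      by (intro exI[of _ "\<Inter>n\<in>{..<N}. {x. (x n, x (Suc n)) \<in> graph_sym F (a n)}"] conjI refl
        closed_INT ballI closed_step sftD(1)[OF a])
    show "C N \<noteq> {}" for N
      using finite_shadow[OF a, of N] unfolding C_def by auto
    show "decseq C" unfolding C_def decseq_def by auto
  qed
  then obtain x where x: "\<And>N. x \<in> C N" by blast
  have "(x n, x (Suc n)) \<in> graph_sym F (a n)" for n using x[of "Suc n"] by (simp add: C_def)
  then have "x \<in> shadows a" by (simp add: shadows_def)
  then show ?thesis by blast
qed

lemma symbolicI: "S \<subseteq> sft F \<Longrightarrow> symbolic F S"
  by unfold_locales (use fin sftD(1) in auto)

text \<open>A closed relation can be projected along a compact factor: along the symbolic space in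
  \<open>closedin_shadowed\<close>, along \<open>X\<close> in
  \<open>closedin_shadowed_le\<close>.\<close>

lemma closedin_shadow_relation:
  assumes S: "S \<subseteq> sft F"
  shows "closedin (prod_topology (trajectory_space F) (symbolic_space F S)) {(x, a). a \<in> S \<and> x \<in> shadows a}"
proof -
  interpret S: symbolic F S by (rule symbolicI[OF S])
  let ?P = "prod_topology (trajectory_space F) (symbolic_space F S)"
  let ?D = "\<lambda>n b. {x \<in> trajectories F. x \<in> {x. (x n, x (Suc n)) \<in> graph_sym F b}}"
  have "{(x, a). a \<in> S \<and> x \<in> shadows a} = (\<Inter>n. \<Union>b\<in>syms F. ?D n b \<times> {a \<in> S. a n = b})"
  proof (intro equalityI subsetI)
    fix p assume "p \<in> {(x, a). a \<in> S \<and> x \<in> shadows a}"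
    then obtain x a where p: "p = (x, a)" "a \<in> S" "x \<in> shadows a" by blast
    then have "a \<in> sft F" using S by blast
    then have x: "x \<in> trajectories F" and "\<And>n. a n \<in> syms F" using shadows_trajectories p(3) sftD(1) by blast+
    then show "p \<in> (\<Inter>n. \<Union>b\<in>syms F. ?D n b \<times> {a \<in> S. a n = b})"
      using p by (simp add: shadows_def)
  next
    fix p assume h: "p \<in> (\<Inter>n. \<Union>b\<in>syms F. ?D n b \<times> {a \<in> S. a n = b})"
    obtain x a where p: "p = (x, a)" by (cases p)
    have "a \<in> S \<and> (x n, x (Suc n)) \<in> graph_sym F (a n)" for n using h unfolding p by auto
    then show "p \<in> {(x, a). a \<in> S \<and> x \<in> shadows a}" unfolding p by (simp add: shadows_def)
  qed
  moreover have "closedin ?P (\<Inter>n. \<Union>b\<in>syms F. ?D n b \<times> {a \<in> S. a n = b})"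
  proof (rule closedin_INT)
    fix n :: nat
    show "closedin ?P (\<Union>b\<in>syms F. ?D n b \<times> {a \<in> S. a n = b})"
    proof (rule closedin_Union)
      show "finite ((\<lambda>b. ?D n b \<times> {a \<in> S. a n = b}) ` syms F)" using fin by simp
      fix T assume "T \<in> (\<lambda>b. ?D n b \<times> {a \<in> S. a n = b}) ` syms F"
      then obtain b where b: "b \<in> syms F" "T = ?D n b \<times> {a \<in> S. a n = b}" by blast
      show "closedin ?P T" unfolding b(2) closedin_prod_Times_iff
        using closedin_X[OF closed_step[OF b(1)]] S.closedin_clopens[OF S.letter_clopen] by blast
    qed
  qed simp
  ultimately show ?thesis by simp
qed

text \<open>These sets will serve as the \<open>Z b\<close> of \<open>limsup_words_le_h_top\<close>
  on \<open>X\<close>.\<close>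

lemma closedin_shadowed:
  assumes S: "S \<subseteq> sft F" and comp: "compact_space (symbolic_space F S)"
  shows "closedin (trajectory_space F) {x. \<exists>a\<in>S. a 0 = b \<and> x \<in> shadows a}"
proof -
  interpret S: symbolic F S by (rule symbolicI[OF S])
  let ?P = "prod_topology (trajectory_space F) (symbolic_space F S)"
  let ?R = "{(x, a). a \<in> S \<and> x \<in> shadows a} \<inter> (trajectories F \<times> {a \<in> S. a 0 = b})"
  have "closedin ?P (trajectories F \<times> {a \<in> S. a 0 = b})"
    unfolding closedin_prod_Times_iff
    using closedin_topspace[of "trajectory_space F"] S.closedin_clopens[OF S.letter_clopen] unfolding topspace_X by blast
  then have "closedin ?P ?R" by (intro closedin_Int closedin_shadow_relation[OF S])
  then have "closedin (trajectory_space F) (fst ` ?R)"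
    using closed_map_fst[OF comp] unfolding closed_map_def by blast
  moreover have "fst ` ?R = {x. \<exists>a\<in>S. a 0 = b \<and> x \<in> shadows a}"
  proof (intro equalityI subsetI)
    fix x assume "x \<in> {x. \<exists>a\<in>S. a 0 = b \<and> x \<in> shadows a}"
    then obtain a where a: "a \<in> S" "a 0 = b" "x \<in> shadows a" by blast
    then have "x \<in> trajectories F" using S shadows_trajectories by blast
    then have "(x, a) \<in> ?R" using a by simp
    then show "x \<in> fst ` ?R" by force
  qed auto
  ultimately show ?thesis by simp
qed

lemma compact_sft: "compact_space (symbolic_space F (sft F))"
proof -
  interpret S: symbolic F "sft F" by (rule symbolicI) simp
  show ?thesis
  proof (rule S.compactI)
    fix x assume x: "\<And>n. x n \<in> syms F" "x \<notin> sft F"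
    then obtain n where n: "(x n, x (Suc n)) \<notin> edges F (syms F)" by (auto simp: sft_eq_walks walks_def)
    have "y \<notin> sft F" if "\<forall>i<Suc (Suc n). y i = x i" for y
      using n that unfolding sft_eq_walks walks_def by (metis (mono_tags, lifting) lessI less_Suc_eq mem_Collect_eq)
    then show "\<exists>k. \<forall>y. (\<forall>i<k. y i = x i) \<longrightarrow> y \<notin> sft F" by blast
  qed
qed

lemma tds_sft: "tds (symbolic_space F (sft F)) lshift"
proof -
  interpret S: symbolic F "sft F" by (rule symbolicI) simp
  show ?thesis unfolding tds_def
    using compact_sft S.metrizable S.continuous_lshift sft_lshift[of _ 1] by simp
qed

text \<open>Where the shadow is unique, this is a sublevel set of its \<open>i\<close>-th
  coordinate; in this way the inverse of the coding will be seen to be Borel.\<close>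

lemma closedin_shadowed_le:
  "closedin (symbolic_space F (sft F)) {a \<in> sft F. \<exists>x\<in>shadows a. x i \<le> q}"
proof -
  interpret S: symbolic F "sft F" by (rule symbolicI) simp
  let ?P = "prod_topology (trajectory_space F) (symbolic_space F (sft F))"
  let ?D = "{x \<in> trajectories F. x \<in> {x. x i \<le> q}}"
  let ?R = "{(x, a). a \<in> sft F \<and> x \<in> shadows a} \<inter> (?D \<times> sft F)"
  have "closed {x :: nat \<Rightarrow> real. x i \<le> q}"
    by (intro closed_Collect_le continuous_on_product_coordinates continuous_on_const)
  then have "closedin ?P (?D \<times> sft F)"
    unfolding closedin_prod_Times_iff
    using closedin_X closedin_topspace[of "symbolic_space F (sft F)"] unfolding S.topspace by blast
  then have "closedin ?P ?R" by (intro closedin_Int closedin_shadow_relation) simp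
  then have "closedin (symbolic_space F (sft F)) (snd ` ?R)"
    using closed_map_snd[OF compact_X] unfolding closed_map_def by blast
  moreover have "snd ` ?R = {a \<in> sft F. \<exists>x\<in>shadows a. x i \<le> q}"
  proof (intro equalityI subsetI)
    fix a assume "a \<in> {a \<in> sft F. \<exists>x\<in>shadows a. x i \<le> q}"
    then obtain x where a: "a \<in> sft F" "x \<in> shadows a" "x i \<le> q" by blast
    then have "x \<in> trajectories F" using shadows_trajectories by blast
    then have "(x, a) \<in> ?R" using a by simp
    then show "a \<in> snd ` ?R" by force
  qed auto
  ultimately show ?thesis by simp
qed

section \<open>Measurability of the coding and of recurrence conditions\<close>

lemma code_letter_sets: "{x \<in> trajectories F. code x n = b} \<in> sets (borel_of_top (trajectory_space F))"
proof (cases "b \<in> syms F")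
  case False
  then have e: "{x \<in> trajectories F. code x n = b} = {}" using code_props(1) by blast
  show ?thesis unfolding e by (rule sets.empty_sets)
next
  case True
  let ?M = "borel_of_top (trajectory_space F)"
  have sp: "space ?M = trajectories F" by (simp add: space_borel_of_top topspace_X)
  \<comment> \<open>\<open>G_0(b)\<close> need not be closed, but it is the closed graph
    \<open>G(b)\<close> cut down by a Borel condition on the later coordinate.\<close>
  have iff: "code x n = b \<longleftrightarrow> (x n, x (Suc n)) \<in> graph_sym F b \<and> x (Suc n) \<in> srng0 F b" if x: "x \<in> trajectories F" for x
  proof
    assume c: "code x n = b"
    show "(x n, x (Suc n)) \<in> graph_sym F b \<and> x (Suc n) \<in> srng0 F b"
      using code_props(2,3)[OF x, of n] srng0_sub unfolding c graph_sym_iff[OF True] by blast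
  next
    assume h: "(x n, x (Suc n)) \<in> graph_sym F b \<and> x (Suc n) \<in> srng0 F b"
    then have "(x n, x (Suc n)) \<in> graph0_sym F b"
      unfolding graph0_sym_iff[OF True] graph_sym_iff[OF True] by blast
    then show "code x n = b" by (rule code_unique[OF x True])
  qed
  have "{x \<in> trajectories F. x \<in> {x. (x n, x (Suc n)) \<in> graph_sym F b}} \<in> sets ?M"
  proof -
    have "openin (trajectory_space F) (trajectories F - {x \<in> trajectories F. x \<in> {x. (x n, x (Suc n)) \<in> graph_sym F b}})"
      using closedin_X[OF closed_step[OF True, of n]] unfolding closedin_def topspace_X by blast
    then have "trajectories F - {x \<in> trajectories F. x \<in> {x. (x n, x (Suc n)) \<in> graph_sym F b}} \<in> sets ?M"
      unfolding sets_borel_of_top by blast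
    from sets.compl_sets[OF this] show ?thesis unfolding sp by (simp add: double_diff)
  qed
  moreover have "srng0 F b \<in> sets borel" by (rule srng_cases[OF True]) simp_all
  then have "(\<lambda>x. x (Suc n)) -` srng0 F b \<inter> space ?M \<in> sets ?M"
    by (rule measurable_sets[OF coordinate_measurable])
  ultimately have "{x \<in> trajectories F. x \<in> {x. (x n, x (Suc n)) \<in> graph_sym F b}} \<inter>
      ((\<lambda>x. x (Suc n)) -` srng0 F b \<inter> space ?M) \<in> sets ?M"
    by (rule sets.Int)
  moreover have "{x \<in> trajectories F. x \<in> {x. (x n, x (Suc n)) \<in> graph_sym F b}} \<inter>
      ((\<lambda>x. x (Suc n)) -` srng0 F b \<inter> space ?M) = {x \<in> trajectories F. code x n = b}"
    unfolding sp using iff by auto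
  ultimately show ?thesis by simp
qed

lemma code_measurable:
  "code \<in> measurable (borel_of_top (trajectory_space F)) (borel_of_top (symbolic_space F (sft F)))"
proof -
  interpret S: symbolic F "sft F" by (rule symbolicI) simp
  let ?M = "borel_of_top (trajectory_space F)" and ?N = "borel_of_top (symbolic_space F (sft F))"
  have sp: "space ?M = trajectories F" by (simp add: space_borel_of_top topspace_X)
  show ?thesis
  proof (rule measurable_sigma_sets[of ?N "sft F" S.clopens])
    show "sets ?N = sigma_sets (sft F) S.clopens" by (rule S.sets_symbolic)
    show "S.clopens \<subseteq> Pow (sft F)" by (auto simp: S.clopens_def)
    show "code \<in> space ?M \<rightarrow> sft F" unfolding sp using code_sft by blast
    fix B assume "B \<in> S.clopens"
    then obtain k where k: "B \<subseteq> sft F" "S.determined k B" by (auto simp: S.clopens_def)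
    have "code -` B \<inter> space ?M = (\<Union>w\<in>words k B. (\<Inter>i\<in>{..<k}. {x \<in> trajectories F. code x i = w ! i}) \<inter> space ?M)"
    proof (intro equalityI subsetI)
      fix x assume x: "x \<in> code -` B \<inter> space ?M"
      then have "map (code x) [0..<k] \<in> words k B" by (auto simp: words_def)
      moreover have "x \<in> (\<Inter>i\<in>{..<k}. {x \<in> trajectories F. code x i = map (code x) [0..<k] ! i}) \<inter> space ?M"
        using x by (simp add: sp)
      ultimately show "x \<in> (\<Union>w\<in>words k B. (\<Inter>i\<in>{..<k}. {x \<in> trajectories F. code x i = w ! i}) \<inter> space ?M)"
        by blast
    next
      fix x assume "x \<in> (\<Union>w\<in>words k B. (\<Inter>i\<in>{..<k}. {x \<in> trajectories F. code x i = w ! i}) \<inter> space ?M)"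
      then obtain w where w: "w \<in> words k B" "x \<in> space ?M" "\<And>i. i < k \<Longrightarrow> code x i = w ! i" by auto
      then obtain a where a: "a \<in> B" "w = map a [0..<k]" by (auto simp: words_def)
      have "code x i = a i" if "i < k" for i using w(3)[OF that] a(2) that by simp
      moreover have "code x \<in> sft F" using w(2) code_sft unfolding sp by blast
      ultimately have "code x \<in> B" using k a(1) unfolding S.determined_def by (metis subsetD)
      then show "x \<in> code -` B \<inter> space ?M" using w(2) by blast
    qed
    moreover have "(\<Inter>i\<in>{..<k}. {x \<in> trajectories F. code x i = w ! i}) \<inter> space ?M \<in> sets ?M" for w
    proof (cases "k = 0")
      case False
      then have "(\<Inter>i\<in>{..<k}. {x \<in> trajectories F. code x i = w ! i}) \<in> sets ?M"
        by (intro sets.finite_INT code_letter_sets) auto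
      then show ?thesis by (intro sets.Int sets.top)
    qed simp
    moreover have "finite (words k B)"
      by (rule finite_subset[OF _ S.finite_words[of k]]) (use k(1) in \<open>auto simp: words_def\<close>)
    ultimately show "code -` B \<inter> space ?M \<in> sets ?M" by (simp only:) (intro sets.finite_UN)
  qed
qed

lemma mem_cylinder_iff: "a \<in> sft F \<Longrightarrow> (lshift ^^ n) a \<in> cylinder F w \<longleftrightarrow> (\<forall>i<length w. a (n + i) = w ! i)"
  using sft_lshift[of a n] by (simp add: cylinder_def lshift_funpow add.commute)

lemma frequently_cylinder_sets:
  "{a \<in> sft F. infinite {n. (lshift ^^ n) a \<in> cylinder F w}} \<in> sets (borel_of_top (symbolic_space F (sft F)))"
proof -
  interpret S: symbolic F "sft F" by (rule symbolicI) simp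
  let ?V = "\<lambda>n. {a \<in> sft F. (lshift ^^ n) a \<in> cylinder F w}"
  have "?V n \<in> S.clopens" for n
  proof -
    have "S.determined (n + length w) (?V n)" unfolding S.determined_def
    proof (intro ballI impI)
      fix x y assume xy: "x \<in> sft F" "y \<in> sft F" "\<forall>i<n + length w. x i = y i"
      then show "x \<in> ?V n \<longleftrightarrow> y \<in> ?V n" by (simp add: mem_cylinder_iff)
    qed
    then show ?thesis by (auto simp: S.clopens_def)
  qed
  then have V: "?V n \<in> sets (borel_of_top (symbolic_space F (sft F)))" for n
    unfolding S.sets_symbolic by (rule sigma_sets.Basic)
  have "{a \<in> sft F. infinite {n. (lshift ^^ n) a \<in> cylinder F w}} = (\<Inter>m. \<Union>n\<in>{m..}. ?V n)"
    by (auto simp: infinite_Collect_nat_iff)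
  moreover have "(\<Inter>m. \<Union>n\<in>{m..}. ?V n) \<in> sets (borel_of_top (symbolic_space F (sft F)))"
    using V by (intro sets.countable_INT sets.countable_UN') auto
  ultimately show ?thesis by simp
qed

lemma sft_restr_sets: "sft_restr F C \<in> sets (borel_of_top (symbolic_space F (sft F)))"
proof -
  interpret S: symbolic F "sft F" by (rule symbolicI) simp
  have "{a \<in> sft F. a n \<in> C} \<in> S.clopens" for n
  proof -
    have "S.determined (Suc n) {a \<in> sft F. a n \<in> C}" by (simp add: S.determined_def)
    then show ?thesis by (auto simp: S.clopens_def)
  qed
  then have V: "{a \<in> sft F. a n \<in> C} \<in> sets (borel_of_top (symbolic_space F (sft F)))" for n
    unfolding S.sets_symbolic by (rule sigma_sets.Basic)
  have "sft_restr F C = (\<Inter>n. {a \<in> sft F. a n \<in> C})" by (auto simp: sft_restr_def)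
  moreover have "(\<Inter>n. {a \<in> sft F. a n \<in> C}) \<in> sets (borel_of_top (symbolic_space F (sft F)))"
    using V by (intro sets.countable_INT) auto
  ultimately show ?thesis by simp
qed

end

section \<open>Entropy conjugacy\<close>

lemma language_restr_path:
  assumes "w \<in> language_restr F C"
  shows "is_path (edges F C) w" "w \<noteq> []" "set w \<subseteq> C"
proof -
  have w: "w \<noteq> []" "set w \<subseteq> C" "\<And>i. Suc i < length w \<Longrightarrow> trans_mat F (w ! i) (w ! Suc i) = 1"
    using assms by (auto simp: language_restr_def language_def)
  have "(w ! i, w ! Suc i) \<in> edges F C" if "Suc i < length w" for i
  proof -
    have "w ! i \<in> C" "w ! Suc i \<in> C" using w(2) that by auto
    then show ?thesis using w(3)[OF that] by (simp add: edges_def)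
  qed
  then show "is_path (edges F C) w" by (simp add: successively_conv_nth)
  show "w \<noteq> []" "set w \<subseteq> C" by (rule w)+
qed

lemma words_mono: "S \<subseteq> S' \<Longrightarrow> words n S \<subseteq> words n S'"
  by (auto simp: words_def)

section \<open>Anchors, good points and their unique shadows\<close>

locale markov_F = markov F for F :: "'a markov_tuple" +
  assumes coding: "\<And>C. irreducible_component F C \<Longrightarrow> positive_entropy F C \<Longrightarrow> \<exists>u. coding_word F C u"
    and avoiding: "\<And>C. irreducible_component F C \<Longrightarrow> positive_entropy F C \<Longrightarrow> C \<subseteq> sym0 F \<Longrightarrow> \<exists>u. avoiding_word F C u"
    and pos: "h_top (symbolic_space F (sft F)) lshift > 0"
begin

lemma finite_syms: "finite (syms F)"
  by (rule fin)

definition comps :: "'a set set" where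
  "comps = {C. irreducible_component F C \<and> positive_entropy F C}"

lemma comps_syms: "C \<in> comps \<Longrightarrow> C \<subseteq> syms F"
  by (simp add: comps_def irreducible_component_iff)

lemma finite_comps: "finite comps"
  by (rule finite_subset[of _ "Pow (syms F)"]) (use comps_syms fin in auto)

text \<open>A trajectory shadowing a point of \<open>[v]\<close>, \<open>v\<close> an anchor, cannot sit at an end point of
  \<open>D(v\<^sub>0)\<close>: an avoiding word is an anchor, and so is every symbol outside \<open>\<A>\<^sub>0\<close>.\<close>

definition anchor :: "'a set \<Rightarrow> 'a list \<Rightarrow> bool" where
  "anchor C v \<longleftrightarrow> v \<in> language_restr F C \<and> (\<forall>a\<in>cylinder F v. \<forall>x\<in>shadows a. x 0 \<in> sdom0 F (a 0))"

lemma anchor_exists: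
  assumes C: "C \<in> comps"
  shows "\<exists>v. anchor C v"
proof (cases "C \<subseteq> sym0 F")
  case True
  then obtain v where v: "avoiding_word F C v" using avoiding C by (auto simp: comps_def)
  have "x 0 \<in> sdom0 F (a 0)" if a: "a \<in> cylinder F v" and x: "x \<in> shadows a" for a x
  proof -
    have s: "a \<in> sft F" using a by (simp add: cylinder_def)
    have "x 0 \<in> point_interval F a" by (rule shadows_point_interval[OF s x])
    moreover have "point_interval F a \<inter> pts F = {}" using v a by (simp add: avoiding_word_def)
    ultimately have "x 0 \<notin> pts F" by blast
    then show ?thesis using sdom0_or_pts[OF sftD(1)[OF s] shadows_sdom[OF s x]] by blast
  qed
  then show ?thesis using v by (auto simp: anchor_def avoiding_word_def)
next
  case False
  \<comment> \<open>For such a symbol \<open>D_0\<close> is all of \<open>D\<close>, so the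
    one-letter word is an anchor.\<close>
  then obtain s where s: "s \<in> C" "s \<notin> sym0 F" by blast
  have "x 0 \<in> sdom0 F (a 0)" if a: "a \<in> cylinder F [s]" and x: "x \<in> shadows a" for a x
  proof -
    have st: "a \<in> sft F" "a 0 = s" using a by (simp_all add: cylinder_def)
    then show ?thesis using sdom0_or_pts[OF sftD(1)[OF st(1)] shadows_sdom[OF st(1) x], of 0] s(2) by simp
  qed
  moreover have "[s] \<in> language_restr F C"
    using s comps_syms[OF C] by (auto simp: language_restr_def language_def)
  ultimately show ?thesis by (auto simp: anchor_def)
qed

definition coding_word_of :: "'a set \<Rightarrow> 'a list" where "coding_word_of C = (SOME u. coding_word F C u)"
definition anchor_of :: "'a set \<Rightarrow> 'a list" where "anchor_of C = (SOME v. anchor C v)"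

lemma coding_word_of: "C \<in> comps \<Longrightarrow> coding_word F C (coding_word_of C)"
  unfolding coding_word_of_def by (rule someI_ex) (simp add: comps_def coding)

lemma anchor_of: "C \<in> comps \<Longrightarrow> anchor C (anchor_of C)"
  unfolding anchor_of_def by (rule someI_ex) (rule anchor_exists)

abbreviation frequently :: "'a list \<Rightarrow> (nat \<Rightarrow> 'a) \<Rightarrow> bool" where
  "frequently w a \<equiv> infinite {n. (lshift ^^ n) a \<in> cylinder F w}"

text \<open>Both recurrence conditions ignore finite prefixes, so the set is mapped into itself by
  the shift, as the domain of a conjugacy must be.\<close>

definition good :: "(nat \<Rightarrow> 'a) set" where
  "good = (\<Union>C\<in>comps. {a \<in> sft_restr F C. frequently (coding_word_of C) a \<and> frequently (anchor_of C) a})"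

lemma sft_restr_sub: "sft_restr F C \<subseteq> sft F"
  by (auto simp: sft_restr_def)

lemma good_sft: "good \<subseteq> sft F"
  using sft_restr_sub by (auto simp: good_def)

lemma good_sets: "good \<in> sets (borel_of_top (symbolic_space F (sft F)))"
proof -
  let ?M = "borel_of_top (symbolic_space F (sft F))"
  have "good = (\<Union>C\<in>comps. sft_restr F C \<inter> {a \<in> sft F. frequently (coding_word_of C) a} \<inter> {a \<in> sft F. frequently (anchor_of C) a})"
    using sft_restr_sub by (auto simp: good_def)
  also have "\<dots> \<in> sets ?M"
    by (intro sets.finite_UN finite_comps sets.Int sft_restr_sets frequently_cylinder_sets)
  finally show ?thesis .
qed

lemma frequently_lshift: "frequently w ((lshift ^^ m) a) \<longleftrightarrow> frequently w a"
proof -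
  have e: "(lshift ^^ n) ((lshift ^^ m) a) = (lshift ^^ (n + m)) a" for n by (simp add: funpow_add)
  show ?thesis unfolding infinite_Collect_nat_iff e
  proof
    assume h: "\<forall>k. \<exists>n\<ge>k. (lshift ^^ (n + m)) a \<in> cylinder F w"
    show "\<forall>k. \<exists>n\<ge>k. (lshift ^^ n) a \<in> cylinder F w"
    proof
      fix k
      obtain n where "n \<ge> k" "(lshift ^^ (n + m)) a \<in> cylinder F w" using h by blast
      then show "\<exists>n\<ge>k. (lshift ^^ n) a \<in> cylinder F w" by (intro exI[of _ "n + m"]) simp
    qed
  next
    assume h: "\<forall>k. \<exists>n\<ge>k. (lshift ^^ n) a \<in> cylinder F w"
    show "\<forall>k. \<exists>n\<ge>k. (lshift ^^ (n + m)) a \<in> cylinder F w"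
    proof
      fix k
      obtain n where n: "n \<ge> k + m" "(lshift ^^ n) a \<in> cylinder F w" using h by blast
      then show "\<exists>n\<ge>k. (lshift ^^ (n + m)) a \<in> cylinder F w" by (intro exI[of _ "n - m"]) simp
    qed
  qed
qed

lemma sft_restr_lshift: "a \<in> sft_restr F C \<Longrightarrow> (lshift ^^ n) a \<in> sft_restr F C"
  using sft_lshift[of a n] by (simp add: sft_restr_def lshift_funpow)

lemma goodE:
  assumes "a \<in> good"
  obtains C where "C \<in> comps" "a \<in> sft_restr F C" "frequently (coding_word_of C) a" "frequently (anchor_of C) a"
proof -
  have "\<exists>C\<in>comps. a \<in> {a \<in> sft_restr F C. frequently (coding_word_of C) a \<and> frequently (anchor_of C) a}"
    using assms unfolding good_def by (simp only: UN_iff)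
  then show ?thesis by (elim bexE CollectE conjE) (rule that)
qed

lemma goodI:
  assumes "C \<in> comps" "a \<in> sft_restr F C" "frequently (coding_word_of C) a" "frequently (anchor_of C) a"
  shows "a \<in> good"
  unfolding good_def by (rule UN_I[OF assms(1)]) (intro CollectI conjI assms)

lemma good_lshift:
  assumes "a \<in> good" shows "(lshift ^^ n) a \<in> good"
proof -
  obtain C where C: "C \<in> comps" "a \<in> sft_restr F C" "frequently (coding_word_of C) a" "frequently (anchor_of C) a"
    using assms by (rule goodE)
  show ?thesis
    by (rule goodI[OF C(1) sft_restr_lshift[OF C(2)]]) (simp_all only: frequently_lshift C(3,4) not_False_eq_True)
qed

text \<open>Each visit to the anchor places the shadow in \<open>D_0\<close> of the current symbol,
  and \<open>code_eqI\<close> transports this back to all earlier times.\<close>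

lemma code_eq_of_frequently:
  assumes a: "a \<in> sft F" and v: "anchor C v" "frequently v a" and x: "x \<in> shadows a"
  shows "code x = a"
proof (rule code_eqI[OF a x])
  have "{n. (lshift ^^ n) a \<in> cylinder F v} \<subseteq> {n. x n \<in> sdom0 F (a n)}"
  proof (intro subsetI CollectI)
    fix n assume "n \<in> {n. (lshift ^^ n) a \<in> cylinder F v}"
    then have "(lshift ^^ n) x 0 \<in> sdom0 F ((lshift ^^ n) a 0)"
      using v(1) shadows_lshift[OF x, of n] by (simp add: anchor_def)
    then show "x n \<in> sdom0 F (a n)" by (simp add: lshift_funpow)
  qed
  then show "infinite {n. x n \<in> sdom0 F (a n)}" using v(2) by (rule infinite_super)
qed

lemma good_shadow_code:
  assumes "a \<in> good" "x \<in> shadows a"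
  shows "code x = a"
proof -
  obtain C where C: "C \<in> comps" "frequently (anchor_of C) a" using assms(1) by (rule goodE) (rule that)
  show ?thesis
    by (rule code_eq_of_frequently[OF _ anchor_of[OF C(1)] C(2) assms(2)]) (use good_sft assms(1) in blast)
qed

text \<open>A singleton interval determines only the first coordinate of a shadow. Every shifted
  point of the component still visits the coding word infinitely often, and this determines all the
  other coordinates.\<close>

lemma good_shadow_unique:
  assumes a: "a \<in> good" and x: "x \<in> shadows a" and y: "y \<in> shadows a"
  shows "x = y"
proof
  fix n
  obtain C where C: "C \<in> comps" "a \<in> sft_restr F C" "frequently (coding_word_of C) a" using a by (rule goodE) (rule that)
  let ?b = "(lshift ^^ n) a"
  have b: "?b \<in> sft_restr F C" "frequently (coding_word_of C) ?b"
    using sft_restr_lshift[OF C(2)] C(3) by (simp_all only: frequently_lshift not_False_eq_True)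
  have "is_singleton (point_interval F ?b)"
    using coding_word_of[OF C(1)] b unfolding coding_word_def by blast
  then obtain t where t: "point_interval F ?b = {t}" by (rule is_singletonE)
  have s: "?b \<in> sft F" using b(1) sft_restr_sub by blast
  have "(lshift ^^ n) x 0 = t" "(lshift ^^ n) y 0 = t"
    using shadows_point_interval[OF s shadows_lshift[OF x]] shadows_point_interval[OF s shadows_lshift[OF y]]
    unfolding t by simp_all
  then show "x n = y n" by (simp add: lshift_funpow)
qed

section \<open>The coding restricted to good points\<close>

definition goodX :: "(nat \<Rightarrow> real) set" where
  "goodX = {x \<in> trajectories F. code x \<in> good}"

lemma goodX_sets: "goodX \<in> sets (borel_of_top (trajectory_space F))"
proof -
  have "code -` good \<inter> space (borel_of_top (trajectory_space F)) \<in> sets (borel_of_top (trajectory_space F))"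
    by (rule measurable_sets[OF code_measurable good_sets])
  moreover have "code -` good \<inter> space (borel_of_top (trajectory_space F)) = goodX"
    by (auto simp: goodX_def space_borel_of_top topspace_X)
  ultimately show ?thesis by simp
qed

text \<open>Injective, because each trajectory shadows its own code and a good code has one shadow;
  onto, because every point has a shadow and the shadows of a good point have that point as
  code.\<close>

lemma bij_code: "bij_betw code goodX good"
  unfolding bij_betw_def
proof
  show "inj_on code goodX"
  proof (rule inj_onI)
    fix x y assume xy: "x \<in> goodX" "y \<in> goodX" "code x = code y"
    then have g: "code x \<in> good" "x \<in> trajectories F" "y \<in> trajectories F" by (simp_all add: goodX_def)
    show "x = y" using good_shadow_unique[OF g(1) shadows_code[OF g(2)]] shadows_code[OF g(3)] xy(3) by simp
  qed
  show "code ` goodX = good"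
  proof (intro equalityI subsetI)
    fix a assume a: "a \<in> good"
    then have s: "a \<in> sft F" using good_sft by blast
    obtain x where x: "x \<in> shadows a" using shadows_nonempty[OF s] by blast
    have "code x = a" by (rule good_shadow_code[OF a x])
    moreover have "x \<in> trajectories F" using shadows_trajectories[OF s] x by blast
    ultimately show "a \<in> code ` goodX" using a by (force simp: goodX_def)
  qed (auto simp: goodX_def)
qed

lemma inv_code_shadow:
  assumes a: "a \<in> good"
  shows "inv_into goodX code a \<in> shadows a" "inv_into goodX code a \<in> goodX"
proof -
  have m: "a \<in> code ` goodX" using bij_code a by (simp add: bij_betw_def)
  show g: "inv_into goodX code a \<in> goodX" by (rule inv_into_into[OF m])
  then show "inv_into goodX code a \<in> shadows a"
    using shadows_code[of "inv_into goodX code a"] f_inv_into_f[OF m] by (simp add: goodX_def)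
qed

text \<open>By uniqueness the preimage of \<open>a\<close> is its only shadow, so bounding its
  \<open>i\<close>-th coordinate by \<open>q\<close> amounts to the existence of a shadow with this
  bound, which is a closed condition on \<open>a\<close>.\<close>

lemma inv_code_measurable:
  "inv_into goodX code \<in> measurable (restrict_space (borel_of_top (symbolic_space F (sft F))) good)
     (restrict_space (borel_of_top (trajectory_space F)) goodX)"
proof -
  interpret S: symbolic F "sft F" by (rule symbolicI) simp
  let ?N = "borel_of_top (symbolic_space F (sft F))"
  let ?R = "restrict_space ?N good"
  have spN: "space ?N = sft F" by (simp add: space_borel_of_top S.topspace)
  have spR: "space ?R = good" using good_sft by (simp add: space_restrict_space spN Int_absorb2)
  have "(\<lambda>a. inv_into goodX code a i) \<in> borel_measurable ?R" for i
    unfolding borel_measurable_iff_le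
  proof
    fix q
    let ?A = "{a \<in> sft F. \<exists>x\<in>shadows a. x i \<le> q}"
    have "openin (symbolic_space F (sft F)) (sft F - ?A)"
      using closedin_shadowed_le[of i q] unfolding closedin_def S.topspace by blast
    then have "sft F - ?A \<in> sets ?N" unfolding sets_borel_of_top by blast
    from sets.compl_sets[OF this] have "?A \<in> sets ?N" unfolding spN by (simp add: double_diff)
    moreover have "{a \<in> space ?R. inv_into goodX code a i \<le> q} = good \<inter> ?A"
    proof (intro equalityI subsetI)
      fix a assume "a \<in> {a \<in> space ?R. inv_into goodX code a i \<le> q}"
      then have a: "a \<in> good" "inv_into goodX code a i \<le> q" by (simp_all add: spR)
      then show "a \<in> good \<inter> ?A" using inv_code_shadow(1)[OF a(1)] good_sft by blast
    next
      fix a assume "a \<in> good \<inter> ?A"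
      then obtain x where a: "a \<in> good" "x \<in> shadows a" "x i \<le> q" by blast
      have "x = inv_into goodX code a" by (rule good_shadow_unique[OF a(1,2) inv_code_shadow(1)[OF a(1)]])
      then show "a \<in> {a \<in> space ?R. inv_into goodX code a i \<le> q}" using a by (simp add: spR)
    qed
    ultimately show "{a \<in> space ?R. inv_into goodX code a i \<le> q} \<in> sets ?R"
      unfolding sets_restrict_space by (simp only:) (rule imageI)
  qed
  then have b: "inv_into goodX code \<in> borel_measurable ?R" by (rule measurable_coordinatewise_then_product)
  have "inv_into goodX code \<in> measurable ?R (restrict_space borel (trajectories F))"
    by (rule measurable_restrict_space2[OF _ b]) (use inv_code_shadow(2) in \<open>auto simp: spR goodX_def\<close>)
  then have "inv_into goodX code \<in> measurable ?R (borel_of_top (trajectory_space F))"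
    using measurable_cong_sets[OF refl sets_X, of ?R] by simp
  then show ?thesis
    by (rule measurable_restrict_space2[rotated]) (use inv_code_shadow(2) in \<open>auto simp: spR\<close>)
qed

section \<open>Word growth of the components and topological entropy of both systems\<close>

lemma growth_zero_of_not_positive:
  assumes C: "irreducible_component F C" "\<not> positive_entropy F C"
  shows "exp_growth_le (\<lambda>n. card (words n (sft_restr F C))) 0"
proof -
  interpret S: symbolic F "sft_restr F C" by (rule symbolicI[OF sft_restr_sub])
  have "limsup (\<lambda>n. ennreal (ln (real (card (words n (sft_restr F C)))) / real n))
      \<le> h_top (symbolic_space F (sft_restr F C)) lshift"
    by (rule S.limsup_words_le_h_top_symbolic) (use sft_restr_lshift[of _ C 1] in auto)
  also have "\<dots> = ennreal 0" using C(2) by (simp add: positive_entropy_def)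
  finally show ?thesis by (rule exp_growth_leI_limsup) simp
qed

lemma compact_sft_restr:
  "compact_space (symbolic_space F (sft_restr F C))"
proof -
  interpret S: symbolic F "sft_restr F C" by (rule symbolicI[OF sft_restr_sub])
  show ?thesis
  proof (rule S.compactI)
    fix x assume x: "\<And>n. x n \<in> syms F" "x \<notin> sft_restr F C"
    then obtain n where n: "trans_mat F (x n) (x (Suc n)) \<noteq> 1 \<or> x n \<notin> C"
      by (auto simp: sft_restr_def sft_def)
    have "y \<notin> sft_restr F C" if y: "\<forall>i<Suc (Suc n). y i = x i" for y
    proof
      assume "y \<in> sft_restr F C"
      then have "trans_mat F (y n) (y (Suc n)) = 1" "y n \<in> C" by (auto simp: sft_restr_def sft_def)
      then show False using n y by simp
    qed
    then show "\<exists>k. \<forall>y. (\<forall>i<k. y i = x i) \<longrightarrow> y \<notin> sft_restr F C" by blast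
  qed
qed

lemma not_growth_zero_of_positive:
  assumes C: "C \<in> comps"
  shows "\<not> exp_growth_le (\<lambda>n. card (words n (sft_restr F C))) 0"
proof
  interpret S: symbolic F "sft_restr F C" by (rule symbolicI[OF sft_restr_sub])
  assume "exp_growth_le (\<lambda>n. card (words n (sft_restr F C))) 0"
  then have "h_top (symbolic_space F (sft_restr F C)) lshift \<le> ennreal 0"
    by (intro S.h_top_le compact_sft_restr) (use sft_restr_lshift[of _ C 1] in auto)
  then show False using C by (simp add: comps_def positive_entropy_def)
qed

text \<open>This uses the positive entropy of the whole shift: if all components had entropy zero,
  its words would grow subexponentially.\<close>

lemma comps_nonempty: "comps \<noteq> {}"
proof
  interpret S: symbolic F "sft F" by (rule symbolicI) simp
  assume "comps = {}"
  then have "exp_growth_le (\<lambda>n. card (words n (sft_restr F C))) 0" if "irreducible_component F C" for C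
    using that by (intro growth_zero_of_not_positive) (auto simp: comps_def)
  then have "exp_growth_le (\<lambda>n. card (words n (sft F))) 0" by (rule words_sft_growth_zero[OF fin])
  then have "h_top (symbolic_space F (sft F)) lshift \<le> ennreal 0"
    by (intro S.h_top_le compact_sft) (use sft_lshift[of _ 1] in auto)
  then show False using pos by simp
qed

text \<open>A component without infinite walks has entropy zero, which leaves the first case of
  \<open>irreducible_component_cases\<close>.\<close>

lemma comp_graph:
  assumes C: "C \<in> comps"
  shows "irreducible_graph C (edges F C)"
proof (rule irreducible_component_cases[of F C])
  show "irreducible_component F C" using C by (simp add: comps_def)
  assume "sft_restr F C = {}"
  then have "exp_growth_le (\<lambda>n. card (words n (sft_restr F C))) 0"
    by (intro exp_growth_le_eventually_0[of 0]) (simp add: words_def)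
  then show ?thesis using not_growth_zero_of_positive[OF C] by blast
qed (use fin in auto)

lemma growth_iff:
  assumes C: "C \<in> comps"
  shows "exp_growth_le (\<lambda>n. card (words n (sft_restr F C))) g \<longleftrightarrow>
    exp_growth_le (\<lambda>n. card (paths (edges F C) C n)) g"
proof -
  interpret irreducible_graph C "edges F C" by (rule comp_graph[OF C])
  have eq: "words n (sft_restr F C) = paths (edges F C) C n" if "n > 0" for n
    unfolding sft_restr_eq_walks[OF comps_syms[OF C]] by (rule words_walks[OF that])
  have *: "exp_growth_le d g" if c: "exp_growth_le c g" and e: "\<And>n. n > 0 \<Longrightarrow> c n = d n" for c d :: "nat \<Rightarrow> nat"
    unfolding exp_growth_le_def
  proof (intro allI impI)
    fix h :: real assume "h > 0"
    then have "\<forall>\<^sub>F n in sequentially. real (c n) \<le> exp (real n * (g + h))" using c by (simp add: exp_growth_le_def)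
    then show "\<forall>\<^sub>F n in sequentially. real (d n) \<le> exp (real n * (g + h))"
      using eventually_gt_at_top[of 0] by eventually_elim (simp add: e)
  qed
  show ?thesis
  proof
    assume "exp_growth_le (\<lambda>n. card (words n (sft_restr F C))) g"
    then show "exp_growth_le (\<lambda>n. card (paths (edges F C) C n)) g" by (rule *) (simp add: eq)
  next
    assume "exp_growth_le (\<lambda>n. card (paths (edges F C) C n)) g"
    then show "exp_growth_le (\<lambda>n. card (words n (sft_restr F C))) g" by (rule *) (simp add: eq)
  qed
qed

lemma growth_le_h_top_sft:
  assumes "h_top (symbolic_space F (sft F)) lshift \<le> ennreal g" "g \<ge> 0"
  shows "exp_growth_le (\<lambda>n. card (words n (sft_restr F C))) g"
proof -
  interpret S: symbolic F "sft F" by (rule symbolicI) simp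
  have "limsup (\<lambda>n. ennreal (ln (real (card (words n (sft_restr F C)))) / real n))
      \<le> h_top (symbolic_space F (sft F)) lshift"
    by (rule S.limsup_words_le_h_top_symbolic) (use sft_lshift[of _ 1] sft_restr_sub in auto)
  then show ?thesis by (intro exp_growth_leI_limsup order_trans[OF _ assms(1)] assms(2))
qed

text \<open>The bounded gaps of the anchor are used twice: they make the symbolic set compact, hence
  the sets of shadows closed, and they force each shadow to have the prescribed code, so that
  shadows with different first letters are different points.\<close>

lemma growth_le_h_top_X:
  assumes C: "C \<in> comps" and g: "h_top (trajectory_space F) lshift \<le> ennreal g" "g \<ge> 0"
  shows "exp_growth_le (\<lambda>n. card (words n (sft_restr F C))) g"
  unfolding growth_iff[OF C]
proof -
  interpret irreducible_graph C "edges F C" by (rule comp_graph[OF C])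
  let ?v = "anchor_of C"
  have v: "anchor C ?v" by (rule anchor_of[OF C])
  then have "?v \<in> language_restr F C" by (simp add: anchor_def)
  note vp = language_restr_path[OF this]
  show "exp_growth_le (\<lambda>n. card (paths (edges F C) C n)) g"
  proof (rule growth_le_of_frequent[OF vp g(2)])
    fix p
    let ?S = "frequent ?v p"
    have Ssub: "?S \<subseteq> sft_restr F C"
      unfolding sft_restr_eq_walks[OF comps_syms[OF C]] frequent_def by blast
    then have Ss: "?S \<subseteq> sft F" using sft_restr_sub by blast
    interpret S: symbolic F ?S by (rule symbolicI[OF Ss])
    have shift: "(lshift ^^ n) a \<in> ?S" if a: "a \<in> ?S" for n a
    proof -
      have w: "a \<in> walks (edges F C)" and f: "\<And>n. \<exists>m\<ge>n. m < n + p \<and> (\<forall>j<length ?v. a (m + j) = ?v ! j)"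
        using a by (auto simp: frequent_def)
      have "\<exists>m\<ge>k. m < k + p \<and> (\<forall>j<length ?v. (lshift ^^ n) a (m + j) = ?v ! j)" for k
      proof -
        obtain m where m: "m \<ge> k + n" "m < k + n + p" "\<forall>j<length ?v. a (m + j) = ?v ! j" using f by blast
        show ?thesis
        proof (intro exI[of _ "m - n"] conjI)
          show "\<forall>j<length ?v. (lshift ^^ n) a (m - n + j) = ?v ! j" using m by (simp add: lshift_funpow)
        qed (use m in auto)
      qed
      then show ?thesis unfolding frequent_def using walks_lshift[OF w] by blast
    qed
    have comp: "compact_space (symbolic_space F ?S)"
    proof (rule S.compactI)
      fix x assume "x \<notin> ?S"
      then consider n where "(x n, x (Suc n)) \<notin> edges F C"
        | n where "\<forall>m\<ge>n. m < n + p \<longrightarrow> (\<exists>j<length ?v. x (m + j) \<noteq> ?v ! j)"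
        unfolding frequent_def walks_def by blast
      then show "\<exists>k. \<forall>y. (\<forall>i<k. y i = x i) \<longrightarrow> y \<notin> ?S"
      proof cases
        case 1
        have "y \<notin> ?S" if y: "\<forall>i<Suc (Suc n). y i = x i" for y
        proof
          assume "y \<in> ?S"
          then have "(y n, y (Suc n)) \<in> edges F C" by (simp add: frequent_def walks_def)
          then show False using 1 y by simp
        qed
        then show ?thesis by blast
      next
        case 2
        \<comment> \<open>An occurrence may start at the last position of the window, so the letters
          beyond it have to be fixed as well.\<close>
        have "y \<notin> ?S" if y: "\<forall>i<n + p + length ?v. y i = x i" for y
        proof
          assume "y \<in> ?S"
          then obtain m where m: "m \<ge> n" "m < n + p" "\<And>j. j < length ?v \<Longrightarrow> y (m + j) = ?v ! j"
            unfolding frequent_def by blast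
          obtain j where j: "j < length ?v" "x (m + j) \<noteq> ?v ! j" using 2 m by blast
          have "y (m + j) = x (m + j)" using y m(2) j(1) by simp
          then show False using m(3)[OF j(1)] j(2) by simp
        qed
        then show ?thesis by blast
      qed
    qed
    have freq: "frequently ?v a" if a: "a \<in> ?S" for a
      unfolding infinite_Collect_nat_iff
    proof
      fix k
      have s: "a \<in> sft F" using a Ss by blast
      obtain m where "m \<ge> k" "\<forall>j<length ?v. a (m + j) = ?v ! j" using a unfolding frequent_def by blast
      then show "\<exists>n\<ge>k. (lshift ^^ n) a \<in> cylinder F ?v" using mem_cylinder_iff[OF s] by blast
    qed
    have code: "code x = a" if "a \<in> ?S" "x \<in> shadows a" for a x
      using code_eq_of_frequently[OF _ v freq[OF that(1)] that(2)] that(1) Ss by blast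
    obtain c0 where "c0 \<in> C" using ne by blast
    then have "syms F \<noteq> {}" using comps_syms[OF C] by blast
    have "limsup (\<lambda>n. ennreal (ln (real (card (words n ?S))) / real n)) \<le> h_top (trajectory_space F) lshift"
    proof (rule limsup_words_le_h_top[OF finite_syms \<open>syms F \<noteq> {}\<close>, where Z = "\<lambda>b. {x. \<exists>a\<in>?S. a 0 = b \<and> x \<in> shadows a}"])
      show "closedin (trajectory_space F) {x. \<exists>a\<in>?S. a 0 = b \<and> x \<in> shadows a}" for b
        by (rule closedin_shadowed[OF Ss comp])
      show "{x. \<exists>a\<in>?S. a 0 = b \<and> x \<in> shadows a} \<inter> {x. \<exists>a\<in>?S. a 0 = c \<and> x \<in> shadows a} = {}" if bc: "b \<noteq> c" for b c
      proof (rule equals0I)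
        fix x assume "x \<in> {x. \<exists>a\<in>?S. a 0 = b \<and> x \<in> shadows a} \<inter> {x. \<exists>a\<in>?S. a 0 = c \<and> x \<in> shadows a}"
        then obtain a a' where a: "a \<in> ?S" "a 0 = b" "x \<in> shadows a" "a' \<in> ?S" "a' 0 = c" "x \<in> shadows a'" by auto
        have "a = a'" using code[OF a(1,3)] code[OF a(4,6)] by (rule trans[OF sym])
        then show False using a(2,5) bc by simp
      qed
      show "lshift x \<in> topspace (trajectory_space F)" if "x \<in> topspace (trajectory_space F)" for x
        using that trajectories_lshift by (simp add: topspace_X)
      show "y n \<in> syms F" if "y \<in> ?S" for y n using S.S[OF that] .
      show "\<exists>x\<in>topspace (trajectory_space F). \<forall>n. (lshift ^^ n) x \<in> {x. \<exists>a\<in>?S. a 0 = y n \<and> x \<in> shadows a}"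
        if y: "y \<in> ?S" for y
      proof -
        have ys: "y \<in> sft F" using y Ss by blast
        obtain x where x: "x \<in> shadows y" using shadows_nonempty[OF ys] by blast
        show ?thesis
        proof (intro bexI[of _ x] allI CollectI bexI conjI)
          show "x \<in> topspace (trajectory_space F)" using shadows_trajectories[OF ys] x by (auto simp: topspace_X)
          show "(lshift ^^ n) x \<in> shadows ((lshift ^^ n) y)" for n by (rule shadows_lshift[OF x])
          show "(lshift ^^ n) y \<in> ?S" for n by (rule shift[OF y])
        qed (simp add: lshift_funpow)
      qed
    qed
    then show "exp_growth_le (\<lambda>n. card (words n ?S)) g"
      by (intro exp_growth_leI_limsup order_trans[OF _ g(1)] g(2))
  qed
qed

section \<open>Entropy of the exceptional sets and the conjugacy\<close>

lemma avoiding_growth_comp: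
  assumes C: "C \<in> comps" and w: "w \<in> language_restr F C"
    and g: "exp_growth_le (\<lambda>n. card (words n (sft_restr F C))) g"
  obtains h where "h < g"
    "exp_growth_le (\<lambda>n. card (words n {a \<in> sft_restr F C. \<forall>n. (lshift ^^ n) a \<notin> cylinder F w})) h"
proof -
  interpret irreducible_graph C "edges F C" by (rule comp_graph[OF C])
  obtain h where h: "h < g" "exp_growth_le (\<lambda>n. card (avoiding_paths w n)) h"
    by (rule avoiding_growth[OF language_restr_path[OF w] g[unfolded growth_iff[OF C]]])
  have "exp_growth_le (\<lambda>n. card (words n {a \<in> sft_restr F C. \<forall>n. (lshift ^^ n) a \<notin> cylinder F w})) h"
  proof (rule exp_growth_le_mono[OF h(2)])
    fix n
    have "words n {a \<in> sft_restr F C. \<forall>n. (lshift ^^ n) a \<notin> cylinder F w} \<subseteq> avoiding_paths w n"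
    proof
      fix u assume "u \<in> words n {a \<in> sft_restr F C. \<forall>n. (lshift ^^ n) a \<notin> cylinder F w}"
      then obtain a where a: "a \<in> sft_restr F C" "\<And>n. (lshift ^^ n) a \<notin> cylinder F w" and u: "u = map a [0..<n]"
        by (auto simp: words_def)
      have s: "a \<in> sft F" using a(1) sft_restr_sub by blast
      have "u \<in> words n (walks (edges F C))"
        using a(1) u unfolding sft_restr_eq_walks[OF comps_syms[OF C]] words_def by blast
      then have "u \<in> paths (edges F C) C n" using words_subset_paths[OF EC] by blast
      moreover have "\<not> sublist w u"
      proof
        assume "sublist w u"
        then obtain ps ss where e: "u = ps @ w @ ss" by (auto simp: sublist_def)
        have "a (length ps + i) = w ! i" if i: "i < length w" for i
        proof -
          have "length ps + i < n" using arg_cong[OF e, of length] i unfolding u by simp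
          then have "a (length ps + i) = u ! (length ps + i)" unfolding u by simp
          also have "\<dots> = w ! i" unfolding e using i by (simp add: nth_append)
          finally show ?thesis .
        qed
        then show False using a(2)[of "length ps"] mem_cylinder_iff[OF s] by blast
      qed
      ultimately show "u \<in> avoiding_paths w n" by (simp add: avoiding_paths_def)
    qed
    moreover have "finite (avoiding_paths w n)" using finite_paths[OF fin] by (simp add: avoiding_paths_def)
    ultimately show "card (words n {a \<in> sft_restr F C. \<forall>n. (lshift ^^ n) a \<notin> cylinder F w}) \<le> card (avoiding_paths w n)"
      by (rule card_mono[rotated])
  qed simp
  with h(1) show ?thesis by (rule that)
qed

text \<open>To be applied with \<open>\<phi>\<close> the coding map and with \<open>\<phi>\<close> the identity.\<close>

lemma h_prob_bad_less:
  fixes Y :: "'x topology" and T :: "'x \<Rightarrow> 'x" and \<phi> :: "'x \<Rightarrow> nat \<Rightarrow> 'a"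
  assumes \<phi>: "\<And>x. x \<in> topspace Y \<Longrightarrow> \<phi> x \<in> sft F" "\<And>x. x \<in> topspace Y \<Longrightarrow> \<phi> (T x) = lshift (\<phi> x)"
    and meas: "\<And>a. {x \<in> topspace Y. \<phi> x 0 = a} \<in> sets (borel_of_top Y)"
    and bound: "\<And>\<mu> S h. invariant_prob Y T \<mu> \<Longrightarrow> S \<subseteq> topspace Y \<Longrightarrow> AE x in \<mu>. x \<in> S \<Longrightarrow> h \<ge> 0 \<Longrightarrow>
      exp_growth_le (\<lambda>n. card (words n (\<phi> ` S))) h \<Longrightarrow> h_measure \<mu> T \<le> ennreal h"
    and lower: "\<And>C g. C \<in> comps \<Longrightarrow> h_top Y T \<le> ennreal g \<Longrightarrow> g \<ge> 0 \<Longrightarrow>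
      exp_growth_le (\<lambda>n. card (words n (sft_restr F C))) g"
  shows "h_prob Y T {x \<in> topspace Y. \<phi> x \<notin> good} < h_top Y T"
proof -
  \<comment> \<open>A finite positive number, at most \<open>h_top\<close>, that bounds the growth
    of every component of positive entropy. For infinite \<open>h_top\<close> a crude bound by the
    size of the alphabet serves.\<close>
  have "\<exists>g>0. ennreal g \<le> h_top Y T \<and> (\<forall>C\<in>comps. exp_growth_le (\<lambda>n. card (words n (sft_restr F C))) g)"
  proof (cases "h_top Y T = \<top>")
    case True
    \<comment> \<open>The increments keep the base of the powers at least 1 and \<open>g\<close>
      positive.\<close>
    define g where "g = ln (real (card (syms F)) + 1) + 1"
    have "ln (real (card (syms F)) + 1) \<ge> 0" by simp
    then have "g > 0" unfolding g_def by linarith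
    moreover have "exp_growth_le (\<lambda>n. card (words n (sft_restr F C))) g" for C
      unfolding exp_growth_le_def
    proof (intro allI impI always_eventually)
      fix e :: real and n :: nat assume e: "e > 0"
      have "card (words n (sft_restr F C)) \<le> card {xs. set xs \<subseteq> syms F \<and> length xs = n}"
        by (rule card_mono[OF finite_lists_length_eq[OF fin]])
           (auto simp: words_def sft_restr_def sft_def)
      also have "\<dots> = card (syms F) ^ n" by (rule card_lists_length_eq[OF fin])
      finally have "real (card (words n (sft_restr F C))) \<le> real (card (syms F) ^ n)" by (rule of_nat_mono)
      also have "\<dots> = real (card (syms F)) ^ n" by simp
      also have "\<dots> \<le> (real (card (syms F)) + 1) ^ n" by (intro power_mono) auto
      also have "\<dots> = exp (real n * ln (real (card (syms F)) + 1))" by (simp add: exp_of_nat_mult)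
      also have "\<dots> \<le> exp (real n * (g + e))" using e by (simp add: g_def mult_left_mono)
      finally show "real (card (words n (sft_restr F C))) \<le> exp (real n * (g + e))" .
    qed
    ultimately show ?thesis using True by (intro exI[of _ g]) simp
  next
    case False
    define g where "g = enn2real (h_top Y T)"
    have g: "h_top Y T = ennreal g" "g \<ge> 0" using False by (simp_all add: g_def less_top)
    have gr: "exp_growth_le (\<lambda>n. card (words n (sft_restr F C))) g" if "C \<in> comps" for C
      by (rule lower[OF that _ g(2)]) (simp add: g(1))
    obtain C where C: "C \<in> comps" using comps_nonempty by blast
    \<comment> \<open>For \<open>g = 0\<close> a component of positive entropy would grow
      subexponentially.\<close>
    have "g \<noteq> 0" using gr[OF C] not_growth_zero_of_positive[OF C] by auto
    then show ?thesis using g gr by (intro exI[of _ g]) auto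
  qed
  then obtain g where g: "g > 0" "ennreal g \<le> h_top Y T"
    "\<And>C. C \<in> comps \<Longrightarrow> exp_growth_le (\<lambda>n. card (words n (sft_restr F C))) g" by blast
  let ?av = "\<lambda>C w. {a \<in> sft_restr F C. \<forall>n. (lshift ^^ n) a \<notin> cylinder F w}"
  have "\<exists>h. 0 \<le> h \<and> h < g \<and> exp_growth_le (\<lambda>n. card (words n (?av C (coding_word_of C)))) h \<and>
      exp_growth_le (\<lambda>n. card (words n (?av C (anchor_of C)))) h" if C: "C \<in> comps" for C
  proof -
    have u: "coding_word_of C \<in> language_restr F C" using coding_word_of[OF C] by (simp add: coding_word_def)
    have v: "anchor_of C \<in> language_restr F C" using anchor_of[OF C] by (simp add: anchor_def)
    obtain h1 where h1: "h1 < g" "exp_growth_le (\<lambda>n. card (words n (?av C (coding_word_of C)))) h1"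
      by (rule avoiding_growth_comp[OF C u g(3)[OF C]])
    obtain h2 where h2: "h2 < g" "exp_growth_le (\<lambda>n. card (words n (?av C (anchor_of C)))) h2"
      by (rule avoiding_growth_comp[OF C v g(3)[OF C]])
    \<comment> \<open>The rates obtained by forbidding a word may be negative, whereas
      \<open>bound\<close> takes nonnegative rates.\<close>
    let ?h = "max 0 (max h1 h2)"
    have "exp_growth_le (\<lambda>n. card (words n (?av C (coding_word_of C)))) ?h" by (rule exp_growth_le_mono[OF h1(2)]) auto
    moreover have "exp_growth_le (\<lambda>n. card (words n (?av C (anchor_of C)))) ?h" by (rule exp_growth_le_mono[OF h2(2)]) auto
    ultimately show ?thesis using h1(1) h2(1) g(1) by (intro exI[of _ ?h]) simp
  qed
  then have "\<forall>C\<in>comps. \<exists>h. 0 \<le> h \<and> h < g \<and> exp_growth_le (\<lambda>n. card (words n (?av C (coding_word_of C)))) h \<and>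
      exp_growth_le (\<lambda>n. card (words n (?av C (anchor_of C)))) h" by blast
  from bchoice[OF this] obtain H where "\<forall>C\<in>comps. 0 \<le> H C \<and> H C < g \<and>
      exp_growth_le (\<lambda>n. card (words n (?av C (coding_word_of C)))) (H C) \<and>
      exp_growth_le (\<lambda>n. card (words n (?av C (anchor_of C)))) (H C)" by (rule exE)
  then have H: "0 \<le> H C" "H C < g" "exp_growth_le (\<lambda>n. card (words n (?av C (coding_word_of C)))) (H C)"
    "exp_growth_le (\<lambda>n. card (words n (?av C (anchor_of C)))) (H C)" if "C \<in> comps" for C using that by simp_all
  \<comment> \<open>A maximum over finitely many components stays below \<open>g\<close>, which
    makes the bound uniform in the measure. The entry 0 covers the components of entropy
    zero.\<close>
  define M where "M = Max (insert 0 (H ` comps))"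
  have M: "M < g" "0 \<le> M" "\<And>C. C \<in> comps \<Longrightarrow> H C \<le> M"
    unfolding M_def using finite_comps g(1) H(2) by auto
  have "h_prob Y T {x \<in> topspace Y. \<phi> x \<notin> good} \<le> ennreal M"
    unfolding h_prob_def
  proof (rule SUP_least)
    fix \<mu> assume "\<mu> \<in> {\<mu>. ergodic_prob Y T \<mu> \<and> measure \<mu> {x \<in> topspace Y. \<phi> x \<notin> good} > 0}"
    then have erg: "ergodic_prob Y T \<mu>" and bad: "measure \<mu> {x \<in> topspace Y. \<phi> x \<notin> good} > 0" by auto
    have inv: "invariant_prob Y T \<mu>" using erg by (simp add: ergodic_prob_def)
    then have st: "sets \<mu> = sets (borel_of_top Y)" by (simp add: invariant_prob_def)
    interpret ergodic_coding F Y T \<mu> \<phi>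
      by unfold_locales (use erg fin \<phi> meas st in auto)
    have fw: "finite (words n (sft_restr F C))" for n C
      by (rule finite_subset[OF _ finite_lists_length_eq[OF fin, of n]])
         (auto simp: words_def sft_restr_def sft_def)
    have bd: "h_measure \<mu> T \<le> ennreal M"
      if P: "AE x in \<mu>. \<phi> x \<in> A" and A: "A \<subseteq> sft_restr F C"
        and h: "0 \<le> h" "h \<le> M" "exp_growth_le (\<lambda>n. card (words n A)) h" for A C h
    proof -
      let ?S = "{x \<in> topspace Y. \<phi> x \<in> A}"
      have "h_measure \<mu> T \<le> ennreal h"
      proof (rule bound[OF inv _ _ h(1)])
        show "AE x in \<mu>. x \<in> ?S" using P by (rule AE_mp) (rule AE_I2, simp add: space)
        show "exp_growth_le (\<lambda>n. card (words n (\<phi> ` ?S))) h"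
        proof (rule exp_growth_le_mono[OF h(3)])
          fix n
          have "finite (words n A)" using fw words_mono[OF A] by (rule rev_finite_subset)
          then show "card (words n (\<phi> ` ?S)) \<le> card (words n A)" by (rule card_mono) (auto simp: words_def)
        qed simp
      qed blast
      also have "\<dots> \<le> ennreal M" using h(2) by (rule ennreal_leI)
      finally show ?thesis .
    qed
    obtain C where C: "irreducible_component F C" "AE x in \<mu>. \<phi> x \<in> sft_restr F C" by (rule component)
    show "h_measure \<mu> T \<le> ennreal M"
    proof (cases "positive_entropy F C")
      case False
      show ?thesis
        by (rule bd[OF C(2) subset_refl _ M(2) growth_zero_of_not_positive[OF C(1) False]]) simp
    next
      case True
      then have Cc: "C \<in> comps" using C(1) by (simp add: comps_def)
      have avoid: "AE x in \<mu>. \<phi> x \<in> ?av C w" if "AE x in \<mu>. \<forall>n. (lshift ^^ n) (\<phi> x) \<notin> cylinder F w" for w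
        using C(2) that by eventually_elim simp
      from word_dichotomy[of "coding_word_of C"] show ?thesis
      proof
        assume "AE x in \<mu>. \<forall>n. (lshift ^^ n) (\<phi> x) \<notin> cylinder F (coding_word_of C)"
        from bd[OF avoid[OF this] _ H(1)[OF Cc] M(3)[OF Cc] H(3)[OF Cc]] show ?thesis by blast
      next
        assume fu: "AE x in \<mu>. frequently (coding_word_of C) (\<phi> x)"
        from word_dichotomy[of "anchor_of C"] show ?thesis
        proof
          assume "AE x in \<mu>. \<forall>n. (lshift ^^ n) (\<phi> x) \<notin> cylinder F (anchor_of C)"
          from bd[OF avoid[OF this] _ H(1)[OF Cc] M(3)[OF Cc] H(4)[OF Cc]] show ?thesis by blast
        next
          assume fv: "AE x in \<mu>. frequently (anchor_of C) (\<phi> x)"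
          \<comment> \<open>Both words recur, so almost every code is good and the measure cannot
            charge the bad set.\<close>
          have "AE x in \<mu>. x \<notin> {x \<in> topspace Y. \<phi> x \<notin> good}"
            using C(2) fu fv
          proof eventually_elim
            fix x assume "\<phi> x \<in> sft_restr F C" "frequently (coding_word_of C) (\<phi> x)" "frequently (anchor_of C) (\<phi> x)"
            then have "\<phi> x \<in> good" by (rule goodI[OF Cc])
            then show "x \<notin> {x \<in> topspace Y. \<phi> x \<notin> good}" by blast
          qed
          then have "measure \<mu> {x \<in> topspace Y. \<phi> x \<notin> good} = 0"
          \<comment> \<open>Measurability of the bad set is not among the assumptions here; outside
            \<open>sets \<mu>\<close> the value of \<open>measure\<close> is 0 by
            convention.\<close>
          proof (cases "{x \<in> topspace Y. \<phi> x \<notin> good} \<in> sets \<mu>")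
            case True
            then show ?thesis using prob_space.prob_eq_0[OF prob True] \<open>AE x in \<mu>. x \<notin> _\<close> by blast
          qed (rule measure_notin_sets)
          then show ?thesis using bad by simp
        qed
      qed
    qed
  qed
  also have "ennreal M < ennreal g" using M(1,2) by (simp add: ennreal_less_iff)
  also have "\<dots> \<le> h_top Y T" by (rule g(2))
  finally show ?thesis .
qed

lemma conjugate:
  "borel_entropy_conjugate (trajectory_space F) lshift (symbolic_space F (sft F)) lshift"
proof -
  interpret S: symbolic F "sft F" by (rule symbolicI) simp
  let ?X = "trajectory_space F" and ?Y = "symbolic_space F (sft F)"
  let ?E0 = "trajectories F - goodX" and ?E1 = "sft F - good"
  have d0: "topspace ?X - ?E0 = goodX" by (auto simp: topspace_X goodX_def)
  have d1: "topspace ?Y - ?E1 = good" using good_sft by (auto simp: S.topspace)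
  have e0: "?E0 = {x \<in> topspace ?X. code x \<notin> good}" by (auto simp: topspace_X goodX_def)
  have e1: "?E1 = {x \<in> topspace ?Y. x \<notin> good}" by (auto simp: S.topspace)
  have s0: "?E0 \<in> sets (borel_of_top ?X)"
    using sets.compl_sets[OF goodX_sets] by (simp add: space_borel_of_top topspace_X)
  have s1: "?E1 \<in> sets (borel_of_top ?Y)"
    using sets.compl_sets[OF good_sets] by (simp add: space_borel_of_top S.topspace)
  have m: "code \<in> measurable (restrict_space (borel_of_top ?X) goodX) (restrict_space (borel_of_top ?Y) good)"
    by (rule measurable_restrict_space3[OF code_measurable]) (simp add: goodX_def)
  have h0: "h_prob ?X lshift ?E0 < h_top ?X lshift"
    unfolding e0
  proof (rule h_prob_bad_less)
    show "code x \<in> sft F" if "x \<in> topspace ?X" for x using that code_sft by (simp add: topspace_X)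
    show "{x \<in> topspace ?X. code x 0 = a} \<in> sets (borel_of_top ?X)" for a
      unfolding topspace_X by (rule code_letter_sets)
    show "h_measure \<mu> lshift \<le> ennreal h"
      if "invariant_prob ?X lshift \<mu>" "S \<subseteq> topspace ?X" "AE x in \<mu>. x \<in> S" "h \<ge> 0"
        "exp_growth_le (\<lambda>n. card (words n (code ` S))) h" for \<mu> S h
      using that by (intro h_measure_le_words_X[where S = S]) (simp_all add: topspace_X)
  qed (rule code_lshift, rule growth_le_h_top_X)
  have h1: "h_prob ?Y lshift ?E1 < h_top ?Y lshift"
    unfolding e1
  proof (rule h_prob_bad_less[where \<phi> = "\<lambda>x. x"])
    show "{x \<in> topspace ?Y. x 0 = a} \<in> sets (borel_of_top ?Y)" for a
      unfolding S.topspace by (rule S.letter_sets)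
    show "h_measure \<mu> lshift \<le> ennreal h"
      if "invariant_prob ?Y lshift \<mu>" "S \<subseteq> topspace ?Y" "AE x in \<mu>. x \<in> S" "h \<ge> 0"
        "exp_growth_le (\<lambda>n. card (words n ((\<lambda>x. x) ` S))) h" for \<mu> S h
      using that by (intro S.h_measure_le_words[where S' = S]) (simp_all add: S.topspace)
    show "exp_growth_le (\<lambda>n. card (words n (sft_restr F C))) g"
      if "C \<in> comps" "h_top ?Y lshift \<le> ennreal g" "g \<ge> 0" for C g
      by (rule growth_le_h_top_sft[OF that(2,3)])
  qed (simp_all add: S.topspace)
  have eq: "lshift x \<in> goodX \<and> code (lshift x) = lshift (code x)" if "x \<in> goodX" for x
    using that good_lshift[of "code x" 1] trajectories_lshift code_lshift by (simp add: goodX_def)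
  show ?thesis unfolding borel_entropy_conjugate_def
  proof (intro conjI exI[of _ ?E0] exI[of _ ?E1] exI[of _ code])
    show "\<forall>x\<in>topspace ?X - ?E0. lshift x \<in> topspace ?X - ?E0 \<and> code (lshift x) = lshift (code x)"
      unfolding d0 using eq by blast
  qed ((unfold d0 d1)?, rule tds_X tds_sft s0 s1 h0 h1 m bij_code inv_code_measurable)+
qed

end

theorem theorem1p1:
  fixes F :: "'a markov_tuple"
  assumes "F \<in> class_F"
  shows "borel_entropy_conjugate (trajectory_space F) lshift (symbolic_space F (sft F)) lshift"
proof -
  interpret markov_F F
    by unfold_locales (use assms in \<open>auto simp: class_F_def\<close>)
  show ?thesis by (rule conjugate)
qed

end
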